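(* Let $e\ge 1$, $m\ge 0$ be integers, let $Y$ be a totally ordered set with $d=em+1$ elements and $\pi:Y\to\mathbb{N}$ a map all of whose fibres have at most $e$ elements, and let $\mathbb{S}'=(\mathbb{S}_{\xi_1,\xi_2})_{\xi_1,\xi_2\in E'}$ be the associated Fourier matrix for the imprimitive complex reflection groups $G(e,1,n)$ (defined in the context). Choose $a_1,\dots,a_r\in\mathbb{Z}$ such that $$\xi_0=(a_1,\ldots,a_1+n_1-1)\otimes\cdots\otimes(a_r,\ldots,a_r+n_r-1)\in E'.$$ Then $\mathbb{S}'$ with unit $\xi_0$ defines a $\mathbb{Z}$-algebra $R$ with a basis $B=\{b_\xi\mid \xi\in E'\}$, and there are signs $\eta_\xi\in\{1,-1\}$ ($\xi\in E'$) such that, with $B'=\{\eta_\xi b_\xi\mid\xi\in E'\}$, the pair $(R,B')$ is a $\mathbb{Z}$-based ring.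
   Context: **The matrix $\mathbb{S}'$.** Put $\zeta=\exp(2\pi \mathrm{i}/e)$. Let $\pi(Y)=\{w_1,\dots,w_r\}$ with $w_1,\dots,w_r$ distinct, and $n_\mu=|\pi^{-1}(w_\mu)|\le e$. Let $\Xi$ be the set of all maps $\psi:Y\to\{0,\dots,e-1\}$ such that $\psi(y)<\psi(y')$ whenever $y<y'$ and $\pi(y)=\pi(y')$. For $\psi\in\Xi$ put $\epsilon(\psi)=(-1)^{|\{(y,y')\in Y\times Y\,\mid\, y<y',\ \psi(y)<\psi(y')\}|}$. Identify $\psi\in\Xi$ with the symbol $\bar i^1\otimes\cdots\otimes\bar i^r$, where $\bar i^\mu=(i^\mu_1,\dots,i^\mu_{n_\mu})$, $0\le i_1^\mu<\dots<i^\mu_{n_\mu}\le e-1$, and $\{i_1^\mu,\dots,i_{n_\mu}^\mu\}=\psi(\pi^{-1}(w_\mu))$; let $E$ be the set of all such symbols (in bijection with $\Xi$). Put $c=(-1)^{m(e-1)}\,\mathrm{i}^{-\binom{e-1}{2}m}\sqrt{e}^{\,d-em}$. The matrix $\mathbb{S}$, indexed by $E\cong\Xi$, is defined, for $\psi_1=\bar i^1\otimes\cdots\otimes\bar i^r$ and $\psi_2=\bar j^1\otimes\cdots\otimes\bar j^r$, by $$\overline{\mathbb{S}_{\psi_1,\psi_2}}=\bar c\,\epsilon(\psi_1)\epsilon(\psi_2)\prod_{\mu=1}^r\ \sum_{\sigma\in S_{n_\mu}}\operatorname{sgn}(\sigma)\prod_{\nu=1}^{n_\mu}\frac{1}{\sqrt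 e}\,\zeta^{\,i^\mu_\nu j^\mu_{\sigma(\nu)}}.$$ Let $E'$ be the set of $\bar i^1\otimes\cdots\otimes\bar i^r\in E$ with $\sum_{\mu=1}^r\sum_{\nu=1}^{n_\mu} i^\mu_\nu\equiv m\binom{e}{2}\pmod e$, and $\mathbb{S}'=(\mathbb{S}_{\xi_1,\xi_2})_{\xi_1,\xi_2\in E'}$. The Fourier matrices for the groups $G(e,1,n)$ decompose into blocks of the form $\mathbb{S}'$. In the definition of $\xi_0$ the entries of each tuple are taken modulo $e$ and arranged in increasing order. **Algebra defined by a matrix.** Let $S\in\mathbb{C}^{N\times N}$ satisfy $S\bar S^t=1$ and let $i_0$ be a column all of whose entries are non-zero. Divide each row of $S$ by its entry in column $i_0$ to get a matrix $s$. If the $\mathbb{Z}$-lattice spanned by the columns of $s$ in $\mathbb{C}^N$ is closed under componentwise multiplication, it is a $\mathbb{Z}$-algebra $R$ with the columns of $s$ as a $\mathbb{Z}$-basis $B$ (column $i_0$ giving $1$), and one says that $S$ with unit $i_0$ defines the $\mathbb{Z}$-algebra $R$ (and the basis $B$). **$\mathbb{Z}$-based ring.** A pair $(R,B)$, where $R$ is a finitely generated commutative $\mathbb{Z}$-algebra that is a free $\mathbb{Z}$-module with basis $B=\{b_0=1,\dots,b_{N-1}\}$ and structure constants $b_ib_j=\sum_k N_{ij}^kb_k$, $N_{ij}^k\in\mathbb{Z}$, such that there is an involution $\sim:R\to R$ which is a $\mathbb{Z}$-module homomorphism with $\tilde B=B$, $N_{\tilde i\tilde j}^k=N_{ij}^{\tilde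 k}$ and $N_{\tilde i j}^0=\delta_{i,j}$ for all $i,j,k$, where $\tilde i$ is the index with $\widetilde{b_i}=b_{\tilde i}$. (Structure constants may be negative.) *)

theory Defs
  imports
    "HOL-Analysis.Analysis"
    "HOL-Combinatorics.Permutations"
    "HOL-Number_Theory.Cong"
    "HOL-Algebra.Ring"
begin

section \<open>Based rings\<close>

text \<open>Finiteness of \<open>B\<close> is part of the notion, so \<^const>\<open>finsum\<close> is never applied
  to an infinite set here.\<close>

definition Z_basis :: "('a, 'r) ring_scheme \<Rightarrow> 'a set \<Rightarrow> bool" where
  "Z_basis R B \<longleftrightarrow> finite B \<and> B \<subseteq> carrier R \<and>
     (\<forall>x\<in>carrier R. \<exists>!c. c \<in> B \<rightarrow>\<^sub>E (UNIV :: int set) \<and>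
        x = (\<Oplus>\<^bsub>R\<^esub>b\<in>B. [c b] \<cdot>\<^bsub>R\<^esub> b))"

text \<open>The basis elements index themselves: \<open>N a b k\<close> is the coefficient of \<open>k \<in> B\<close> in
  \<open>a \<otimes> b\<close>, and the index \<open>0\<close> of \<open>b\<^sub>0 = 1\<close> is the element \<open>\<one>\<close>.\<close>

definition Z_based_ring :: "('a, 'r) ring_scheme \<Rightarrow> 'a set \<Rightarrow> bool" where
  "Z_based_ring R B \<longleftrightarrow> cring R \<and> Z_basis R B \<and> \<one>\<^bsub>R\<^esub> \<in> B \<and>
     (\<exists>(N :: 'a \<Rightarrow> 'a \<Rightarrow> 'a \<Rightarrow> int) (t :: 'a \<Rightarrow> 'a).
        (\<forall>a\<in>B. \<forall>b\<in>B. a \<otimes>\<^bsub>R\<^esub> b = (\<Oplus>\<^bsub>R\<^esub>k\<in>B. [N a b k] \<cdot>\<^bsub>R\<^esub> k)) \<and>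
        t \<in> carrier R \<rightarrow> carrier R \<and>
        (\<forall>x\<in>carrier R. \<forall>y\<in>carrier R. t (x \<oplus>\<^bsub>R\<^esub> y) = t x \<oplus>\<^bsub>R\<^esub> t y) \<and>
        (\<forall>x\<in>carrier R. t (t x) = x) \<and>
        t ` B = B \<and>
        (\<forall>a\<in>B. \<forall>b\<in>B. \<forall>k\<in>B. N (t a) (t b) k = N a b (t k)) \<and>
        (\<forall>a\<in>B. \<forall>b\<in>B. N (t a) b \<one>\<^bsub>R\<^esub> = (if a = b then 1 else 0)))"


section \<open>Algebra defined by a matrix\<close>

text \<open>A complex matrix with rows and columns indexed by a finite set \<open>I\<close> is a function
  \<open>S :: 'i \<Rightarrow> 'i \<Rightarrow> complex\<close>, first argument the row, of which only the values on \<open>I \<times> I\<close>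
  matter; vectors in \<open>\<complex>\<^sup>I\<close> are extensional functions on \<open>I\<close>.\<close>

definition norm_col :: "'i set \<Rightarrow> ('i \<Rightarrow> 'i \<Rightarrow> complex) \<Rightarrow> 'i \<Rightarrow> 'i \<Rightarrow> ('i \<Rightarrow> complex)" where
  "norm_col I S i0 j = (\<lambda>i\<in>I. S i j / S i i0)"

definition col_lattice :: "'i set \<Rightarrow> ('i \<Rightarrow> 'i \<Rightarrow> complex) \<Rightarrow> 'i \<Rightarrow> ('i \<Rightarrow> complex) set" where
  "col_lattice I S i0 =
     {f. \<exists>c :: 'i \<Rightarrow> int. f = (\<lambda>i\<in>I. \<Sum>j\<in>I. of_int (c j) * norm_col I S i0 j i)}"

definition mat_alg :: "'i set \<Rightarrow> ('i \<Rightarrow> 'i \<Rightarrow> complex) \<Rightarrow> 'i \<Rightarrow> ('i \<Rightarrow> complex) ring" where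
  "mat_alg I S i0 =
     \<lparr>carrier = col_lattice I S i0,
      mult = (\<lambda>f g. \<lambda>i\<in>I. f i * g i),
      one = (\<lambda>i\<in>I. 1),
      zero = (\<lambda>i\<in>I. 0),
      add = (\<lambda>f g. \<lambda>i\<in>I. f i + g i)\<rparr>"

text \<open>If this holds, the algebra defined by \<open>S\<close> with unit \<open>i0\<close> is \<open>mat_alg I S i0\<close> and its
  basis consists of the columns \<open>norm_col I S i0 j\<close> for \<open>j \<in> I\<close>.\<close>

definition defines_Z_algebra :: "'i set \<Rightarrow> ('i \<Rightarrow> 'i \<Rightarrow> complex) \<Rightarrow> 'i \<Rightarrow> bool" where
  "defines_Z_algebra I S i0 \<longleftrightarrow>
     finite I \<and> i0 \<in> I \<and>
     (\<forall>i\<in>I. \<forall>j\<in>I. (\<Sum>k\<in>I. S i k * cnj (S j k)) = (if i = j then 1 else 0)) \<and>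
     (\<forall>i\<in>I. S i i0 \<noteq> 0) \<and>
     (\<forall>f\<in>col_lattice I S i0. \<forall>g\<in>col_lattice I S i0. (\<lambda>i\<in>I. f i * g i) \<in> col_lattice I S i0)"


section \<open>The Fourier matrix\<close>

definition fib :: "'a set \<Rightarrow> ('a \<Rightarrow> nat) \<Rightarrow> nat \<Rightarrow> 'a set" where
  "fib Y \<pi> w = {y \<in> Y. \<pi> y = w}"

definition Xi :: "nat \<Rightarrow> 'a::linorder set \<Rightarrow> ('a \<Rightarrow> nat) \<Rightarrow> ('a \<Rightarrow> nat) set" where
  "Xi e Y \<pi> =
     {\<psi> \<in> Y \<rightarrow>\<^sub>E {0..<e}. \<forall>y\<in>Y. \<forall>y'\<in>Y. y < y' \<and> \<pi> y = \<pi> y' \<longrightarrow> \<psi> y < \<psi> y'}"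

definition eps :: "'a::linorder set \<Rightarrow> ('a \<Rightarrow> nat) \<Rightarrow> complex" where
  "eps Y \<psi> = (-1) ^ card {(y, y'). y \<in> Y \<and> y' \<in> Y \<and> y < y' \<and> \<psi> y < \<psi> y'}"

text \<open>The tensor factors of a symbol are indexed by the values \<open>w \<in> \<pi> ` Y\<close> themselves rather
  than by an enumeration \<open>w\<^sub>1, \<dots>, w\<^sub>r\<close> of them. The factor at \<open>w\<close> is an increasing
  list, and its entry number \<open>\<nu>\<close> is counted from \<open>0\<close>. The set of symbols is not introduced
  separately: its elements are represented by the maps \<open>\<psi>\<close> they come from.\<close>

definition symb :: "'a set \<Rightarrow> ('a \<Rightarrow> nat) \<Rightarrow> ('a \<Rightarrow> nat) \<Rightarrow> nat \<Rightarrow> nat list" where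
  "symb Y \<pi> \<psi> = (\<lambda>w \<in> \<pi> ` Y. sorted_list_of_set (\<psi> ` fib Y \<pi> w))"

definition zeta :: "nat \<Rightarrow> complex" where
  "zeta e = exp (2 * of_real pi * \<i> / of_nat e)"

definition cfac :: "nat \<Rightarrow> nat \<Rightarrow> nat \<Rightarrow> complex" where
  "cfac e m d = (-1) ^ (m * (e - 1)) * \<i> powi (- int (((e - 1) choose 2) * m)) *
     of_real (sqrt (real e)) powi (int d - int (e * m))"

definition Smat ::
  "nat \<Rightarrow> nat \<Rightarrow> 'a::linorder set \<Rightarrow> ('a \<Rightarrow> nat) \<Rightarrow> ('a \<Rightarrow> nat) \<Rightarrow> ('a \<Rightarrow> nat) \<Rightarrow> complex" where
  "Smat e m Y \<pi> \<psi>1 \<psi>2 = cnj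
     (cnj (cfac e m (card Y)) * eps Y \<psi>1 * eps Y \<psi>2 *
      (\<Prod>w \<in> \<pi> ` Y. \<Sum>\<sigma> | \<sigma> permutes {..<card (fib Y \<pi> w)}.
         of_int (sign \<sigma>) *
         (\<Prod>\<nu> < card (fib Y \<pi> w). 1 / of_real (sqrt (real e)) *
            zeta e ^ ((symb Y \<pi> \<psi>1 w ! \<nu>) * (symb Y \<pi> \<psi>2 w ! \<sigma> \<nu>)))))"

definition E' :: "nat \<Rightarrow> nat \<Rightarrow> 'a::linorder set \<Rightarrow> ('a \<Rightarrow> nat) \<Rightarrow> ('a \<Rightarrow> nat) set" where
  "E' e m Y \<pi> =
     {\<psi> \<in> Xi e Y \<pi>. [(\<Sum>w \<in> \<pi> ` Y. sum_list (symb Y \<pi> \<psi> w)) = m * (e choose 2)] (mod e)}"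

text \<open>The symbol \<open>(a\<^sub>1, \<dots>, a\<^sub>1 + n\<^sub>1 - 1) \<otimes> \<dots> \<otimes> (a\<^sub>r, \<dots>, a\<^sub>r + n\<^sub>r - 1)\<close>,
  with entries reduced modulo \<open>e\<close> and arranged in increasing order.\<close>

definition interval_symb ::
  "nat \<Rightarrow> 'a set \<Rightarrow> ('a \<Rightarrow> nat) \<Rightarrow> (nat \<Rightarrow> int) \<Rightarrow> nat \<Rightarrow> nat list" where
  "interval_symb e Y \<pi> a = (\<lambda>w \<in> \<pi> ` Y.
     sort (map (\<lambda>k. nat ((a w + int k) mod int e)) [0..<card (fib Y \<pi> w)]))"

end

theory Submission
  imports Defs
begin

text \<open>
  Up to a scalar and signs, the entries of \<open>\<S>\<close> are the alternants
  \<open>D \<psi> g = \<Sum>\<^sub>\<sigma> sgn \<sigma> \<Prod>\<^sub>y \<chi> (\<psi> (\<sigma> y) g y)\<close>, the sum running over the permutations of \<open>Y\<close>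
  that preserve the fibres of \<open>\<pi>\<close> and \<open>\<chi>\<close> being a faithful character of \<open>\<int>/e\<close>. They make sense for
  all \<open>g : Y \<rightarrow> \<int>\<close>. Adding a constant to \<open>g\<close> changes the sum of its values by \<open>d \<equiv> 1 (mod e)\<close>
  times that constant and multiplies \<open>D \<psi> g\<close>, for \<open>\<psi> \<in> E'\<close>, by a sign; hence the functions
  \<open>D _ g\<close> on \<open>E'\<close> span the same lattice as those with \<open>g \<in> E'\<close>, and \<open>\<S>'\<close> inherits unitarity
  from the orthogonality of characters.

  By Pieri's rule this lattice is stable under multiplication by the elementary symmetric functions
  of the values \<open>\<chi> (\<psi> y)\<close>, \<open>y\<close> in a fibre. These are the coefficients of a linear recurrence which
  moves the entries of \<open>g\<close> into the windows \<open>a, \<dots>, a + n - 1\<close>, so every \<open>D _ g\<close> is a multiple of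
  \<open>D _ \<xi>\<^sub>0\<close> by a polynomial in elementary symmetric functions. This yields both the non-vanishing of
  column \<open>\<xi>\<^sub>0\<close> and the closure under multiplication.

  The involution is complex conjugation: it acts on columns as the reflection
  \<open>j \<mapsto> 2 a + n - 1 - j\<close> of every fibre, up to sign. A choice of \<open>\<eta>\<close> exists because on a column fixed by
  the reflection the sign is \<open>1\<close>: the reflection permutes the entries of that column and those of
  \<open>\<xi>\<^sub>0\<close> by involutions with the same number of fixed points in every fibre, hence of equal sign.
\<close>

section \<open>Based rings from unitary matrices\<close>

lemma col_lattice_extensional: "f \<in> col_lattice I S i0 \<Longrightarrow> f \<in> extensional I"
  by (auto simp: col_lattice_def)

lemma col_latticeE:
  assumes "f \<in> col_lattice I S i0"
  obtains c :: "'i \<Rightarrow> int" where "\<And>i. i \<in> I \<Longrightarrow> f i = (\<Sum>j\<in>I. of_int (c j) * norm_col I S i0 j i)"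
  using assms by (auto simp: col_lattice_def)

lemma col_latticeI:
  assumes "f \<in> extensional I"
    and "\<And>i. i \<in> I \<Longrightarrow> f i = (\<Sum>j\<in>I. of_int (c j) * norm_col I S i0 j i)"
  shows "f \<in> col_lattice I S i0"
  unfolding col_lattice_def using assms
  by (auto intro!: exI[of _ c] extensionalityI[of _ I])

lemma col_lattice_add:
  assumes "f \<in> col_lattice I S i0" "g \<in> col_lattice I S i0"
  shows "(\<lambda>i\<in>I. f i + g i) \<in> col_lattice I S i0"
proof -
  obtain c d :: "'a \<Rightarrow> int"
    where "\<And>i. i \<in> I \<Longrightarrow> f i = (\<Sum>j\<in>I. of_int (c j) * norm_col I S i0 j i)"
      and "\<And>i. i \<in> I \<Longrightarrow> g i = (\<Sum>j\<in>I. of_int (d j) * norm_col I S i0 j i)"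
    using assms by (elim col_latticeE) blast
  then show ?thesis
    by (intro col_latticeI[where c = "\<lambda>j. c j + d j"]) (auto simp: algebra_simps sum.distrib)
qed

lemma col_lattice_scale:
  assumes "f \<in> col_lattice I S i0"
  shows "(\<lambda>i\<in>I. of_int z * f i) \<in> col_lattice I S i0"
proof -
  obtain c :: "'a \<Rightarrow> int"
    where "\<And>i. i \<in> I \<Longrightarrow> f i = (\<Sum>j\<in>I. of_int (c j) * norm_col I S i0 j i)"
    using assms by (elim col_latticeE) blast
  then show ?thesis
    by (intro col_latticeI[where c = "\<lambda>j. z * c j"]) (auto simp: algebra_simps sum_distrib_left)
qed

lemma norm_col_in_col_lattice:
  assumes "finite I" "j \<in> I"
  shows "norm_col I S i0 j \<in> col_lattice I S i0"
proof (rule col_latticeI[where c = "\<lambda>k. if k = j then 1 else 0"])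
  fix i
  have "(\<Sum>k\<in>I. of_int (if k = j then 1 else 0) * norm_col I S i0 k i)
      = (\<Sum>k\<in>I. if k = j then norm_col I S i0 k i else 0)"
    by (intro sum.cong) auto
  then show "norm_col I S i0 j i = (\<Sum>k\<in>I. of_int (if k = j then 1 else 0) * norm_col I S i0 k i)"
    using assms by (simp add: sum.delta)
qed (simp add: norm_col_def)

lemma norm_col_unit:
  assumes "\<And>i. i \<in> I \<Longrightarrow> S i i0 \<noteq> 0"
  shows "norm_col I S i0 i0 = (\<lambda>i\<in>I. 1)"
  using assms by (auto simp: norm_col_def)

lemma carrier_mat_alg: "carrier (mat_alg I S i0) = col_lattice I S i0"
  by (simp add: mat_alg_def)

section \<open>The ring of the column lattice and its orthonormal bases\<close>

lemma cring_mat_alg: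
  assumes "defines_Z_algebra I S i0"
  shows "cring (mat_alg I S i0)"
proof (rule cringI)
  let ?R = "mat_alg I S i0"
  have fin: "finite I" and i0: "i0 \<in> I" and nz: "\<And>i. i \<in> I \<Longrightarrow> S i i0 \<noteq> 0"
    and mult: "\<And>f g. f \<in> col_lattice I S i0 \<Longrightarrow> g \<in> col_lattice I S i0 \<Longrightarrow>
      (\<lambda>i\<in>I. f i * g i) \<in> col_lattice I S i0"
    using assms unfolding defines_Z_algebra_def by blast+
  \<comment> \<open>The unit column normalises to the constant 1, so 1 lies in the lattice, and 0 is
    a multiple of it.\<close>
  have one: "(\<lambda>i\<in>I. 1) \<in> col_lattice I S i0"
    using norm_col_in_col_lattice[OF fin i0, of S i0] norm_col_unit[of I S i0, OF nz] by simp
  have zero: "(\<lambda>i\<in>I. 0) \<in> col_lattice I S i0"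
    using col_lattice_scale[OF one, of 0] by (simp cong: restrict_cong)
  show "abelian_group ?R"
  proof (rule abelian_groupI)
    show "\<exists>g\<in>carrier ?R. g \<oplus>\<^bsub>?R\<^esub> f = \<zero>\<^bsub>?R\<^esub>" if "f \<in> carrier ?R" for f
      using that col_lattice_scale[of f I S i0 "-1"]
      by (intro bexI[of _ "\<lambda>i\<in>I. - f i"]) (auto simp: mat_alg_def cong: restrict_cong)
  next
    show "\<zero>\<^bsub>?R\<^esub> \<oplus>\<^bsub>?R\<^esub> f = f" if "f \<in> carrier ?R" for f
      using that col_lattice_extensional[of f I S i0]
      by (auto simp: mat_alg_def extensional_def fun_eq_iff)
  qed (auto simp: mat_alg_def zero col_lattice_add algebra_simps cong: restrict_cong)
  show "comm_monoid ?R"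
  proof (rule comm_monoidI)
    show "\<one>\<^bsub>?R\<^esub> \<otimes>\<^bsub>?R\<^esub> f = f" if "f \<in> carrier ?R" for f
      using that col_lattice_extensional[of f I S i0]
      by (auto simp: mat_alg_def extensional_def fun_eq_iff)
  qed (auto simp: mat_alg_def one mult algebra_simps cong: restrict_cong)
qed (auto simp: mat_alg_def algebra_simps cong: restrict_cong)

text \<open>Connects integer multiples in the abstract additive group with pointwise products;
  negative multiples are reached through the additive inverse.\<close>

lemma add_pow_mat_alg:
  fixes k :: int
  assumes R: "cring (mat_alg I S i0)" and f: "f \<in> col_lattice I S i0"
  shows "[k] \<cdot>\<^bsub>mat_alg I S i0\<^esub> f = (\<lambda>i\<in>I. of_int k * f i)"
proof -
  let ?R = "mat_alg I S i0"
  interpret R: cring ?R by fact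
  have nat: "[n] \<cdot>\<^bsub>?R\<^esub> f = (\<lambda>i\<in>I. of_nat n * f i)" for n :: nat
  proof (induction n)
    case (Suc n)
    have "[Suc n] \<cdot>\<^bsub>?R\<^esub> f = [n] \<cdot>\<^bsub>?R\<^esub> f \<oplus>\<^bsub>?R\<^esub> f"
      by (simp add: add_pow_def)
    then show ?case
      unfolding Suc by (simp only:) (simp add: mat_alg_def algebra_simps cong: restrict_cong)
  qed (simp add: add_pow_def mat_alg_def)
  show ?thesis
  proof (cases "k < 0")
    case False
    then have "[k] \<cdot>\<^bsub>?R\<^esub> f = [nat k] \<cdot>\<^bsub>?R\<^esub> f"
      unfolding add_pow_def by (intro pow_nat[symmetric]) simp
    then show ?thesis
      using False unfolding nat by simp
  next
    case True
    have "[k] \<cdot>\<^bsub>?R\<^esub> f = \<ominus>\<^bsub>?R\<^esub> ([nat (- k)] \<cdot>\<^bsub>?R\<^esub> f)"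
      using int_pow_def2[of "add_monoid ?R" f k] True by (simp only: add_pow_def a_inv_def if_True)
    also have "\<dots> = (\<lambda>i\<in>I. of_int k * f i)"
    proof (rule R.minus_equality)
      show "(\<lambda>i\<in>I. of_int k * f i) \<in> carrier ?R"
        using col_lattice_scale[OF f] by (simp add: mat_alg_def)
      show "[nat (- k)] \<cdot>\<^bsub>?R\<^esub> f \<in> carrier ?R"
        using col_lattice_scale[OF f, of "int (nat (- k))"] unfolding nat
          by (simp add: mat_alg_def del: int_nat_eq)
      show "(\<lambda>i\<in>I. of_int k * f i) \<oplus>\<^bsub>?R\<^esub> [nat (- k)] \<cdot>\<^bsub>?R\<^esub> f = \<zero>\<^bsub>?R\<^esub>"
        using True by (simp add: nat) (simp add: mat_alg_def cong: restrict_cong)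
    qed
    finally show ?thesis .
  qed
qed

lemma finsum_mat_alg:
  assumes R: "cring (mat_alg I S i0)" and "finite B"
    and "\<And>b. b \<in> B \<Longrightarrow> h b \<in> col_lattice I S i0"
  shows "finsum (mat_alg I S i0) h B = (\<lambda>i\<in>I. \<Sum>b\<in>B. h b i)"
  using assms(2,3)
proof (induction B)
  interpret R: cring "mat_alg I S i0" by fact
  {
    case empty
    show ?case by (simp add: R.finsum_empty) (simp add: mat_alg_def)
  next
    case (insert b B)
    have "finsum (mat_alg I S i0) h (insert b B)
        = h b \<oplus>\<^bsub>mat_alg I S i0\<^esub> finsum (mat_alg I S i0) h B"
      using insert by (intro R.finsum_insert) (auto simp: mat_alg_def)
    then show ?case
      using insert by simp (simp add: mat_alg_def cong: restrict_cong)
  }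
qed

text \<open>The standard Hermitian form, transported to the lattice by the unit column \<open>u\<close>, makes the
  columns orthonormal and hence computes coordinates.\<close>

definition col_inner :: "'i set \<Rightarrow> ('i \<Rightarrow> complex) \<Rightarrow> ('i \<Rightarrow> complex) \<Rightarrow> ('i \<Rightarrow> complex) \<Rightarrow> complex" where
  "col_inner I u f g = (\<Sum>i\<in>I. u i * cnj (u i) * f i * cnj (g i))"

lemma col_inner_sum_left:
  "col_inner I u (\<lambda>i\<in>I. \<Sum>b\<in>B. c b * h b i) g = (\<Sum>b\<in>B. c b * col_inner I u (h b) g)"
proof -
  have "col_inner I u (\<lambda>i\<in>I. \<Sum>b\<in>B. c b * h b i) g
      = (\<Sum>i\<in>I. \<Sum>b\<in>B. c b * (u i * cnj (u i) * h b i * cnj (g i)))"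
    unfolding col_inner_def by (intro sum.cong) (auto simp: sum_distrib_left sum_distrib_right mult_ac)
  also have "\<dots> = (\<Sum>b\<in>B. c b * col_inner I u (h b) g)"
    by (subst sum.swap) (simp add: col_inner_def sum_distrib_left)
  finally show ?thesis .
qed

lemma col_inner_coeff:
  assumes "finite B" "\<And>b b'. b \<in> B \<Longrightarrow> b' \<in> B \<Longrightarrow> col_inner I u b b' = (if b = b' then 1 else 0)" "k \<in> B"
  shows "col_inner I u (\<lambda>i\<in>I. \<Sum>b\<in>B. c b * b i) k = c k"
proof -
  have "col_inner I u (\<lambda>i\<in>I. \<Sum>b\<in>B. c b * b i) k = (\<Sum>b\<in>B. if b = k then c b else 0)"
    unfolding col_inner_sum_left using assms by (intro sum.cong) auto
  then show ?thesis
    using assms by (simp add: sum.delta)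
qed

text \<open>Coordinates with respect to an orthonormal family are inner products, hence unique;
  existence is the hypothesis \<open>span\<close>.\<close>

lemma Z_basis_orthonormal:
  assumes R: "cring (mat_alg I S i0)" and B: "finite B" "B \<subseteq> col_lattice I S i0"
    and on: "\<And>b b'. b \<in> B \<Longrightarrow> b' \<in> B \<Longrightarrow> col_inner I u b b' = (if b = b' then 1 else 0)"
    and span: "\<And>f. f \<in> col_lattice I S i0 \<Longrightarrow>
      \<exists>c :: _ \<Rightarrow> int. f = (\<lambda>i\<in>I. \<Sum>b\<in>B. of_int (c b) * b i)"
  shows "Z_basis (mat_alg I S i0) B"
proof -
  let ?R = "mat_alg I S i0"
  have fs: "(\<Oplus>\<^bsub>?R\<^esub>b\<in>B. [c b] \<cdot>\<^bsub>?R\<^esub> b) = (\<lambda>i\<in>I. \<Sum>b\<in>B. of_int (c b) * b i)"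
    for c :: "_ \<Rightarrow> int"
  proof -
    have "(\<Oplus>\<^bsub>?R\<^esub>b\<in>B. [c b] \<cdot>\<^bsub>?R\<^esub> b) = (\<lambda>i\<in>I. \<Sum>b\<in>B. ([c b] \<cdot>\<^bsub>?R\<^esub> b) i)"
      using B by (intro finsum_mat_alg[OF R]) (auto simp: add_pow_mat_alg[OF R] subset_iff
          intro!: col_lattice_scale)
    also have "\<dots> = (\<lambda>i\<in>I. \<Sum>b\<in>B. of_int (c b) * b i)"
      using B by (intro restrict_ext sum.cong) (auto simp: add_pow_mat_alg[OF R] subset_iff)
    finally show ?thesis .
  qed
  have "\<exists>!c. c \<in> B \<rightarrow>\<^sub>E (UNIV :: int set) \<and> f = (\<Oplus>\<^bsub>?R\<^esub>b\<in>B. [c b] \<cdot>\<^bsub>?R\<^esub> b)"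
    if f: "f \<in> carrier ?R" for f
  proof -
    obtain c :: "_ \<Rightarrow> int" where c: "f = (\<lambda>i\<in>I. \<Sum>b\<in>B. of_int (c b) * b i)"
      using span f by (auto simp: mat_alg_def)
    show ?thesis
    \<comment> \<open>\<open>Z_basis\<close> quantifies over extensional coefficient functions,
      hence the restriction.\<close>
    proof (rule ex1I[of _ "restrict c B"])
      show "restrict c B \<in> B \<rightarrow>\<^sub>E UNIV \<and> f = (\<Oplus>\<^bsub>?R\<^esub>b\<in>B. [restrict c B b] \<cdot>\<^bsub>?R\<^esub> b)"
        unfolding fs by (simp add: c cong: restrict_cong sum.cong)
    next
      fix d :: "_ \<Rightarrow> int"
      assume d: "d \<in> B \<rightarrow>\<^sub>E UNIV \<and> f = (\<Oplus>\<^bsub>?R\<^esub>b\<in>B. [d b] \<cdot>\<^bsub>?R\<^esub> b)"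
      have "d b = c b" if "b \<in> B" for b
      proof -
        have "of_int (d b) = col_inner I u f b"
          using d col_inner_coeff[OF B(1) on that, where c = "\<lambda>b. of_int (d b)"] by (simp add: fs)
        also have "\<dots> = of_int (c b)"
          using c col_inner_coeff[OF B(1) on that, where c = "\<lambda>b. of_int (c b)"] by simp
        finally show ?thesis by simp
      qed
      then show "d = restrict c B"
        using d by (intro extensionalityI[of _ B]) (auto simp: PiE_def)
    qed
  qed
  then show ?thesis
    using B by (auto simp: Z_basis_def mat_alg_def)
qed


text \<open>The involution is pointwise complex conjugation. By \<open>conj\<close> it permutes the
  columns up to sign, and by \<open>no_neg\<close> this sign is 1 on every column that it fixes;
  these facts allow signs for which the signed columns are permuted exactly.\<close>

lemma Z_based_ring_mat_alg:
  fixes S :: "'i \<Rightarrow> 'i \<Rightarrow> complex" and I i0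
  defines "R \<equiv> mat_alg I S i0" and "b \<equiv> norm_col I S i0"
  assumes alg: "defines_Z_algebra I S i0"
    and col: "\<And>j k. j \<in> I \<Longrightarrow> k \<in> I \<Longrightarrow> (\<Sum>l\<in>I. S l j * cnj (S l k)) = (if j = k then 1 else 0)"
    and conj: "\<And>j. j \<in> I \<Longrightarrow> \<exists>k\<in>I. \<exists>s\<in>{1, -1 :: int}. \<forall>l\<in>I. cnj (b j l) = of_int s * b k l"
    and no_neg: "\<And>j. j \<in> I \<Longrightarrow> \<not> (\<forall>l\<in>I. cnj (b j l) = - b j l)"
  shows "inj_on b I" "Z_basis R (b ` I)"
    "\<exists>\<eta> :: 'i \<Rightarrow> int. (\<forall>\<xi>\<in>I. \<eta> \<xi> \<in> {1, -1}) \<and> Z_based_ring R ((\<lambda>\<xi>. [\<eta> \<xi>] \<cdot>\<^bsub>R\<^esub> b \<xi>) ` I)"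
proof -
  have fin: "finite I" and i0: "i0 \<in> I" and nz: "\<And>i. i \<in> I \<Longrightarrow> S i i0 \<noteq> 0"
    and mult: "\<And>f g. f \<in> col_lattice I S i0 \<Longrightarrow> g \<in> col_lattice I S i0 \<Longrightarrow>
      (\<lambda>i\<in>I. f i * g i) \<in> col_lattice I S i0"
    using alg unfolding defines_Z_algebra_def by blast+
  have R: "cring (mat_alg I S i0)"
    using cring_mat_alg[OF alg] .
  \<comment> \<open>Weighting by the squared modulus of the unit column undoes the division in
    \<open>norm_col\<close>, so orthonormality of the columns of \<open>S\<close> carries
    over.\<close>
  define u where "u = (\<lambda>l. S l i0)"
  have bL: "b j \<in> col_lattice I S i0" if "j \<in> I" for j
    unfolding b_def by (rule norm_col_in_col_lattice[OF fin that])
  have col_inner_b: "col_inner I u (b j) (b k) = (if j = k then 1 else 0)" if "j \<in> I" "k \<in> I" for j k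
  proof -
    have "col_inner I u (b j) (b k) = (\<Sum>l\<in>I. S l j * cnj (S l k))"
      unfolding col_inner_def b_def norm_col_def u_def using nz by (intro sum.cong) (auto simp: field_simps)
    then show ?thesis using col that by simp
  qed
  define v where "v = (\<lambda>(\<eta> :: 'i \<Rightarrow> int) \<xi>. (\<lambda>i\<in>I. of_int (\<eta> \<xi>) * b \<xi> i))"
  have vL: "v \<eta> j \<in> col_lattice I S i0" if "j \<in> I" for j \<eta>
    unfolding v_def by (intro col_lattice_scale bL that)
  have col_inner_scale: "col_inner I u (\<lambda>i\<in>I. c * f i) (\<lambda>i\<in>I. d * g i) = c * cnj d * col_inner I u f g" for c d f g
    unfolding col_inner_def by (auto simp: sum_distrib_left mult_ac intro!: sum.cong)
  have v_on: "col_inner I u (v \<eta> j) (v \<eta> k) = (if j = k then 1 else 0)"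
    if "j \<in> I" "k \<in> I" "\<forall>\<xi>\<in>I. \<eta> \<xi> \<in> {1, -1}" for j k \<eta>
    using that by (auto simp: v_def col_inner_scale col_inner_b)
  have v_inj: "inj_on (v \<eta>) I" if "\<forall>\<xi>\<in>I. \<eta> \<xi> \<in> {1, -1}" for \<eta>
    using v_on[OF _ _ that] by (metis inj_onI zero_neq_one)
  have v_basis: "Z_basis R (v \<eta> ` I)" if \<eta>: "\<forall>\<xi>\<in>I. \<eta> \<xi> \<in> {1, -1}" for \<eta>
    unfolding R_def
  proof (rule Z_basis_orthonormal[OF R, where u = u])
    show "finite (v \<eta> ` I)" using fin by simp
    show "v \<eta> ` I \<subseteq> col_lattice I S i0" using vL by blast
    show "col_inner I u x y = (if x = y then 1 else 0)" if "x \<in> v \<eta> ` I" "y \<in> v \<eta> ` I" for x y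
      using that v_on[OF _ _ \<eta>] by (auto simp: inj_on_eq_iff[OF v_inj[OF \<eta>]])
    show "\<exists>c :: _ \<Rightarrow> int. f = (\<lambda>i\<in>I. \<Sum>x\<in>v \<eta> ` I. of_int (c x) * x i)"
      if f: "f \<in> col_lattice I S i0" for f
    proof -
      obtain c :: "_ \<Rightarrow> int" where c: "\<And>i. i \<in> I \<Longrightarrow> f i = (\<Sum>j\<in>I. of_int (c j) * norm_col I S i0 j i)"
        using f by (elim col_latticeE) blast
      \<comment> \<open>A basis element is a column, not an index, so the index is recovered by
        inverting \<open>v \<eta>\<close>; multiplying by \<eta> is the same as dividing by
        it.\<close>
      define d where "d = (\<lambda>x. let j = inv_into I (v \<eta>) x in c j * \<eta> j)"
      have "f i = (\<Sum>x\<in>v \<eta> ` I. of_int (d x) * x i)" if i: "i \<in> I" for i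
      proof -
        have "(\<Sum>x\<in>v \<eta> ` I. of_int (d x) * x i) = (\<Sum>j\<in>I. of_int (c j * \<eta> j) * v \<eta> j i)"
          by (subst sum.reindex[OF v_inj[OF \<eta>]])
             (auto simp: d_def inv_into_f_f[OF v_inj[OF \<eta>]] intro!: sum.cong)
        also have "\<dots> = f i"
          unfolding c[OF i] using i \<eta> by (intro sum.cong) (auto simp: v_def b_def)
        finally show ?thesis ..
      qed
      then show ?thesis
        using col_lattice_extensional[OF f] by (intro exI[of _ d] extensionalityI[of _ I]) auto
    qed
  qed
  have v1: "v (\<lambda>_. 1) j = b j" for j
    by (auto simp: v_def b_def norm_col_def)
  show "inj_on b I"
    using v_inj[of "\<lambda>_. 1"] by (simp add: v1 cong: inj_on_cong)
  show "Z_basis R (b ` I)"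
    using v_basis[of "\<lambda>_. 1"] by (simp add: v1)
  \<comment> \<open>By orthonormality a signed column determines both its index and its
    sign.\<close>
  have unique: "k = k' \<and> s = s'"
    if "k \<in> I" "k' \<in> I" "s \<in> {1, -1}" "s' \<in> {1, -1}"
      and eq: "\<And>l. l \<in> I \<Longrightarrow> of_int s * b k l = of_int s' * b k' l" for k k' and s s' :: int
  proof -
    have "(\<lambda>l\<in>I. of_int s * b k l) = (\<lambda>l\<in>I. of_int s' * b k' l)"
      using eq by (intro restrict_ext)
    then have "col_inner I u (\<lambda>l\<in>I. of_int s * b k l) (\<lambda>l\<in>I. 1 * b k l)
        = col_inner I u (\<lambda>l\<in>I. of_int s' * b k' l) (\<lambda>l\<in>I. 1 * b k l)"
      by simp
    then have "(of_int s :: complex) = of_int (s' * (if k' = k then 1 else 0))"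
      unfolding col_inner_scale using that by (simp add: col_inner_b)
    then show ?thesis
      using that by (auto split: if_splits)
  qed
  obtain tl :: "'i \<Rightarrow> 'i" and \<kappa> :: "'i \<Rightarrow> int"
    where tl: "\<And>j. j \<in> I \<Longrightarrow> tl j \<in> I" and \<kappa>: "\<And>j. j \<in> I \<Longrightarrow> \<kappa> j \<in> {1, -1}"
      and cnj_b: "\<And>j l. j \<in> I \<Longrightarrow> l \<in> I \<Longrightarrow> cnj (b j l) = of_int (\<kappa> j) * b (tl j) l"
    using conj by metis
  have tl_tl: "tl (tl j) = j \<and> \<kappa> (tl j) = \<kappa> j" if j: "j \<in> I" for j
  proof -
    have "of_int (\<kappa> (tl j)) * b (tl (tl j)) l = of_int (\<kappa> j) * b j l" if l: "l \<in> I" for l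
    proof -
      have "b j l = cnj (of_int (\<kappa> j) * b (tl j) l)"
        using cnj_b[OF j l] by (metis complex_cnj_cnj)
      also have "\<dots> = of_int (\<kappa> j) * (of_int (\<kappa> (tl j)) * b (tl (tl j)) l)"
        using cnj_b[OF tl[OF j] l] by simp
      finally show ?thesis
        using \<kappa>[OF j] \<kappa>[OF tl[OF j]] by auto
    qed
    then show ?thesis
      using unique[OF tl[OF tl[OF j]] j \<kappa>[OF tl[OF j]] \<kappa>[OF j]] by blast
  qed
  have \<kappa>_fixed: "\<kappa> j = 1" if "j \<in> I" "tl j = j" for j
    using no_neg[OF that(1)] \<kappa>[OF that(1)] cnj_b[OF that(1)] that(2) by auto
  \<comment> \<open>In each orbit \<open>{j, tl j}\<close> a representative gets the sign 1 and its
    partner the conjugation sign \<kappa>. The choice depends on the set alone, so both elements of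
    an orbit agree on the representative.\<close>
  define \<eta> where "\<eta> = (\<lambda>j. if j = (SOME x. x \<in> {j, tl j}) then 1 else \<kappa> j)"
  have \<eta>: "\<forall>\<xi>\<in>I. \<eta> \<xi> \<in> {1, -1}"
    using \<kappa> by (auto simp: \<eta>_def)
  have \<eta>_tl: "\<eta> j * \<kappa> j = \<eta> (tl j)" if j: "j \<in> I" for j
  proof -
    have "{tl j, tl (tl j)} = {j, tl j}"
      using tl_tl[OF j] by auto
    moreover have "(SOME x. x \<in> {j, tl j}) \<in> {j, tl j}"
      by (rule someI_ex) auto
    ultimately show ?thesis
      using \<kappa>[OF j] tl_tl[OF j] \<kappa>_fixed[OF j] unfolding \<eta>_def by (cases "tl j = j") auto
  qed
  define t where "t = (\<lambda>f :: 'i \<Rightarrow> complex. \<lambda>i\<in>I. cnj (f i))"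
  have tv: "t (v \<eta> j) = v \<eta> (tl j)" if j: "j \<in> I" for j
    unfolding t_def v_def using \<eta>_tl[OF j, symmetric] cnj_b[OF j] by (auto intro!: restrict_ext)
  have tL: "t f \<in> col_lattice I S i0" if f: "f \<in> col_lattice I S i0" for f
  proof -
    obtain c :: "_ \<Rightarrow> int" where c: "\<And>i. i \<in> I \<Longrightarrow> f i = (\<Sum>j\<in>I. of_int (c j) * norm_col I S i0 j i)"
      using f by (elim col_latticeE) blast
    have bij: "bij_betw tl I I"
      by (rule bij_betw_byWitness[where f' = tl]) (use tl tl_tl in auto)
    have "t f i = (\<Sum>j\<in>I. of_int (c (tl j) * \<kappa> j) * norm_col I S i0 j i)" if i: "i \<in> I" for i
    proof -
      have "t f i = (\<Sum>j\<in>I. of_int (c j * \<kappa> j) * b (tl j) i)"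
        using i c[OF i] cnj_b[OF _ i] by (simp add: t_def b_def[symmetric] mult.assoc)
      also have "\<dots> = (\<Sum>j\<in>I. of_int (c (tl j) * \<kappa> j) * b j i)"
        by (subst sum.reindex_bij_betw[OF bij, symmetric, of "\<lambda>j. of_int (c (tl j) * \<kappa> j) * b j i"])
           (use tl_tl in auto)
      finally show ?thesis by (simp add: b_def)
    qed
    then show ?thesis
      by (intro col_latticeI[where c = "\<lambda>j. c (tl j) * \<kappa> j"]) (auto simp: t_def)
  qed
  \<comment> \<open>Conjugation fixes the constant 1, so \<open>i0\<close> is its own partner and
    receives the sign 1.\<close>
  have one_v: "(\<lambda>i\<in>I. 1) = v \<eta> i0"
  proof -
    have b1: "b i0 = (\<lambda>i\<in>I. 1)"
      unfolding b_def by (rule norm_col_unit) (rule nz)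
    have "of_int (\<kappa> i0) * b (tl i0) l = of_int 1 * b i0 l" if "l \<in> I" for l
      using cnj_b[OF i0 that] that by (simp add: b1)
    then have "tl i0 = i0"
      using unique[OF tl[OF i0] i0 \<kappa>[OF i0], of 1] by blast
    then have "\<eta> i0 = 1"
      by (simp add: \<eta>_def)
    then show ?thesis
      by (auto simp: v_def b1)
  qed
  define B where "B = v \<eta> ` I"
  have BL: "B \<subseteq> col_lattice I S i0" and finB: "finite B"
    using vL fin by (auto simp: B_def)
  have B_on: "col_inner I u x y = (if x = y then 1 else 0)" if "x \<in> B" "y \<in> B" for x y
    using that v_on[OF _ _ \<eta>] by (auto simp: B_def inj_on_eq_iff[OF v_inj[OF \<eta>]])
  have basis: "Z_basis R B"
    unfolding B_def by (rule v_basis[OF \<eta>])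
  have coeff: "\<exists>c :: _ \<Rightarrow> int. f = (\<Oplus>\<^bsub>R\<^esub>k\<in>B. [c k] \<cdot>\<^bsub>R\<^esub> k) \<and> (\<forall>k\<in>B. of_int (c k) = col_inner I u f k)"
    if "f \<in> col_lattice I S i0" for f
  proof -
    have "f \<in> carrier R"
      using that by (simp add: R_def mat_alg_def)
    then have "\<exists>!c. c \<in> B \<rightarrow>\<^sub>E (UNIV :: int set) \<and> f = (\<Oplus>\<^bsub>R\<^esub>k\<in>B. [c k] \<cdot>\<^bsub>R\<^esub> k)"
      using basis unfolding Z_basis_def by (elim conjE) (erule (1) bspec)
    then obtain c :: "_ \<Rightarrow> int" where c: "f = (\<Oplus>\<^bsub>R\<^esub>k\<in>B. [c k] \<cdot>\<^bsub>R\<^esub> k)"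
      by (elim ex1E conjE)
    note c
    also have "\<dots> = (\<lambda>i\<in>I. \<Sum>k\<in>B. ([c k] \<cdot>\<^bsub>R\<^esub> k) i)"
      unfolding R_def using BL by (intro finsum_mat_alg[OF R finB])
        (auto simp: add_pow_mat_alg[OF R] subset_iff intro!: col_lattice_scale)
    also have "\<dots> = (\<lambda>i\<in>I. \<Sum>k\<in>B. of_int (c k) * k i)"
      unfolding R_def using BL by (intro restrict_ext sum.cong)
        (auto simp: add_pow_mat_alg[OF R] subset_iff)
    finally show ?thesis
      using c col_inner_coeff[OF finB B_on, where c = "\<lambda>k. of_int (c k)"] by (intro exI[of _ c]) auto
  qed
  \<comment> \<open>Structure constants are inner products. The floor of the real part makes
    \<open>N\<close> an integer-valued function defined everywhere; for elements of \<open>B\<close>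
    the inner product already is an integer.\<close>
  define N where "N = (\<lambda>x y k. \<lfloor>Re (col_inner I u (\<lambda>i\<in>I. x i * y i) k)\<rfloor>)"
  have N: "(\<lambda>i\<in>I. x i * y i) = (\<Oplus>\<^bsub>R\<^esub>k\<in>B. [N x y k] \<cdot>\<^bsub>R\<^esub> k) \<and>
      (\<forall>k\<in>B. of_int (N x y k) = col_inner I u (\<lambda>i\<in>I. x i * y i) k)" if xy: "x \<in> B" "y \<in> B" for x y
  proof -
    have "(\<lambda>i\<in>I. x i * y i) \<in> col_lattice I S i0"
      using xy BL mult by blast
    from coeff[OF this] obtain c :: "_ \<Rightarrow> int"
      where c: "(\<lambda>i\<in>I. x i * y i) = (\<Oplus>\<^bsub>R\<^esub>k\<in>B. [c k] \<cdot>\<^bsub>R\<^esub> k)"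
        "\<forall>k\<in>B. of_int (c k) = col_inner I u (\<lambda>i\<in>I. x i * y i) k"
      by blast
    have Nc: "N x y k = c k" if "k \<in> B" for k
      using c(2)[rule_format, OF that, symmetric] by (simp add: N_def)
    interpret cring R
      unfolding R_def by (rule R)
    have "(\<Oplus>\<^bsub>R\<^esub>k\<in>B. [N x y k] \<cdot>\<^bsub>R\<^esub> k) = (\<Oplus>\<^bsub>R\<^esub>k\<in>B. [c k] \<cdot>\<^bsub>R\<^esub> k)"
      using BL by (intro finsum_cong') (auto simp: Nc R_def add_pow_mat_alg[OF R] subset_iff
          carrier_mat_alg intro!: col_lattice_scale)
    then show ?thesis
      using c by (auto simp: Nc)
  qed
  have tB: "t x \<in> B" if "x \<in> B" for x
    using that tl tv by (auto simp: B_def)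
  have ttL: "t (t f) = f" if "f \<in> col_lattice I S i0" for f
    using col_lattice_extensional[OF that] by (auto simp: t_def extensional_def fun_eq_iff)
  have "Z_based_ring R B"
    unfolding Z_based_ring_def
  proof (intro conjI exI[of _ N] exI[of _ t])
    show "cring R" unfolding R_def by (rule R)
    show "Z_basis R B" by (rule basis)
    have oneR: "\<one>\<^bsub>R\<^esub> = (\<lambda>i\<in>I. 1)" by (simp add: R_def mat_alg_def)
    show oneB: "\<one>\<^bsub>R\<^esub> \<in> B"
      using i0 by (simp add: oneR one_v B_def)
    show "\<forall>x\<in>B. \<forall>y\<in>B. x \<otimes>\<^bsub>R\<^esub> y = (\<Oplus>\<^bsub>R\<^esub>k\<in>B. [N x y k] \<cdot>\<^bsub>R\<^esub> k)"
    proof (intro ballI)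
      fix x y assume "x \<in> B" "y \<in> B"
      then have "(\<lambda>i\<in>I. x i * y i) = (\<Oplus>\<^bsub>R\<^esub>k\<in>B. [N x y k] \<cdot>\<^bsub>R\<^esub> k)" using N by blast
      moreover have "x \<otimes>\<^bsub>R\<^esub> y = (\<lambda>i\<in>I. x i * y i)" by (simp add: R_def mat_alg_def)
      ultimately show "x \<otimes>\<^bsub>R\<^esub> y = (\<Oplus>\<^bsub>R\<^esub>k\<in>B. [N x y k] \<cdot>\<^bsub>R\<^esub> k)" by (simp only:)
    qed
    show "t \<in> carrier R \<rightarrow> carrier R"
      using tL by (auto simp: R_def mat_alg_def)
    show "\<forall>x\<in>carrier R. \<forall>y\<in>carrier R. t (x \<oplus>\<^bsub>R\<^esub> y) = t x \<oplus>\<^bsub>R\<^esub> t y"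
      by (auto simp: R_def mat_alg_def t_def cong: restrict_cong)
    show "\<forall>x\<in>carrier R. t (t x) = x"
      using ttL by (simp add: R_def mat_alg_def)
    show "t ` B = B"
    proof
      show "B \<subseteq> t ` B"
      proof
        fix x assume "x \<in> B"
        then have "x = t (t x)" "t x \<in> B"
          using ttL BL tB by auto
        then show "x \<in> t ` B" by (rule image_eqI)
      qed
    qed (use tB in blast)
    \<comment> \<open>Moving the conjugation to the third argument conjugates the inner product, and
      the structure constants are real.\<close>
    show "\<forall>x\<in>B. \<forall>y\<in>B. \<forall>k\<in>B. N (t x) (t y) k = N x y (t k)"
    proof (intro ballI)
      fix x y k assume xyk: "x \<in> B" "y \<in> B" "k \<in> B"
      have "complex_of_int (N (t x) (t y) k) = col_inner I u (\<lambda>i\<in>I. t x i * t y i) k"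
        using N tB xyk by blast
      also have "\<dots> = cnj (col_inner I u (\<lambda>i\<in>I. x i * y i) (t k))"
        unfolding col_inner_def by (auto simp: t_def mult_ac intro!: sum.cong)
      also have "\<dots> = of_int (N x y (t k))"
        using N[of x y] tB xyk by (metis complex_cnj_of_int)
      finally show "N (t x) (t y) k = N x y (t k)" by simp
    qed
    \<comment> \<open>The coefficient of 1 in the product of \<open>t x\<close> and \<open>y\<close>
      is the inner product of \<open>y\<close> with \<open>x\<close>.\<close>
    show "\<forall>x\<in>B. \<forall>y\<in>B. N (t x) y \<one>\<^bsub>R\<^esub> = (if x = y then 1 else 0)"
    proof (intro ballI)
      fix x y assume xy: "x \<in> B" "y \<in> B"
      have "complex_of_int (N (t x) y \<one>\<^bsub>R\<^esub>) = col_inner I u (\<lambda>i\<in>I. t x i * y i) \<one>\<^bsub>R\<^esub>"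
        using N tB xy oneB by blast
      also have "\<dots> = col_inner I u y x"
        unfolding col_inner_def by (auto simp: t_def oneR mult_ac intro!: sum.cong)
      also have "\<dots> = of_int (if x = y then 1 else 0)"
        using B_on xy by simp
      finally show "N (t x) y \<one>\<^bsub>R\<^esub> = (if x = y then 1 else 0)"
        by (simp only: of_int_eq_iff)
    qed
  qed
  moreover have "(\<lambda>\<xi>. [\<eta> \<xi>] \<cdot>\<^bsub>R\<^esub> b \<xi>) ` I = B"
    unfolding B_def by (intro image_cong) (auto simp: R_def add_pow_mat_alg[OF R bL] v_def)
  ultimately show "\<exists>\<eta> :: 'i \<Rightarrow> int. (\<forall>\<xi>\<in>I. \<eta> \<xi> \<in> {1, -1}) \<and>
      Z_based_ring R ((\<lambda>\<xi>. [\<eta> \<xi>] \<cdot>\<^bsub>R\<^esub> b \<xi>) ` I)"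
    using \<eta> by (intro exI[of _ \<eta>]) simp
qed

section \<open>Alternants\<close>

text \<open>The character sending \<open>k\<close> to the power \<open>-k\<close> of
  \<open>zeta e\<close>. The sign is negative because \<open>Smat\<close> is given through its
  complex conjugate.\<close>

definition chi :: "nat \<Rightarrow> int \<Rightarrow> complex" where
  "chi e k = cis (- (2 * pi * of_int k / of_nat e))"

lemma chi_0 [simp]: "chi e 0 = 1"
  by (simp add: chi_def)

lemma chi_add: "chi e (a + b) = chi e a * chi e b"
  by (simp add: chi_def cis_mult add_divide_distrib algebra_simps)

lemma chi_sum: "chi e (\<Sum>x\<in>A. f x) = (\<Prod>x\<in>A. chi e (f x))"
  by (induction A rule: infinite_finite_induct) (auto simp: chi_add)

lemma chi_mult_nat: "chi e (int n * a) = chi e a ^ n"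
  by (induction n) (auto simp: chi_add algebra_simps)

lemma cnj_chi: "cnj (chi e k) = chi e (- k)"
  by (simp add: chi_def cis_cnj)

lemma chi_nonzero [simp]: "chi e k \<noteq> 0"
  by (simp add: chi_def)

lemma chi_eq_1_iff:
  assumes "e \<ge> 1"
  shows "chi e k = 1 \<longleftrightarrow> int e dvd k"
proof
  assume "chi e k = 1"
  then have "cos (2 * pi * of_int k / of_nat e) = 1"
    by (simp add: chi_def complex_eq_iff)
  then obtain n :: int where "2 * pi * of_int k / of_nat e = of_int n * 2 * pi"
    by (auto simp: cos_one_2pi_int)
  then have "(of_int k :: real) = of_int (n * int e)"
    using assms by (simp add: field_simps)
  then show "int e dvd k"
    by (metis dvd_triv_right of_int_eq_iff)
next
  assume "int e dvd k"
  then obtain n where k: "k = int e * n" by (elim dvdE)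
  have "- (2 * pi * of_int k / of_nat e) = 2 * pi * of_int (- n)"
    using assms by (simp add: k)
  then show "chi e k = 1"
    unfolding chi_def by (simp only: cis_multiple_2pi Ints_of_int)
qed

lemma chi_cong:
  assumes "e \<ge> 1" "[a = b] (mod int e)"
  shows "chi e a = chi e b"
proof -
  have "chi e (a - b) = 1"
    using assms by (simp add: chi_eq_1_iff cong_iff_dvd_diff)
  then show ?thesis
    using chi_add[of e "a - b" b] by simp
qed

lemma sum_chi:
  assumes "e \<ge> 1"
  shows "(\<Sum>k<e. chi e (int k * a)) = (if int e dvd a then of_nat e else 0)"
proof (cases "int e dvd a")
  case True
  then show ?thesis
    using assms by (simp add: chi_mult_nat chi_eq_1_iff[THEN iffD2])
next
  case False
  then have "chi e a \<noteq> 1"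
    using assms by (simp add: chi_eq_1_iff)
  moreover have "chi e a ^ e = 1"
    using assms by (simp add: chi_eq_1_iff flip: chi_mult_nat)
  ultimately show ?thesis
    using False by (simp add: chi_mult_nat geometric_sum)
qed

section \<open>Fibre-preserving permutations and alternants\<close>

text \<open>The product of the symmetric groups of the fibres, realised inside the permutations of
  \<open>Y\<close>, so that a product of determinants becomes a single signed sum.\<close>

definition fib_perms :: "'a set \<Rightarrow> ('a \<Rightarrow> nat) \<Rightarrow> ('a \<Rightarrow> 'a) set" where
  "fib_perms Y \<pi> = {\<sigma>. \<sigma> permutes Y \<and> (\<forall>y. \<pi> (\<sigma> y) = \<pi> y)}"

lemma fib_perms_permutes: "\<sigma> \<in> fib_perms Y \<pi> \<Longrightarrow> \<sigma> permutes Y"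
  and fib_perms_fibre: "\<sigma> \<in> fib_perms Y \<pi> \<Longrightarrow> \<pi> (\<sigma> y) = \<pi> y"
  by (auto simp: fib_perms_def)

lemma finite_fib_perms: "finite Y \<Longrightarrow> finite (fib_perms Y \<pi>)"
  by (rule finite_subset[OF _ finite_permutations[of Y]]) (auto simp: fib_perms_def)

lemma fib_perms_id: "id \<in> fib_perms Y \<pi>"
  by (simp add: fib_perms_def permutes_id)

lemma fib_perms_comp: "\<sigma> \<in> fib_perms Y \<pi> \<Longrightarrow> \<tau> \<in> fib_perms Y \<pi> \<Longrightarrow> \<sigma> \<circ> \<tau> \<in> fib_perms Y \<pi>"
  by (auto simp: fib_perms_def permutes_compose)

lemma fib_perms_inv: "\<sigma> \<in> fib_perms Y \<pi> \<Longrightarrow> inv_into UNIV \<sigma> \<in> fib_perms Y \<pi>"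
  unfolding fib_perms_def by (auto simp: permutes_inv) (metis permutes_inverses(1))

lemma fib_perms_transpose:
  assumes "y \<in> Y" "y' \<in> Y" "\<pi> y = \<pi> y'"
  shows "Transposition.transpose y y' \<in> fib_perms Y \<pi>"
  using assms by (auto simp: fib_perms_def permutes_swap_id Transposition.transpose_def)

lemma fib_perms_in_Y: "\<sigma> \<in> fib_perms Y \<pi> \<Longrightarrow> \<sigma> y \<in> Y \<longleftrightarrow> y \<in> Y"
  using fib_perms_permutes permutes_in_image by metis

lemma fib_perms_bij_fib:
  assumes "\<sigma> \<in> fib_perms Y \<pi>"
  shows "bij_betw \<sigma> (fib Y \<pi> w) (fib Y \<pi> w)"
proof (rule bij_betw_byWitness[where f' = "inv_into UNIV \<sigma>"])
  show "\<forall>y\<in>fib Y \<pi> w. inv_into UNIV \<sigma> (\<sigma> y) = y" "\<forall>y\<in>fib Y \<pi> w. \<sigma> (inv_into UNIV \<sigma> y) = y"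
    using fib_perms_permutes[OF assms] by (auto simp: permutes_inverses)
  show "\<sigma> ` fib Y \<pi> w \<subseteq> fib Y \<pi> w" "inv_into UNIV \<sigma> ` fib Y \<pi> w \<subseteq> fib Y \<pi> w"
    using assms fib_perms_inv[OF assms] by (auto simp: fib_def fib_perms_in_Y fib_perms_fibre)
qed

lemma fib_perms_bij: "\<sigma> \<in> fib_perms Y \<pi> \<Longrightarrow> bij_betw \<sigma> Y Y"
  using fib_perms_permutes permutes_imp_bij by blast

lemma sign_fib_perms_comp:
  assumes "finite Y" "\<sigma> \<in> fib_perms Y \<pi>" "\<tau> \<in> fib_perms Y \<pi>"
  shows "sign (\<sigma> \<circ> \<tau>) = sign \<sigma> * sign \<tau>"
  using assms by (intro sign_compose permutes_imp_permutation fib_perms_permutes) auto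

lemma sign_fib_perms_inv:
  assumes "finite Y" "\<sigma> \<in> fib_perms Y \<pi>"
  shows "sign (inv_into UNIV \<sigma>) = sign \<sigma>"
  using assms by (intro sign_inverse permutes_imp_permutation fib_perms_permutes) auto

lemma sum_fib_perms_inv:
  "(\<Sum>\<sigma>\<in>fib_perms Y \<pi>. F (inv_into UNIV \<sigma>)) = (\<Sum>\<sigma>\<in>fib_perms Y \<pi>. F \<sigma>)"
  by (rule sum.reindex_bij_witness[where i = "inv_into UNIV" and j = "inv_into UNIV"])
     (auto simp: fib_perms_inv dest!: fib_perms_permutes permutes_inv_inv)

lemma fib_perms_inv_comp:
  assumes "\<tau> \<in> fib_perms Y \<pi>"
  shows "inv_into UNIV \<tau> \<circ> \<tau> = id" "\<tau> \<circ> inv_into UNIV \<tau> = id"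
  using permutes_inv_o[OF fib_perms_permutes[OF assms]] by auto

lemma sum_fib_perms_comp_right:
  assumes "\<tau> \<in> fib_perms Y \<pi>"
  shows "(\<Sum>\<sigma>\<in>fib_perms Y \<pi>. F (\<sigma> \<circ> \<tau>)) = (\<Sum>\<sigma>\<in>fib_perms Y \<pi>. F \<sigma>)"
  by (rule sum.reindex_bij_witness[where i = "\<lambda>\<sigma>. \<sigma> \<circ> inv_into UNIV \<tau>" and j = "\<lambda>\<sigma>. \<sigma> \<circ> \<tau>"])
     (use assms in \<open>auto simp: fib_perms_comp fib_perms_inv comp_assoc fib_perms_inv_comp[OF assms]\<close>)

text \<open>The product over the fibres of determinants with entries
  \<open>chi e (f x * g y)\<close>. Both arguments are arbitrary integer functions, so that they can
  be shifted and reflected.\<close>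

definition alt :: "nat \<Rightarrow> 'a set \<Rightarrow> ('a \<Rightarrow> nat) \<Rightarrow> ('a \<Rightarrow> int) \<Rightarrow> ('a \<Rightarrow> int) \<Rightarrow> complex" where
  "alt e Y \<pi> f g = (\<Sum>\<sigma>\<in>fib_perms Y \<pi>. of_int (sign \<sigma>) * (\<Prod>x\<in>Y. chi e (f (\<sigma> x) * g x)))"

lemma alt_cong:
  assumes "e \<ge> 1" "\<And>x. x \<in> Y \<Longrightarrow> [g x = g' x] (mod int e)"
  shows "alt e Y \<pi> f g = alt e Y \<pi> f g'"
  unfolding alt_def using assms
  by (intro sum.cong prod.cong arg_cong2[where f = "(*)"] refl chi_cong cong_mult cong_refl) auto

text \<open>Transposition of the determinants: \<sigma> is replaced by its inverse, which has the
  same sign.\<close>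

lemma alt_commute:
  assumes "finite Y"
  shows "alt e Y \<pi> f g = alt e Y \<pi> g f"
proof -
  have "alt e Y \<pi> f g
      = (\<Sum>\<sigma>\<in>fib_perms Y \<pi>. of_int (sign (inv_into UNIV \<sigma>)) * (\<Prod>x\<in>Y. chi e (f (inv_into UNIV \<sigma> x) * g x)))"
    unfolding alt_def
    by (rule sum_fib_perms_inv[symmetric, of "\<lambda>\<sigma>. of_int (sign \<sigma>) * (\<Prod>x\<in>Y. chi e (f (\<sigma> x) * g x))"])
  also have "\<dots> = alt e Y \<pi> g f"
    unfolding alt_def
  proof (intro sum.cong refl arg_cong2[where f = "(*)"])
    fix \<sigma> assume \<sigma>: "\<sigma> \<in> fib_perms Y \<pi>"
    show "of_int (sign (inv_into UNIV \<sigma>)) = of_int (sign \<sigma>)"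
      using sign_fib_perms_inv[OF assms \<sigma>] by simp
    show "(\<Prod>x\<in>Y. chi e (f (inv_into UNIV \<sigma> x) * g x)) = (\<Prod>x\<in>Y. chi e (g (\<sigma> x) * f x))"
      using prod.reindex_bij_betw[OF fib_perms_bij[OF \<sigma>], of "\<lambda>x. chi e (f (inv_into UNIV \<sigma> x) * g x)", symmetric]
        permutes_inverses[OF fib_perms_permutes[OF \<sigma>]] by (simp add: mult.commute)
  qed
  finally show ?thesis .
qed

lemma alt_comp:
  assumes "finite Y" and \<tau>: "\<tau> \<in> fib_perms Y \<pi>"
  shows "alt e Y \<pi> f (g \<circ> \<tau>) = of_int (sign \<tau>) * alt e Y \<pi> f g"
proof -
  have "alt e Y \<pi> f (g \<circ> \<tau>)
      = (\<Sum>\<sigma>\<in>fib_perms Y \<pi>. of_int (sign (\<sigma> \<circ> \<tau>)) * (\<Prod>x\<in>Y. chi e (f ((\<sigma> \<circ> \<tau>) x) * (g \<circ> \<tau>) x)))"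
    unfolding alt_def by (rule sum_fib_perms_comp_right[OF \<tau>, symmetric, of
      "\<lambda>\<sigma>. of_int (sign \<sigma>) * (\<Prod>x\<in>Y. chi e (f (\<sigma> x) * (g \<circ> \<tau>) x))"])
  also have "\<dots> = (\<Sum>\<sigma>\<in>fib_perms Y \<pi>. of_int (sign \<tau>) *
      (of_int (sign \<sigma>) * (\<Prod>x\<in>Y. chi e (f (\<sigma> x) * g x))))"
  proof (intro sum.cong refl)
    fix \<sigma> assume \<sigma>: "\<sigma> \<in> fib_perms Y \<pi>"
    have "(\<Prod>x\<in>Y. chi e (f ((\<sigma> \<circ> \<tau>) x) * (g \<circ> \<tau>) x)) = (\<Prod>x\<in>Y. chi e (f (\<sigma> x) * g x))"
      using prod.reindex_bij_betw[OF fib_perms_bij[OF \<tau>], of "\<lambda>x. chi e (f (\<sigma> x) * g x)"] by simp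
    then show "of_int (sign (\<sigma> \<circ> \<tau>)) * (\<Prod>x\<in>Y. chi e (f ((\<sigma> \<circ> \<tau>) x) * (g \<circ> \<tau>) x))
        = of_int (sign \<tau>) * (of_int (sign \<sigma>) * (\<Prod>x\<in>Y. chi e (f (\<sigma> x) * g x)))"
      by (simp add: sign_fib_perms_comp[OF assms(1) \<sigma> \<tau>])
  qed
  finally show ?thesis
    unfolding alt_def by (simp add: sum_distrib_left)
qed

text \<open>Exchanging two columns that agree modulo \<open>e\<close> fixes the alternant and also
  reverses its sign.\<close>

lemma alt_eq_0:
  assumes "e \<ge> 1" "finite Y" "y \<in> Y" "y' \<in> Y" "\<pi> y = \<pi> y'" "y \<noteq> y'" "[g y = g y'] (mod int e)"
  shows "alt e Y \<pi> f g = 0"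
proof -
  have "alt e Y \<pi> f g = alt e Y \<pi> f (g \<circ> Transposition.transpose y y')"
    by (intro alt_cong) (use assms in \<open>auto simp: Transposition.transpose_def cong_sym\<close>)
  also have "\<dots> = - alt e Y \<pi> f g"
    using alt_comp[OF assms(2) fib_perms_transpose[OF assms(3-5)]] assms(6) by (simp add: sign_swap_id)
  finally show ?thesis by simp
qed

text \<open>A function constant on fibres is not moved by fibre-preserving permutations, so it
  contributes the same factor to every term.\<close>

lemma alt_shift:
  assumes "finite Y"
  shows "alt e Y \<pi> f (\<lambda>x. g x + c (\<pi> x)) = chi e (\<Sum>x\<in>Y. f x * c (\<pi> x)) * alt e Y \<pi> f g"
proof -
  have "(\<Prod>x\<in>Y. chi e (f (\<sigma> x) * (g x + c (\<pi> x))))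
      = chi e (\<Sum>x\<in>Y. f x * c (\<pi> x)) * (\<Prod>x\<in>Y. chi e (f (\<sigma> x) * g x))" if \<sigma>: "\<sigma> \<in> fib_perms Y \<pi>" for \<sigma>
  proof -
    have "(\<Prod>x\<in>Y. chi e (f (\<sigma> x) * c (\<pi> x))) = (\<Prod>x\<in>Y. chi e (f x * c (\<pi> x)))"
      using prod.reindex_bij_betw[OF fib_perms_bij[OF \<sigma>], of "\<lambda>x. chi e (f x * c (\<pi> x))"]
      by (simp add: fib_perms_fibre[OF \<sigma>])
    then show ?thesis
      by (simp add: ring_distribs chi_add prod.distrib chi_sum)
  qed
  then show ?thesis
    unfolding alt_def by (auto simp: sum_distrib_left intro!: sum.cong)
qed

lemma cnj_alt: "cnj (alt e Y \<pi> f g) = alt e Y \<pi> f (\<lambda>x. - g x)"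
  by (simp add: alt_def cnj_chi)

section \<open>Elementary symmetric functions: Pieri's rule and the recurrence\<close>

definition esym :: "nat \<Rightarrow> 'a set \<Rightarrow> nat \<Rightarrow> ('a \<Rightarrow> int) \<Rightarrow> complex" where
  "esym e A r f = (\<Sum>T | T \<subseteq> A \<and> card T = r. \<Prod>x\<in>T. chi e (f x))"

text \<open>Pieri's rule before straightening: summands with repeated residues are kept. The
  symmetric function is unchanged when \<open>f\<close> is composed with \<sigma>, so it can be
  expanded inside each term of the alternant.\<close>

lemma esym_mult_alt:
  assumes "finite Y"
  shows "esym e (fib Y \<pi> w) r f * alt e Y \<pi> f g
    = (\<Sum>T | T \<subseteq> fib Y \<pi> w \<and> card T = r. alt e Y \<pi> f (\<lambda>x. g x + (if x \<in> T then 1 else 0)))"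
proof -
  let ?P = "{T. T \<subseteq> fib Y \<pi> w \<and> card T = r}"
  have sub: "fib Y \<pi> w \<subseteq> Y" by (auto simp: fib_def)
  have T: "(\<Prod>x\<in>Y. chi e (f (\<sigma> x) * (g x + (if x \<in> T then 1 else 0))))
      = (\<Prod>x\<in>T. chi e (f (\<sigma> x))) * (\<Prod>x\<in>Y. chi e (f (\<sigma> x) * g x))" if "T \<in> ?P" for T \<sigma>
  proof -
    have "(\<Prod>x\<in>Y. chi e (f (\<sigma> x) * (if x \<in> T then 1 else 0))) = (\<Prod>x\<in>Y. if x \<in> T then chi e (f (\<sigma> x)) else 1)"
      by (intro prod.cong) auto
    also have "\<dots> = (\<Prod>x\<in>T. chi e (f (\<sigma> x)))"
      using that sub assms by (subst prod.If_cases) (auto intro!: prod.cong)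
    finally show ?thesis
      by (simp add: ring_distribs chi_add prod.distrib)
  qed
  have \<sigma>: "(\<Sum>T\<in>?P. \<Prod>x\<in>T. chi e (f (\<sigma> x))) = esym e (fib Y \<pi> w) r f" if \<sigma>: "\<sigma> \<in> fib_perms Y \<pi>" for \<sigma>
  proof -
    have inj: "inj \<sigma>" using permutes_inj[OF fib_perms_permutes[OF \<sigma>]] .
    have inv: "inv_into UNIV \<sigma> ` \<sigma> ` T = T" "\<sigma> ` inv_into UNIV \<sigma> ` T = T" for T
      using fib_perms_inv_comp[OF \<sigma>] by (simp_all add: image_comp)
    have im: "\<sigma> ` T \<in> ?P" if "T \<in> ?P" "\<sigma> \<in> fib_perms Y \<pi>" for T \<sigma>
    proof -
      have "\<sigma> ` T \<subseteq> fib Y \<pi> w"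
        using that(1) fib_perms_bij_fib[OF that(2), of w] by (auto simp: bij_betw_def)
      moreover have "card (\<sigma> ` T) = card T"
        using permutes_inj[OF fib_perms_permutes[OF that(2)]] by (intro card_image) (auto intro: inj_on_subset)
      ultimately show ?thesis using that(1) by auto
    qed
    show ?thesis
      unfolding esym_def
    proof (rule sum.reindex_bij_witness[where i = "image (inv_into UNIV \<sigma>)" and j = "image \<sigma>"])
      show "(\<Prod>x\<in>\<sigma> ` T. chi e (f x)) = (\<Prod>x\<in>T. chi e (f (\<sigma> x)))" for T
        by (subst prod.reindex) (auto intro: inj_on_subset[OF inj])
    qed (use im \<sigma> fib_perms_inv[OF \<sigma>] inv in auto)
  qed
  have "(\<Sum>T\<in>?P. alt e Y \<pi> f (\<lambda>x. g x + (if x \<in> T then 1 else 0)))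
      = (\<Sum>\<sigma>\<in>fib_perms Y \<pi>. \<Sum>T\<in>?P. of_int (sign \<sigma>) *
          ((\<Prod>x\<in>T. chi e (f (\<sigma> x))) * (\<Prod>x\<in>Y. chi e (f (\<sigma> x) * g x))))"
    unfolding alt_def by (subst sum.swap) (intro sum.cong refl arg_cong2[where f = "(*)"] T)
  also have "\<dots> = (\<Sum>\<sigma>\<in>fib_perms Y \<pi>. (\<Sum>T\<in>?P. \<Prod>x\<in>T. chi e (f (\<sigma> x))) *
      (of_int (sign \<sigma>) * (\<Prod>x\<in>Y. chi e (f (\<sigma> x) * g x))))"
    unfolding sum_distrib_right by (intro sum.cong refl) (simp add: mult_ac)
  also have "\<dots> = esym e (fib Y \<pi> w) r f * alt e Y \<pi> f g"
    unfolding alt_def sum_distrib_left by (intro sum.cong refl) (simp add: \<sigma>)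
  finally show ?thesis ..
qed

text \<open>The number \<open>chi e (f a)\<close> is a root of the monic polynomial whose roots are
  all \<open>chi e (f x)\<close>, and \<open>esym\<close> gives its coefficients up to sign.\<close>

lemma esym_recurrence:
  assumes "finite A" "a \<in> A"
  shows "(\<Sum>r\<le>card A. (-1) ^ r * esym e A r f * chi e (f a * (k - int r))) = 0"
proof -
  \<comment> \<open>The factor at \<open>x = a\<close> vanishes.\<close>
  have "0 = (\<Prod>x\<in>A. - chi e (f x) + chi e (f a))"
    using assms by (intro prod_zero[symmetric]) auto
  also have "\<dots> = (\<Sum>T\<in>Pow A. (\<Prod>x\<in>T. - chi e (f x)) * (\<Prod>x\<in>A - T. chi e (f a)))"
    by (rule prod_add) fact
  also have "\<dots> = (\<Sum>T\<in>Pow A. (-1) ^ card T * (\<Prod>x\<in>T. chi e (f x)) * chi e (f a * (int (card A) - int (card T))))"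
  proof (intro sum.cong refl)
    fix T assume "T \<in> Pow A"
    then have T: "T \<subseteq> A" "finite T" using assms finite_subset by auto
    have "(\<Prod>x\<in>T. - chi e (f x)) = (-1) ^ card T * (\<Prod>x\<in>T. chi e (f x))"
      by (simp add: prod_uminus)
    moreover have "(\<Prod>x\<in>A - T. chi e (f a)) = chi e (f a * (int (card A) - int (card T)))"
    proof -
      have "(\<Prod>x\<in>A - T. chi e (f a)) = chi e (int (card A - card T) * f a)"
        using T by (simp add: card_Diff_subset chi_mult_nat)
      then show ?thesis
        using card_mono[OF assms(1) T(1)] by (simp add: of_nat_diff mult.commute)
    qed
    ultimately show "(\<Prod>x\<in>T. - chi e (f x)) * (\<Prod>x\<in>A - T. chi e (f a))
        = (-1) ^ card T * (\<Prod>x\<in>T. chi e (f x)) * chi e (f a * (int (card A) - int (card T)))"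
      by simp
  qed
  also have "\<dots> = (\<Sum>r\<le>card A. \<Sum>T | T \<in> Pow A \<and> card T = r.
      (-1) ^ card T * (\<Prod>x\<in>T. chi e (f x)) * chi e (f a * (int (card A) - int (card T))))"
    using assms by (intro sum.group[symmetric]) (auto simp: card_mono)
  also have "\<dots> = (\<Sum>r\<le>card A. (-1) ^ r * esym e A r f * chi e (f a * (int (card A) - int r)))"
    unfolding esym_def sum_distrib_left sum_distrib_right by (intro sum.cong) auto
  \<comment> \<open>Multiplying by a power of the root moves the exponents from
    \<open>card A - r\<close> to \<open>k - r\<close>; negative powers are allowed since the root is
    non-zero.\<close>
  finally have "0 = chi e (f a * (k - int (card A))) *
      (\<Sum>r\<le>card A. (-1) ^ r * esym e A r f * chi e (f a * (int (card A) - int r)))"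
    by simp
  also have "\<dots> = (\<Sum>r\<le>card A. (-1) ^ r * esym e A r f * chi e (f a * (k - int r)))"
    unfolding sum_distrib_left
  proof (intro sum.cong refl)
    fix r
    have "chi e (f a * (k - int (card A))) * chi e (f a * (int (card A) - int r)) = chi e (f a * (k - int r))"
      by (simp add: algebra_simps flip: chi_add)
    then show "chi e (f a * (k - int (card A))) * ((-1) ^ r * esym e A r f * chi e (f a * (int (card A) - int r)))
        = (-1) ^ r * esym e A r f * chi e (f a * (k - int r))"
      by (metis mult.assoc mult.commute)
  qed
  finally show ?thesis ..
qed

text \<open>In the term of \<sigma> the entry at \<open>y\<close> enters only through a power of
  \<open>chi e (f (\<sigma> y))\<close>. Since \<open>\<sigma> y\<close> stays in the fibre of
  \<open>y\<close>, all terms satisfy the same recurrence.\<close>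

lemma alt_recurrence:
  assumes "finite Y" "y \<in> Y"
  shows "(\<Sum>r\<le>card (fib Y \<pi> (\<pi> y)). (-1) ^ r * esym e (fib Y \<pi> (\<pi> y)) r f *
    alt e Y \<pi> f (g(y := k - int r))) = 0"
proof -
  let ?A = "fib Y \<pi> (\<pi> y)"
  have "(\<Prod>x\<in>Y. chi e (f (\<sigma> x) * (g(y := j)) x))
      = chi e (f (\<sigma> y) * j) * (\<Prod>x\<in>Y - {y}. chi e (f (\<sigma> x) * g x))" for \<sigma> j
    using assms by (subst prod.remove[of Y y]) (auto intro!: prod.cong)
  then have "(\<Sum>r\<le>card ?A. (-1) ^ r * esym e ?A r f * alt e Y \<pi> f (g(y := k - int r)))
      = (\<Sum>\<sigma>\<in>fib_perms Y \<pi>. (\<Sum>r\<le>card ?A. (-1) ^ r * esym e ?A r f * chi e (f (\<sigma> y) * (k - int r))) *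
          (of_int (sign \<sigma>) * (\<Prod>x\<in>Y - {y}. chi e (f (\<sigma> x) * g x))))"
    unfolding alt_def sum_distrib_left sum_distrib_right by (subst sum.swap) (simp add: mult_ac)
  also have "\<dots> = 0"
  proof (intro sum.neutral ballI)
    fix \<sigma> assume "\<sigma> \<in> fib_perms Y \<pi>"
    then have "\<sigma> y \<in> ?A" "finite ?A"
      using assms by (auto simp: fib_def fib_perms_fibre fib_perms_in_Y)
    from esym_recurrence[OF this(2,1)]
    show "(\<Sum>r\<le>card ?A. (-1) ^ r * esym e ?A r f * chi e (f (\<sigma> y) * (k - int r))) *
          (of_int (sign \<sigma>) * (\<Prod>x\<in>Y - {y}. chi e (f (\<sigma> x) * g x))) = 0"
      by simp
  qed
  finally show ?thesis .
qed

section \<open>Sorting residues within the fibres\<close>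

lemma sorted_list_of_set_strict_mono_image:
  fixes f :: "'a::linorder \<Rightarrow> 'b::linorder"
  assumes "finite A" "strict_mono_on A f"
  shows "sorted_list_of_set (f ` A) = map f (sorted_list_of_set A)"
proof (rule sorted_distinct_set_unique)
  have "sorted_wrt (\<lambda>x y. f x < f y) (sorted_list_of_set A)"
    by (rule sorted_wrt_mono_rel[OF _ strict_sorted_list_of_set])
       (use assms in \<open>auto simp: strict_mono_on_def\<close>)
  then have "sorted_wrt (<) (map f (sorted_list_of_set A))"
    by (simp add: sorted_wrt_map)
  then show "sorted (map f (sorted_list_of_set A))" "distinct (map f (sorted_list_of_set A))"
    by (simp_all add: strict_sorted_iff)
qed (use assms in auto)

text \<open>Exactly the exclusion of the repetitions that make an alternant vanish by
  \<open>alt_eq_0\<close>.\<close>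

definition fib_inj :: "nat \<Rightarrow> 'a set \<Rightarrow> ('a \<Rightarrow> nat) \<Rightarrow> ('a \<Rightarrow> int) \<Rightarrow> bool" where
  "fib_inj e Y \<pi> g \<longleftrightarrow> (\<forall>y\<in>Y. \<forall>y'\<in>Y. \<pi> y = \<pi> y' \<and> [g y = g y'] (mod int e) \<longrightarrow> y = y')"

text \<open>A choice of matching points is injective because the residues of \<open>g\<close> are
  distinct in each fibre, and an injective self-map of a finite set is a permutation.\<close>

lemma match_residues:
  assumes "finite Y" "fib_inj e Y \<pi> g"
    and "\<And>y. y \<in> Y \<Longrightarrow> \<exists>y'\<in>Y. \<pi> y' = \<pi> y \<and> [g y = h y'] (mod int e)"
  obtains \<tau> where "\<tau> \<in> fib_perms Y \<pi>" "\<And>y. y \<in> Y \<Longrightarrow> [g y = h (\<tau> y)] (mod int e)"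
proof -
  obtain t where t: "\<And>y. y \<in> Y \<Longrightarrow> t y \<in> Y \<and> \<pi> (t y) = \<pi> y \<and> [g y = h (t y)] (mod int e)"
    using assms(3) by metis
  define \<tau> where "\<tau> = restrict_id t Y"
  have "inj_on \<tau> Y"
  proof (rule inj_onI)
    fix y y' assume y: "y \<in> Y" "y' \<in> Y" "\<tau> y = \<tau> y'"
    then have "t y = t y'" by (simp add: \<tau>_def)
    then have "\<pi> y = \<pi> y'" "[g y = g y'] (mod int e)"
      using t[OF y(1)] t[OF y(2)] by (metis, metis cong_sym cong_trans)
    then show "y = y'"
      using assms(2) y by (simp add: fib_inj_def)
  qed
  then have "\<tau> permutes Y"
    using assms(1) t by (intro inj_imp_permutes) (auto simp: \<tau>_def)
  then have "\<tau> \<in> fib_perms Y \<pi>"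
    using t by (auto simp: fib_perms_def \<tau>_def restrict_id_def)
  then show thesis
    using that t by (auto simp: \<tau>_def)
qed

lemma Xi_less: "\<psi> \<in> Xi e Y \<pi> \<Longrightarrow> y \<in> Y \<Longrightarrow> \<psi> y < e"
  by (auto simp: Xi_def PiE_def Pi_def)

lemma Xi_strict_mono: "\<psi> \<in> Xi e Y \<pi> \<Longrightarrow> strict_mono_on (fib Y \<pi> w) \<psi>"
  by (auto simp: Xi_def fib_def strict_mono_on_def)

lemma Xi_inj_on: "\<psi> \<in> Xi e Y \<pi> \<Longrightarrow> inj_on \<psi> (fib Y \<pi> w)"
  by (intro strict_mono_on_imp_inj_on Xi_strict_mono)

lemma nat_cong_imp_eq:
  fixes a b :: nat
  assumes "[int a = int b] (mod int e)" "a < e" "b < e"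
  shows "a = b"
  using assms by (simp add: cong_int_iff cong_less_modulus_unique_nat)

lemma Xi_fib_inj: "\<psi> \<in> Xi e Y \<pi> \<Longrightarrow> fib_inj e Y \<pi> (\<lambda>y. int (\<psi> y))"
  unfolding fib_inj_def using Xi_inj_on[of \<psi> e Y \<pi>] Xi_less[of \<psi> e Y \<pi>] nat_cong_imp_eq
  by (auto simp: inj_on_def fib_def)

lemma Xi_ext:
  assumes "\<psi> \<in> Xi e Y \<pi>" "\<psi>' \<in> Xi e Y \<pi>" "\<And>y. y \<in> Y \<Longrightarrow> \<psi> y = \<psi>' y"
  shows "\<psi> = \<psi>'"
  using assms by (auto simp: Xi_def intro: PiE_ext)

text \<open>An increasing map on a fibre is recovered from its set of values, which is why the maps
  \<psi> can stand for symbols.\<close>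

lemma Xi_eqI:
  assumes "finite Y" "\<psi> \<in> Xi e Y \<pi>" "\<psi>' \<in> Xi e Y \<pi>"
    and "\<And>w. \<psi> ` fib Y \<pi> w = \<psi>' ` fib Y \<pi> w"
  shows "\<psi> = \<psi>'"
proof (rule Xi_ext[OF assms(2,3)])
  fix y assume y: "y \<in> Y"
  let ?A = "fib Y \<pi> (\<pi> y)"
  have A: "finite ?A" "y \<in> ?A" using assms(1) y by (auto simp: fib_def)
  have "map \<psi> (sorted_list_of_set ?A) = map \<psi>' (sorted_list_of_set ?A)"
    using assms(4)[of "\<pi> y"] A(1) assms(2,3)
    by (metis Xi_strict_mono sorted_list_of_set_strict_mono_image)
  then show "\<psi> y = \<psi>' y"
    using A by simp
qed

lemma Xi_perm_unique:
  assumes "finite Y" "\<psi> \<in> Xi e Y \<pi>" "\<psi>' \<in> Xi e Y \<pi>" "\<rho> \<in> fib_perms Y \<pi>"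
    and eq: "\<And>y. y \<in> Y \<Longrightarrow> \<psi> y = \<psi>' (\<rho> y)"
  shows "\<psi> = \<psi>'" "\<rho> = id"
proof -
  show 1: "\<psi> = \<psi>'"
  proof (rule Xi_eqI[OF assms(1-3)])
    fix w
    have "\<psi> ` fib Y \<pi> w = \<psi>' ` \<rho> ` fib Y \<pi> w"
      unfolding image_image using eq by (intro image_cong) (auto simp: fib_def)
    then show "\<psi> ` fib Y \<pi> w = \<psi>' ` fib Y \<pi> w"
      using fib_perms_bij_fib[OF assms(4), of w] by (simp add: bij_betw_def)
  qed
  have "\<rho> y = y" for y
  proof (cases "y \<in> Y")
    case True
    then have "y \<in> fib Y \<pi> (\<pi> y)" "\<rho> y \<in> fib Y \<pi> (\<pi> y)"
      using assms(4) by (auto simp: fib_def fib_perms_fibre fib_perms_in_Y)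
    then show ?thesis
      using eq[OF True] 1 inj_onD[OF Xi_inj_on[OF assms(3)]] by metis
  next
    case False
    then show ?thesis
      using fib_perms_permutes[OF assms(4)] by (simp add: permutes_not_in)
  qed
  then show "\<rho> = id" by auto
qed

text \<open>Straightening: the entries are reduced modulo \<open>e\<close> and rearranged
  increasingly in each fibre; \<tau> records the rearrangement.\<close>

lemma Xi_sort:
  assumes e: "e \<ge> 1" and Y: "finite Y" and g: "fib_inj e Y \<pi> g"
  obtains \<psi> \<tau> where "\<psi> \<in> Xi e Y \<pi>" "\<tau> \<in> fib_perms Y \<pi>"
    "\<And>y. y \<in> Y \<Longrightarrow> [g y = int (\<psi> (\<tau> y))] (mod int e)"
proof -
  define r where "r y = nat (g y mod int e)" for y
  have r: "int (r y) = g y mod int e" "r y < e" for y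
    using e by (auto simp: r_def nat_less_iff)
  define A where "A w = r ` fib Y \<pi> w" for w
  \<comment> \<open>The rank of \<open>y\<close> in its fibre, counted from 0; \<psi> assigns to
    \<open>y\<close> the residue of the same rank.\<close>
  define idx where "idx y = card {x \<in> fib Y \<pi> (\<pi> y). x < y}" for y
  have finA: "finite (A w)" for w
    using Y by (auto simp: A_def fib_def)
  have "inj_on r (fib Y \<pi> w)" for w
  proof (rule inj_onI)
    fix y y' assume "y \<in> fib Y \<pi> w" "y' \<in> fib Y \<pi> w" "r y = r y'"
    then show "y = y'"
      using g r(1)[of y] r(1)[of y'] by (auto simp: fib_inj_def fib_def cong_def)
  qed
  then have cardA: "card (A w) = card (fib Y \<pi> w)" for w
    unfolding A_def by (rule card_image)
  have idx_less: "idx y < card (A (\<pi> y))" if "y \<in> Y" for y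
    unfolding idx_def cardA using that Y by (intro psubset_card_mono) (auto simp: fib_def)
  have idx_mono: "idx y < idx y'" if "y \<in> Y" "y' \<in> Y" "y < y'" "\<pi> y = \<pi> y'" for y y'
    unfolding idx_def using that Y by (intro psubset_card_mono) (auto simp: fib_def)
  define \<psi> where "\<psi> = (\<lambda>y\<in>Y. sorted_list_of_set (A (\<pi> y)) ! idx y)"
  have \<psi>A: "\<psi> y \<in> A (\<pi> y)" if "y \<in> Y" for y
    using that idx_less[OF that] finA[of "\<pi> y"] nth_mem[of "idx y" "sorted_list_of_set (A (\<pi> y))"]
    by (simp add: \<psi>_def)
  have \<psi>: "\<psi> \<in> Xi e Y \<pi>"
    unfolding Xi_def
  proof (intro CollectI conjI ballI impI)
    show "\<psi> \<in> Y \<rightarrow>\<^sub>E {0..<e}"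
      using \<psi>A r(2) by (auto simp: \<psi>_def A_def) fastforce
    fix y y' assume y: "y \<in> Y" "y' \<in> Y" "y < y' \<and> \<pi> y = \<pi> y'"
    show "\<psi> y < \<psi> y'"
      using y idx_mono[of y y'] idx_less[OF y(2)]
        sorted_wrt_nth_less[OF strict_sorted_list_of_set, of "idx y" "idx y'" "A (\<pi> y')"]
      by (simp add: \<psi>_def)
  qed
  have "\<psi> ` fib Y \<pi> w = A w" for w
  proof (rule card_subset_eq[OF finA])
    show "\<psi> ` fib Y \<pi> w \<subseteq> A w" using \<psi>A by (auto simp: fib_def)
    show "card (\<psi> ` fib Y \<pi> w) = card (A w)"
      using card_image[OF Xi_inj_on[OF \<psi>]] cardA by simp
  qed
  then have "r y \<in> \<psi> ` fib Y \<pi> (\<pi> y)" if "y \<in> Y" for y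
    using that by (auto simp: A_def fib_def)
  then have "\<exists>y'\<in>Y. \<pi> y' = \<pi> y \<and> [g y = int (\<psi> y')] (mod int e)" if "y \<in> Y" for y
    using that r(1)[of y] by (fastforce simp: fib_def cong_def)
  from match_residues[OF Y g this] obtain \<tau> where "\<tau> \<in> fib_perms Y \<pi>"
    "\<And>y. y \<in> Y \<Longrightarrow> [g y = int (\<psi> (\<tau> y))] (mod int e)"
    by blast
  with \<psi> that show thesis by blast
qed

text \<open>Trades a sum over increasing maps for one over all fibrewise injective maps, at the
  price of the order of the permutation group.\<close>

lemma bij_betw_Xi_fib_perms:
  assumes e: "e \<ge> 1" and Y: "finite Y"
  shows "bij_betw (\<lambda>(\<psi>, \<tau>). \<psi> \<circ> \<tau>) (Xi e Y \<pi> \<times> fib_perms Y \<pi>)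
    {g \<in> Y \<rightarrow>\<^sub>E {..<e}. fib_inj e Y \<pi> (\<lambda>x. int (g x))}"
proof (rule bij_betw_imageI)
  show "inj_on (\<lambda>(\<psi>, \<tau>). \<psi> \<circ> \<tau>) (Xi e Y \<pi> \<times> fib_perms Y \<pi>)"
  proof (rule inj_onI, clarify)
    fix \<psi> \<tau> \<psi>' \<tau>'
    assume *: "\<psi> \<in> Xi e Y \<pi>" "\<psi>' \<in> Xi e Y \<pi>" "\<tau> \<in> fib_perms Y \<pi>" "\<tau>' \<in> fib_perms Y \<pi>"
      and eq: "\<psi> \<circ> \<tau> = \<psi>' \<circ> \<tau>'"
    \<comment> \<open>The equation becomes \<open>\<psi> = \<psi>' \<circ> \<rho>\<close>, and
      monotonicity of both maps on the fibres forces \<rho> to be the identity.\<close>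
    define \<rho> where "\<rho> = \<tau>' \<circ> inv_into UNIV \<tau>"
    have \<rho>: "\<rho> \<in> fib_perms Y \<pi>"
      unfolding \<rho>_def by (intro fib_perms_comp fib_perms_inv *)
    have "\<psi> = \<psi> \<circ> (\<tau> \<circ> inv_into UNIV \<tau>)"
      using fib_perms_inv_comp[OF *(3)] by simp
    also have "\<dots> = \<psi>' \<circ> \<rho>"
      using eq by (metis \<rho>_def comp_assoc)
    finally have "\<psi> y = \<psi>' (\<rho> y)" for y
      by (metis comp_apply)
    from Xi_perm_unique[OF Y *(1,2) \<rho> this] have "\<psi> = \<psi>'" "\<rho> = id"
      by auto
    moreover have "\<tau>' = \<rho> \<circ> \<tau>"
      unfolding \<rho>_def comp_assoc using fib_perms_inv_comp[OF *(3)] by simp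
    ultimately show "\<psi> = \<psi>' \<and> \<tau> = \<tau>'"
      by simp
  qed
  show "(\<lambda>(\<psi>, \<tau>). \<psi> \<circ> \<tau>) ` (Xi e Y \<pi> \<times> fib_perms Y \<pi>)
      = {g \<in> Y \<rightarrow>\<^sub>E {..<e}. fib_inj e Y \<pi> (\<lambda>x. int (g x))}" (is "_ = ?F")
  proof (intro equalityI subsetI)
    fix g assume "g \<in> (\<lambda>(\<psi>, \<tau>). \<psi> \<circ> \<tau>) ` (Xi e Y \<pi> \<times> fib_perms Y \<pi>)"
    then obtain \<psi> \<tau> where *: "\<psi> \<in> Xi e Y \<pi>" "\<tau> \<in> fib_perms Y \<pi>" "g = \<psi> \<circ> \<tau>" by auto
    have "y = y'" if "y \<in> Y" "y' \<in> Y" "\<pi> y = \<pi> y'" "[int (g y) = int (g y')] (mod int e)" for y y'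
    proof -
      have "\<tau> y = \<tau> y'"
        using Xi_fib_inj[OF *(1)] that *(2) by (auto simp: fib_inj_def *(3) fib_perms_in_Y fib_perms_fibre)
      then show ?thesis
        using permutes_inj[OF fib_perms_permutes[OF *(2)]] by (simp add: inj_eq)
    qed
    then have "fib_inj e Y \<pi> (\<lambda>x. int (g x))" by (auto simp: fib_inj_def)
    moreover have "g y = undefined" if "y \<notin> Y" for y
      using that * permutes_not_in[OF fib_perms_permutes[OF *(2)] that]
      by (auto simp: Xi_def PiE_def extensional_def)
    ultimately show "g \<in> ?F"
      using Xi_less[OF *(1)] *(2) by (auto simp: *(3) fib_perms_in_Y)
  next
    fix g assume g: "g \<in> ?F"
    then obtain \<psi> \<tau> where *: "\<psi> \<in> Xi e Y \<pi>" "\<tau> \<in> fib_perms Y \<pi>"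
      "\<And>y. y \<in> Y \<Longrightarrow> [int (g y) = int (\<psi> (\<tau> y))] (mod int e)"
      using Xi_sort[OF e Y, of \<pi> "\<lambda>x. int (g x)"] by auto
    have "g y = (\<psi> \<circ> \<tau>) y" for y
    proof (cases "y \<in> Y")
      case True
      then show ?thesis
        using nat_cong_imp_eq[OF *(3)[OF True]] g Xi_less[OF *(1)] *(2) by (auto simp: fib_perms_in_Y)
    next
      case False
      then show ?thesis
        using g *(1) permutes_not_in[OF fib_perms_permutes[OF *(2)] False]
        by (auto simp: Xi_def PiE_def extensional_def)
    qed
    then have "g = (\<lambda>(\<psi>, \<tau>). \<psi> \<circ> \<tau>) (\<psi>, \<tau>)" by auto
    then show "g \<in> (\<lambda>(\<psi>, \<tau>). \<psi> \<circ> \<tau>) ` (Xi e Y \<pi> \<times> fib_perms Y \<pi>)"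
      using * by (intro image_eqI[of _ _ "(\<psi>, \<tau>)"]) auto
  qed
qed

section \<open>Orthogonality over all increasing maps\<close>

text \<open>The sum over \<open>Xi\<close> is extended to all maps from \<open>Y\<close> to the
  residues; there it factors over the points of \<open>Y\<close> into character sums.\<close>

lemma alt_orthogonality:
  assumes e: "e \<ge> 1" and Y: "finite Y"
  shows "of_nat (card (fib_perms Y \<pi>)) *
      (\<Sum>\<psi>\<in>Xi e Y \<pi>. alt e Y \<pi> f (\<lambda>x. int (\<psi> x)) * cnj (alt e Y \<pi> f' (\<lambda>x. int (\<psi> x))))
    = of_nat (e ^ card Y) * (\<Sum>\<sigma>\<in>fib_perms Y \<pi>. \<Sum>\<tau>\<in>fib_perms Y \<pi>. of_int (sign \<sigma> * sign \<tau>) *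
        of_bool (\<forall>x\<in>Y. [f (\<sigma> x) = f' (\<tau> x)] (mod int e)))" (is "_ * ?S = ?R")
proof -
  define H where "H g = alt e Y \<pi> f (\<lambda>x. int (g x)) * cnj (alt e Y \<pi> f' (\<lambda>x. int (g x)))"
    for g :: "'a \<Rightarrow> nat"
  let ?G = "fib_perms Y \<pi>" and ?F = "Y \<rightarrow>\<^sub>E {..<e}"
  have finF: "finite ?F" using Y by (intro finite_PiE) auto
  \<comment> \<open>Maps with a repeated value in some fibre contribute nothing.\<close>
  have "(\<Sum>g\<in>?F. H g) = (\<Sum>g | g \<in> ?F \<and> fib_inj e Y \<pi> (\<lambda>x. int (g x)). H g)"
  proof (rule sum.mono_neutral_right[OF finF])
    show "\<forall>g\<in>?F - {g \<in> ?F. fib_inj e Y \<pi> (\<lambda>x. int (g x))}. H g = 0"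
    proof
      fix g assume "g \<in> ?F - {g \<in> ?F. fib_inj e Y \<pi> (\<lambda>x. int (g x))}"
      then obtain y y' where "y \<in> Y" "y' \<in> Y" "\<pi> y = \<pi> y'" "y \<noteq> y'" "[int (g y) = int (g y')] (mod int e)"
        by (auto simp: fib_inj_def)
      then show "H g = 0"
        unfolding H_def by (simp add: alt_eq_0[OF e Y])
    qed
  qed auto
  also have "\<dots> = (\<Sum>(\<psi>, \<tau>)\<in>Xi e Y \<pi> \<times> ?G. H (\<psi> \<circ> \<tau>))"
    using sum.reindex_bij_betw[OF bij_betw_Xi_fib_perms[OF e Y, of \<pi>], of H]
    by (simp add: case_prod_beta)
  \<comment> \<open>Rearranging the entries multiplies both alternants by the same sign, which
    cancels.\<close>
  also have "\<dots> = (\<Sum>(\<psi>, \<tau>)\<in>Xi e Y \<pi> \<times> ?G. H \<psi>)"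
  proof (intro sum.cong refl, clarify)
    fix \<psi> \<tau> assume \<tau>: "\<tau> \<in> ?G"
    have "(\<lambda>x. int ((\<psi> \<circ> \<tau>) x)) = (\<lambda>x. int (\<psi> x)) \<circ> \<tau>" by auto
    then show "H (\<psi> \<circ> \<tau>) = H \<psi>"
      unfolding H_def by (simp add: alt_comp[OF Y \<tau>] flip: of_int_mult)
  qed
  also have "\<dots> = of_nat (card ?G) * ?S"
    by (simp add: H_def sum_distrib_left flip: sum.cartesian_product)
  finally have 1: "(\<Sum>g\<in>?F. H g) = of_nat (card ?G) * ?S" .
  have "H g = (\<Sum>\<sigma>\<in>?G. \<Sum>\<tau>\<in>?G. of_int (sign \<sigma> * sign \<tau>) *
      (\<Prod>x\<in>Y. chi e (int (g x) * (f (\<sigma> x) - f' (\<tau> x)))))" for g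
  proof -
    have "chi e (f (\<sigma> x) * int (g x)) * chi e (f' (\<tau> x) * - int (g x))
        = chi e (int (g x) * (f (\<sigma> x) - f' (\<tau> x)))" for \<sigma> \<tau> x
      by (simp add: algebra_simps flip: chi_add)
    then show ?thesis
      unfolding H_def cnj_alt unfolding alt_def sum_product
      by (intro sum.cong refl) (simp add: mult_ac flip: prod.distrib)
  qed
  then have "(\<Sum>g\<in>?F. H g) = (\<Sum>g\<in>?F. \<Sum>\<sigma>\<in>?G. \<Sum>\<tau>\<in>?G. of_int (sign \<sigma> * sign \<tau>) *
      (\<Prod>x\<in>Y. chi e (int (g x) * (f (\<sigma> x) - f' (\<tau> x)))))"
    by simp
  also have "\<dots> = (\<Sum>\<sigma>\<in>?G. \<Sum>\<tau>\<in>?G. of_int (sign \<sigma> * sign \<tau>) *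
      (\<Sum>g\<in>?F. \<Prod>x\<in>Y. chi e (int (g x) * (f (\<sigma> x) - f' (\<tau> x)))))"
    unfolding sum_distrib_left
    by (subst sum.swap, intro sum.cong refl, subst sum.swap) simp
  also have "\<dots> = (\<Sum>\<sigma>\<in>?G. \<Sum>\<tau>\<in>?G. of_int (sign \<sigma> * sign \<tau>) *
      (of_nat (e ^ card Y) * of_bool (\<forall>x\<in>Y. [f (\<sigma> x) = f' (\<tau> x)] (mod int e))))"
  proof (intro sum.cong refl arg_cong2[where f = "(*)"])
    fix \<sigma> \<tau>
    \<comment> \<open>The values of \<open>g\<close> at the points of \<open>Y\<close> are chosen
      independently, so sum and product can be exchanged.\<close>
    have "(\<Sum>g\<in>?F. \<Prod>x\<in>Y. chi e (int (g x) * (f (\<sigma> x) - f' (\<tau> x))))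
        = (\<Prod>x\<in>Y. \<Sum>k<e. chi e (int k * (f (\<sigma> x) - f' (\<tau> x))))"
      using Y by (subst prod_sum_PiE) auto
    also have "\<dots> = (\<Prod>x\<in>Y. if [f (\<sigma> x) = f' (\<tau> x)] (mod int e) then of_nat e else 0)"
      by (simp add: sum_chi[OF e] cong_iff_dvd_diff)
    also have "\<dots> = of_nat (e ^ card Y) * of_bool (\<forall>x\<in>Y. [f (\<sigma> x) = f' (\<tau> x)] (mod int e))"
    proof (cases "\<forall>x\<in>Y. [f (\<sigma> x) = f' (\<tau> x)] (mod int e)")
      case False
      then show ?thesis using Y by (auto intro!: prod_zero)
    qed simp
    finally show "(\<Sum>g\<in>?F. \<Prod>x\<in>Y. chi e (int (g x) * (f (\<sigma> x) - f' (\<tau> x))))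
        = of_nat (e ^ card Y) * of_bool (\<forall>x\<in>Y. [f (\<sigma> x) = f' (\<tau> x)] (mod int e))" .
  qed
  also have "\<dots> = ?R"
    by (simp add: sum_distrib_left mult_ac)
  finally show ?thesis
    using 1 by simp
qed

section \<open>The Fourier matrix in terms of alternants\<close>

lemma sum_symb:
  assumes "finite Y" "\<psi> \<in> Xi e Y \<pi>"
  shows "(\<Sum>w\<in>\<pi> ` Y. sum_list (symb Y \<pi> \<psi> w)) = (\<Sum>y\<in>Y. \<psi> y)"
proof -
  have "sum_list (symb Y \<pi> \<psi> w) = (\<Sum>y | y \<in> Y \<and> \<pi> y = w. \<psi> y)" if "w \<in> \<pi> ` Y" for w
  proof -
    have "finite (fib Y \<pi> w)" using assms(1) by (auto simp: fib_def)
    then have "sum_list (symb Y \<pi> \<psi> w) = \<Sum> (\<psi> ` fib Y \<pi> w)"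
      using that by (simp add: symb_def distinct_sum_list_conv_Sum)
    also have "\<dots> = (\<Sum>y\<in>fib Y \<pi> w. \<psi> y)"
      using sum.reindex[OF Xi_inj_on[OF assms(2)], of id] by simp
    finally show ?thesis by (simp add: fib_def)
  qed
  then show ?thesis
    by (simp add: sum.image_gen[OF assms(1), of \<psi> \<pi>])
qed

lemma E'_iff:
  assumes "finite Y"
  shows "\<psi> \<in> E' e m Y \<pi> \<longleftrightarrow>
    \<psi> \<in> Xi e Y \<pi> \<and> [(\<Sum>y\<in>Y. int (\<psi> y)) = int (m * (e choose 2))] (mod int e)"
  unfolding E'_def using sum_symb[OF assms]
  by (auto simp flip: cong_int_iff of_nat_sum)

lemma finite_Xi: "finite Y \<Longrightarrow> finite (Xi e Y \<pi>)"
  by (rule finite_subset[of _ "Y \<rightarrow>\<^sub>E {0..<e}"]) (auto simp: Xi_def intro: finite_PiE)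

lemma finite_E': "finite Y \<Longrightarrow> finite (E' e m Y \<pi>)"
  by (rule finite_subset[OF _ finite_Xi]) (auto simp: E'_def)

text \<open>Summation over \<open>Y\<close> shows that the shift changes the sum of the entries by
  \<open>card Y * k\<close>, which is congruent to \<open>k\<close>, while both sums lie in the
  class defining \<open>E'\<close>. So \<open>k = 0\<close>, and the factorisation of a fibrewise
  injective map is unique.\<close>

lemma E'_shift_unique:
  assumes e: "e \<ge> 1" and Y: "finite Y" and cY: "card Y = e * m + 1"
    and \<psi>1: "\<psi>1 \<in> E' e m Y \<pi>" and \<psi>2: "\<psi>2 \<in> E' e m Y \<pi>"
    and \<sigma>: "\<sigma> \<in> fib_perms Y \<pi>" and \<tau>: "\<tau> \<in> fib_perms Y \<pi>" and k: "k < e"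
  shows "(\<forall>x\<in>Y. [int (\<psi>1 (\<sigma> x)) + int k = int (\<psi>2 (\<tau> x))] (mod int e)) \<longleftrightarrow>
    k = 0 \<and> \<psi>1 = \<psi>2 \<and> \<sigma> = \<tau>"
proof
  assume *: "\<forall>x\<in>Y. [int (\<psi>1 (\<sigma> x)) + int k = int (\<psi>2 (\<tau> x))] (mod int e)"
  have X: "\<psi>1 \<in> Xi e Y \<pi>" "\<psi>2 \<in> Xi e Y \<pi>" using \<psi>1 \<psi>2 by (auto simp: E'_iff[OF Y])
  have "[(\<Sum>x\<in>Y. int (\<psi>1 (\<sigma> x)) + int k) = (\<Sum>x\<in>Y. int (\<psi>2 (\<tau> x)))] (mod int e)"
    using * by (intro cong_sum) auto
  also have "(\<Sum>x\<in>Y. int (\<psi>1 (\<sigma> x)) + int k) = (\<Sum>x\<in>Y. int (\<psi>1 x)) + int (card Y) * int k"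
    using sum.reindex_bij_betw[OF fib_perms_bij[OF \<sigma>], of "\<lambda>x. int (\<psi>1 x)"] by (simp add: sum.distrib)
  also have "(\<Sum>x\<in>Y. int (\<psi>2 (\<tau> x))) = (\<Sum>x\<in>Y. int (\<psi>2 x))"
    by (rule sum.reindex_bij_betw[OF fib_perms_bij[OF \<tau>]])
  finally have "[(\<Sum>x\<in>Y. int (\<psi>1 x)) + int (card Y) * int k = (\<Sum>x\<in>Y. int (\<psi>2 x))] (mod int e)" .
  moreover have "[(\<Sum>x\<in>Y. int (\<psi>1 x)) = (\<Sum>x\<in>Y. int (\<psi>2 x))] (mod int e)"
    using \<psi>1 \<psi>2 unfolding E'_iff[OF Y] by (blast intro: cong_trans cong_sym)
  ultimately have "[(\<Sum>x\<in>Y. int (\<psi>1 x)) + int (card Y) * int k = (\<Sum>x\<in>Y. int (\<psi>1 x)) + 0] (mod int e)"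
    by (metis add_0_right cong_sym cong_trans)
  then have "[int (card Y) * int k = 0] (mod int e)"
    by (simp only: cong_add_lcancel)
  then have "int e dvd int e * (int m * int k) + int k"
    unfolding cY cong_0_iff by (simp add: algebra_simps)
  then have "int e dvd int k"
    by (metis dvd_add_right_iff dvd_triv_left)
  then have k0: "k = 0"
    using k by (auto dest: nat_dvd_not_less)
  have "\<psi>1 \<circ> \<sigma> = \<psi>2 \<circ> \<tau>"
  proof
    fix x
    show "(\<psi>1 \<circ> \<sigma>) x = (\<psi>2 \<circ> \<tau>) x"
    proof (cases "x \<in> Y")
      case True
      then show ?thesis
        using * k0 \<sigma> \<tau> nat_cong_imp_eq[of "\<psi>1 (\<sigma> x)" "\<psi>2 (\<tau> x)" e]
          Xi_less[OF X(1), of "\<sigma> x"] Xi_less[OF X(2), of "\<tau> x"] by (simp add: fib_perms_in_Y)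
    next
      case False
      then show ?thesis
        using X permutes_not_in[OF fib_perms_permutes[OF \<sigma>] False] permutes_not_in[OF fib_perms_permutes[OF \<tau>] False]
        by (auto simp: Xi_def PiE_def extensional_def)
    qed
  qed
  then have "(\<psi>1, \<sigma>) = (\<psi>2, \<tau>)"
    using bij_betw_imp_inj_on[OF bij_betw_Xi_fib_perms[OF e Y, of \<pi>]] X \<sigma> \<tau>
    by (auto dest: inj_onD[where x = "(\<psi>1, \<sigma>)" and y = "(\<psi>2, \<tau>)"])
  with k0 show "k = 0 \<and> \<psi>1 = \<psi>2 \<and> \<sigma> = \<tau>" by simp
qed simp

text \<open>The congruence defining \<open>E'\<close> inside \<open>Xi\<close> is detected by
  averaging over the characters indexed by \<open>k < e\<close>. Each character is absorbed as a
  shift by \<open>k\<close>, and the shifts with \<open>k \<noteq> 0\<close> contribute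
  nothing.\<close>

lemma alt_orthogonality_E':
  assumes e: "e \<ge> 1" and Y: "finite Y" and cY: "card Y = e * m + 1"
    and \<psi>1: "\<psi>1 \<in> E' e m Y \<pi>" and \<psi>2: "\<psi>2 \<in> E' e m Y \<pi>"
  shows "of_nat e * (\<Sum>\<psi>\<in>E' e m Y \<pi>. alt e Y \<pi> (\<lambda>x. int (\<psi>1 x)) (\<lambda>x. int (\<psi> x)) *
      cnj (alt e Y \<pi> (\<lambda>x. int (\<psi>2 x)) (\<lambda>x. int (\<psi> x))))
    = (if \<psi>1 = \<psi>2 then of_nat (e ^ card Y) else 0)"
proof -
  let ?G = "fib_perms Y \<pi>"
  define t where "t = int (m * (e choose 2))"
  define A where "A f \<psi> = alt e Y \<pi> f (\<lambda>x. int (\<psi> x))" for f and \<psi> :: "'a \<Rightarrow> nat"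
  define f1 f2 where "f1 = (\<lambda>x. int (\<psi>1 x))" and "f2 = (\<lambda>x. int (\<psi>2 x))"
  \<comment> \<open>\<open>alt_shift\<close> with the roles of the two arguments exchanged.\<close>
  have shift: "chi e (int k * (\<Sum>x\<in>Y. int (\<psi> x))) * A f1 \<psi> = A (\<lambda>x. f1 x + int k) \<psi>" for k \<psi>
    using alt_shift[OF Y, of e \<pi> "\<lambda>x. int (\<psi> x)" f1 "\<lambda>_. int k"]
    by (simp add: A_def alt_commute[OF Y, of e \<pi> _ "\<lambda>x. int (\<psi> x)"] sum_distrib_left mult.commute)
  \<comment> \<open>The sum over \<open>k\<close> is \<open>e\<close> on \<open>E'\<close> and 0 on
    the rest of \<open>Xi\<close>.\<close>
  have "of_nat e * (\<Sum>\<psi>\<in>E' e m Y \<pi>. A f1 \<psi> * cnj (A f2 \<psi>))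
      = (\<Sum>\<psi>\<in>Xi e Y \<pi>. (\<Sum>k<e. chi e (int k * ((\<Sum>x\<in>Y. int (\<psi> x)) - t))) * (A f1 \<psi> * cnj (A f2 \<psi>)))"
  proof -
    have "(\<Sum>\<psi>\<in>Xi e Y \<pi>. (\<Sum>k<e. chi e (int k * ((\<Sum>x\<in>Y. int (\<psi> x)) - t))) * (A f1 \<psi> * cnj (A f2 \<psi>)))
        = (\<Sum>\<psi>\<in>Xi e Y \<pi>. if \<psi> \<in> E' e m Y \<pi> then of_nat e * (A f1 \<psi> * cnj (A f2 \<psi>)) else 0)"
      by (intro sum.cong refl) (auto simp: sum_chi[OF e] E'_iff[OF Y] t_def cong_iff_dvd_diff)
    also have "\<dots> = (\<Sum>\<psi>\<in>E' e m Y \<pi>. of_nat e * (A f1 \<psi> * cnj (A f2 \<psi>)))"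
      by (rule sum.mono_neutral_cong_right) (auto simp: finite_Xi[OF Y] E'_iff[OF Y])
    finally show ?thesis by (simp add: sum_distrib_left)
  qed
  also have "\<dots> = (\<Sum>k<e. chi e (- (int k * t)) *
      (\<Sum>\<psi>\<in>Xi e Y \<pi>. A (\<lambda>x. f1 x + int k) \<psi> * cnj (A f2 \<psi>)))"
  proof -
    have "chi e (int k * ((\<Sum>x\<in>Y. int (\<psi> x)) - t)) * (A f1 \<psi> * cnj (A f2 \<psi>))
        = chi e (- (int k * t)) * (A (\<lambda>x. f1 x + int k) \<psi> * cnj (A f2 \<psi>))" for k \<psi>
    proof -
      have "int k * ((\<Sum>x\<in>Y. int (\<psi> x)) - t) = - (int k * t) + int k * (\<Sum>x\<in>Y. int (\<psi> x))"
        by (simp add: algebra_simps)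
      then show ?thesis
        by (simp only: chi_add shift[symmetric] mult.assoc)
    qed
    then show ?thesis
      unfolding sum_distrib_right sum_distrib_left by (subst sum.swap) (simp only:)
  qed
  finally have "of_nat (card ?G) * (of_nat e * (\<Sum>\<psi>\<in>E' e m Y \<pi>. A f1 \<psi> * cnj (A f2 \<psi>)))
      = (\<Sum>k<e. chi e (- (int k * t)) * (of_nat (card ?G) *
          (\<Sum>\<psi>\<in>Xi e Y \<pi>. A (\<lambda>x. f1 x + int k) \<psi> * cnj (A f2 \<psi>))))"
    by (simp add: sum_distrib_left mult.left_commute)
  \<comment> \<open>What survives is \<open>k = 0\<close> and \<sigma> = \<tau>; this diagonal
    produces the factor \<open>card ?G\<close> that is cancelled in the end.\<close>
  also have "\<dots> = (\<Sum>k<e. chi e (- (int k * t)) * (of_nat (e ^ card Y) *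
      (\<Sum>\<sigma>\<in>?G. \<Sum>\<tau>\<in>?G. of_int (sign \<sigma> * sign \<tau>) * of_bool (k = 0 \<and> \<psi>1 = \<psi>2 \<and> \<sigma> = \<tau>))))"
    unfolding A_def alt_orthogonality[OF e Y]
    by (intro sum.cong refl arg_cong2[where f = "(*)"] arg_cong[where f = of_bool])
       (simp add: f1_def f2_def E'_shift_unique[OF e Y cY \<psi>1 \<psi>2])
  also have "\<dots> = (\<Sum>k<e. if k = 0 then of_nat (e ^ card Y) *
      (\<Sum>\<sigma>\<in>?G. \<Sum>\<tau>\<in>?G. if \<sigma> = \<tau> then of_bool (\<psi>1 = \<psi>2) else 0) else 0)"
    by (intro sum.cong refl) (auto intro!: sum.cong simp del: of_int_mult)
  also have "\<dots> = of_nat (card ?G) * (if \<psi>1 = \<psi>2 then of_nat (e ^ card Y) else 0)"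
    using e by (simp add: sum.delta finite_fib_perms[OF Y])
  finally show ?thesis
    using fib_perms_id[of Y \<pi>] finite_fib_perms[OF Y, of \<pi>] by (auto simp: A_def f1_def f2_def)
qed

section \<open>Factorisation of signed sums over the fibres\<close>

lemma sum_permutes_reindex:
  fixes F :: "'b \<Rightarrow> 'b \<Rightarrow> 'c :: comm_ring_1"
  assumes p: "bij_betw p A B" and A: "finite A"
  shows "(\<Sum>\<sigma> | \<sigma> permutes B. of_int (sign \<sigma>) * (\<Prod>y\<in>B. F y (\<sigma> y)))
    = (\<Sum>\<sigma> | \<sigma> permutes A. of_int (sign \<sigma>) * (\<Prod>x\<in>A. F (p x) (p (\<sigma> x))))"
proof -
  have inj: "inj_on p A" using p by (simp add: bij_betw_def)
  \<comment> \<open>\<open>bij_betw_permutations\<close> describes the conjugation by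
    \<open>p\<close> in this expanded form.\<close>
  have "(\<lambda>\<sigma> x. if x \<in> B then p (\<sigma> (inv_into A p x)) else x) = map_permutation A p"
    using p by (auto simp: fun_eq_iff map_permutation_def restrict_id_def bij_betw_def)
  then have bij: "bij_betw (map_permutation A p) {\<sigma>. \<sigma> permutes A} {\<sigma>. \<sigma> permutes B}"
    using bij_betw_permutations[OF p] by simp
  show ?thesis
    by (subst sum.reindex_bij_betw[OF bij, symmetric], intro sum.cong refl,
        subst prod.reindex_bij_betw[OF p, symmetric])
       (auto simp: sign_map_permutation[OF inj _ A] map_permutation_apply[OF inj])
qed

lemma fib_perms_eq_permutes:
  assumes "\<And>y. y \<in> A \<Longrightarrow> \<pi> y = w"
  shows "fib_perms A \<pi> = {\<sigma>. \<sigma> permutes A}"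
proof -
  have "\<pi> (\<sigma> y) = \<pi> y" if "\<sigma> permutes A" for \<sigma> y
    using assms permutes_in_image[OF that, of y] permutes_not_in[OF that, of y]
    by (cases "y \<in> A") auto
  then show ?thesis by (auto simp: fib_perms_def)
qed

lemma fib_perms_mono: "A \<subseteq> B \<Longrightarrow> fib_perms A \<pi> \<subseteq> fib_perms B \<pi>"
  by (auto simp: fib_perms_def intro: permutes_subset)

lemma fib_perms_restrict_id:
  assumes "finite B" "A \<subseteq> B" "\<pi> ` A \<inter> \<pi> ` (B - A) = {}" "\<rho> \<in> fib_perms B \<pi>"
  shows "restrict_id \<rho> A \<in> fib_perms A \<pi>"
proof -
  have "\<rho> y \<in> A" if "y \<in> A" for y
  proof (rule ccontr)
    assume "\<rho> y \<notin> A"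
    moreover have "\<rho> y \<in> B" using assms(2,4) that by (auto simp: fib_perms_in_Y)
    ultimately have "\<pi> (\<rho> y) \<in> \<pi> ` A \<inter> \<pi> ` (B - A)"
      using that fib_perms_fibre[OF assms(4), of y] by (metis DiffI IntI imageI)
    then show False using assms(3) by simp
  qed
  then have "restrict_id \<rho> A permutes A"
    using permutes_inj[OF fib_perms_permutes[OF assms(4)]] finite_subset[OF assms(2,1)]
    by (intro inj_imp_permutes) (auto simp: inj_on_def inj_def)
  then show ?thesis
    using fib_perms_fibre[OF assms(4)] by (auto simp: fib_perms_def restrict_id_def)
qed

text \<open>No fibre meets both \<open>A\<close> and \<open>B\<close>, so a fibre-preserving
  permutation of the union is a unique composition of one of \<open>A\<close> and one of
  \<open>B\<close>, and the sign is multiplicative.\<close>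

lemma sum_fib_perms_Un:
  fixes F :: "'a \<Rightarrow> 'a \<Rightarrow> 'c :: comm_ring_1"
  assumes fin: "finite A" "finite B" and disj: "\<pi> ` A \<inter> \<pi> ` B = {}"
  shows "(\<Sum>\<sigma>\<in>fib_perms (A \<union> B) \<pi>. of_int (sign \<sigma>) * (\<Prod>y\<in>A \<union> B. F y (\<sigma> y)))
    = (\<Sum>\<sigma>\<in>fib_perms A \<pi>. of_int (sign \<sigma>) * (\<Prod>y\<in>A. F y (\<sigma> y))) *
      (\<Sum>\<sigma>\<in>fib_perms B \<pi>. of_int (sign \<sigma>) * (\<Prod>y\<in>B. F y (\<sigma> y)))"
proof -
  have AB: "A \<inter> B = {}" using disj by auto
  then have AB': "y \<notin> B" if "y \<in> A" for y using that by auto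
  have sub: "fib_perms A \<pi> \<subseteq> fib_perms (A \<union> B) \<pi>" "fib_perms B \<pi> \<subseteq> fib_perms (A \<union> B) \<pi>"
    by (simp_all add: fib_perms_mono)
  have comp_A: "(\<sigma> \<circ> \<tau>) y = \<sigma> y" if "\<tau> \<in> fib_perms B \<pi>" "y \<in> A" for \<sigma> \<tau> y
    using AB'[OF that(2)] permutes_not_in[OF fib_perms_permutes[OF that(1)], of y] by simp
  have comp_B: "(\<sigma> \<circ> \<tau>) y = \<tau> y" if "\<sigma> \<in> fib_perms A \<pi>" "\<tau> \<in> fib_perms B \<pi>" "y \<in> B" for \<sigma> \<tau> y
    using that AB'[of "\<tau> y"] fib_perms_in_Y[OF that(2), of y]
      permutes_not_in[OF fib_perms_permutes[OF that(1)], of "\<tau> y"] by auto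
  have bij: "bij_betw (\<lambda>(\<sigma>, \<tau>). \<sigma> \<circ> \<tau>) (fib_perms A \<pi> \<times> fib_perms B \<pi>) (fib_perms (A \<union> B) \<pi>)"
  proof (rule bij_betw_byWitness[where f' = "\<lambda>\<rho>. (restrict_id \<rho> A, restrict_id \<rho> B)"])
    show "\<forall>x\<in>fib_perms A \<pi> \<times> fib_perms B \<pi>. (restrict_id ((\<lambda>(\<sigma>, \<tau>). \<sigma> \<circ> \<tau>) x) A, restrict_id ((\<lambda>(\<sigma>, \<tau>). \<sigma> \<circ> \<tau>) x) B) = x"
    proof clarify
      fix \<sigma> \<tau> assume *: "\<sigma> \<in> fib_perms A \<pi>" "\<tau> \<in> fib_perms B \<pi>"
      have "restrict_id (\<sigma> \<circ> \<tau>) A y = \<sigma> y" for y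
        using comp_A[OF *(2)] permutes_not_in[OF fib_perms_permutes[OF *(1)]] by (cases "y \<in> A") auto
      moreover have "restrict_id (\<sigma> \<circ> \<tau>) B y = \<tau> y" for y
        using comp_B[OF *] permutes_not_in[OF fib_perms_permutes[OF *(2)]] by (cases "y \<in> B") auto
      ultimately show "restrict_id (\<sigma> \<circ> \<tau>) A = \<sigma> \<and> restrict_id (\<sigma> \<circ> \<tau>) B = \<tau>" by auto
    qed
    have r: "restrict_id \<rho> A \<in> fib_perms A \<pi> \<and> restrict_id \<rho> B \<in> fib_perms B \<pi>" if "\<rho> \<in> fib_perms (A \<union> B) \<pi>" for \<rho>
    proof
      show "restrict_id \<rho> A \<in> fib_perms A \<pi>"
        by (rule fib_perms_restrict_id[OF _ _ _ that]) (use fin disj in auto)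
      show "restrict_id \<rho> B \<in> fib_perms B \<pi>"
        by (rule fib_perms_restrict_id[OF _ _ _ that]) (use fin disj in auto)
    qed
    show "\<forall>\<rho>\<in>fib_perms (A \<union> B) \<pi>. (\<lambda>(\<sigma>, \<tau>). \<sigma> \<circ> \<tau>) (restrict_id \<rho> A, restrict_id \<rho> B) = \<rho>"
    proof
      fix \<rho> assume \<rho>: "\<rho> \<in> fib_perms (A \<union> B) \<pi>"
      have "restrict_id \<rho> A (restrict_id \<rho> B y) = \<rho> y" for y
      proof -
        consider "y \<in> A" | "y \<in> B" | "y \<notin> A \<union> B" by auto
        then show ?thesis
        proof cases
          case 1
          then show ?thesis using AB by (auto simp: restrict_id_def)
        next
          case 2
          then have "restrict_id \<rho> B y \<in> B" 
            using fib_perms_in_Y[OF conjunct2[OF r[OF \<rho>]], of y] by (simp only:)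
          then show ?thesis using 2 AB by (auto simp: restrict_id_def)
        next
          case 3
          then show ?thesis
            using permutes_not_in[OF fib_perms_permutes[OF \<rho>]] by (auto simp: restrict_id_def)
        qed
      qed
      then show "(\<lambda>(\<sigma>, \<tau>). \<sigma> \<circ> \<tau>) (restrict_id \<rho> A, restrict_id \<rho> B) = \<rho>" by auto
    qed
    show "(\<lambda>(\<sigma>, \<tau>). \<sigma> \<circ> \<tau>) ` (fib_perms A \<pi> \<times> fib_perms B \<pi>) \<subseteq> fib_perms (A \<union> B) \<pi>"
      using sub by (auto intro!: fib_perms_comp)
    show "(\<lambda>\<rho>. (restrict_id \<rho> A, restrict_id \<rho> B)) ` fib_perms (A \<union> B) \<pi> \<subseteq> fib_perms A \<pi> \<times> fib_perms B \<pi>"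
      using r by auto
  qed
  have "(\<Sum>\<sigma>\<in>fib_perms (A \<union> B) \<pi>. of_int (sign \<sigma>) * (\<Prod>y\<in>A \<union> B. F y (\<sigma> y)))
      = (\<Sum>(\<sigma>, \<tau>)\<in>fib_perms A \<pi> \<times> fib_perms B \<pi>. of_int (sign (\<sigma> \<circ> \<tau>)) * (\<Prod>y\<in>A \<union> B. F y ((\<sigma> \<circ> \<tau>) y)))"
    by (subst sum.reindex_bij_betw[OF bij, symmetric]) (simp add: case_prod_beta)
  also have "\<dots> = (\<Sum>(\<sigma>, \<tau>)\<in>fib_perms A \<pi> \<times> fib_perms B \<pi>. (of_int (sign \<sigma>) * (\<Prod>y\<in>A. F y (\<sigma> y))) *
      (of_int (sign \<tau>) * (\<Prod>y\<in>B. F y (\<tau> y))))"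
  proof (intro sum.cong refl, clarify)
    fix \<sigma> \<tau> assume *: "\<sigma> \<in> fib_perms A \<pi>" "\<tau> \<in> fib_perms B \<pi>"
    have "sign (\<sigma> \<circ> \<tau>) = sign \<sigma> * sign \<tau>"
      using * sub fin by (intro sign_fib_perms_comp[of "A \<union> B" _ \<pi>]) auto
    moreover have "(\<Prod>y\<in>A. F y ((\<sigma> \<circ> \<tau>) y)) = (\<Prod>y\<in>A. F y (\<sigma> y))"
      by (intro prod.cong refl arg_cong[where f = "F _"] comp_A[OF *(2)])
    moreover have "(\<Prod>y\<in>B. F y ((\<sigma> \<circ> \<tau>) y)) = (\<Prod>y\<in>B. F y (\<tau> y))"
      by (intro prod.cong refl arg_cong[where f = "F _"] comp_B[OF *])
    ultimately show "of_int (sign (\<sigma> \<circ> \<tau>)) * (\<Prod>y\<in>A \<union> B. F y ((\<sigma> \<circ> \<tau>) y))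
        = (of_int (sign \<sigma>) * (\<Prod>y\<in>A. F y (\<sigma> y))) * (of_int (sign \<tau>) * (\<Prod>y\<in>B. F y (\<tau> y)))"
      unfolding prod.union_disjoint[OF fin AB] by (simp only: of_int_mult mult_ac)
  qed
  finally show ?thesis
    by (simp add: sum_product sum.cartesian_product)
qed

text \<open>Induction on the set of fibre values, splitting off one fibre at a time.\<close>

lemma prod_sum_fibre_permutes:
  fixes F :: "'a \<Rightarrow> 'a \<Rightarrow> 'c :: comm_ring_1"
  assumes Y: "finite Y" and "finite W"
  shows "(\<Prod>w\<in>W. \<Sum>\<sigma> | \<sigma> permutes fib Y \<pi> w. of_int (sign \<sigma>) * (\<Prod>y\<in>fib Y \<pi> w. F y (\<sigma> y)))
    = (\<Sum>\<sigma>\<in>fib_perms {y \<in> Y. \<pi> y \<in> W} \<pi>. of_int (sign \<sigma>) * (\<Prod>y | y \<in> Y \<and> \<pi> y \<in> W. F y (\<sigma> y)))"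
  using assms(2)
proof (induction W)
  case empty
  have "fib_perms {} \<pi> = {id}" by (auto simp: fib_perms_def)
  then show ?case by simp
next
  case (insert w W)
  have "{y \<in> Y. \<pi> y \<in> insert w W} = fib Y \<pi> w \<union> {y \<in> Y. \<pi> y \<in> W}"
    by (auto simp: fib_def)
  moreover have "fib_perms (fib Y \<pi> w) \<pi> = {\<sigma>. \<sigma> permutes fib Y \<pi> w}"
    by (rule fib_perms_eq_permutes) (auto simp: fib_def)
  moreover have "\<pi> ` fib Y \<pi> w \<inter> \<pi> ` {y \<in> Y. \<pi> y \<in> W} = {}"
    using insert.hyps by (auto simp: fib_def)
  ultimately show ?case
    using insert Y sum_fib_perms_Un[of "fib Y \<pi> w" "{y \<in> Y. \<pi> y \<in> W}" \<pi> F] by (simp add: fib_def)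
qed

lemma cnj_zeta_power: "cnj (zeta e ^ k) = chi e (int k)"
proof -
  have "zeta e = cis (2 * pi / real e)"
    unfolding zeta_def cis_conv_exp by (simp add: mult_ac)
  then have "zeta e ^ k = cis (2 * pi * real k / real e)"
    by (simp add: Complex.DeMoivre mult_ac)
  then show ?thesis
    by (simp add: cis_cnj chi_def)
qed

text \<open>Each factor over the positions of a tuple is transported to the fibre along its
  increasing enumeration; then the fibres are merged. The outer conjugation turns powers of
  \<open>zeta\<close> into \<open>chi\<close>.\<close>

lemma Smat_eq_alt:
  assumes Y: "finite Y" and \<psi>1: "\<psi>1 \<in> Xi e Y \<pi>" and \<psi>2: "\<psi>2 \<in> Xi e Y \<pi>"
  shows "Smat e m Y \<pi> \<psi>1 \<psi>2 = cfac e m (card Y) * (1 / of_real (sqrt (real e))) ^ card Y *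
    eps Y \<psi>1 * eps Y \<psi>2 * alt e Y \<pi> (\<lambda>x. int (\<psi>1 x)) (\<lambda>x. int (\<psi>2 x))"
proof -
  let ?s = "1 / of_real (sqrt (real e)) :: complex"
  define F where "F y y' = ?s * chi e (int (\<psi>1 y) * int (\<psi>2 y'))" for y y'
  define T where "T w = (\<Sum>\<sigma> | \<sigma> permutes {..<card (fib Y \<pi> w)}. of_int (sign \<sigma>) *
         (\<Prod>\<nu> < card (fib Y \<pi> w). ?s * zeta e ^ ((symb Y \<pi> \<psi>1 w ! \<nu>) * (symb Y \<pi> \<psi>2 w ! \<sigma> \<nu>))))" for w
  have fibre: "cnj (T w) = (\<Sum>\<sigma> | \<sigma> permutes fib Y \<pi> w. of_int (sign \<sigma>) * (\<Prod>y\<in>fib Y \<pi> w. F y (\<sigma> y)))"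
    if w: "w \<in> \<pi> ` Y" for w
  proof -
    have fin: "finite (fib Y \<pi> w)" using Y by (auto simp: fib_def)
    let ?l = "sorted_list_of_set (fib Y \<pi> w)"
    have bij: "bij_betw ((!) ?l) {..<card (fib Y \<pi> w)} (fib Y \<pi> w)"
      using fin by (intro bij_betw_nth) auto
    have symb: "symb Y \<pi> \<psi> w = map \<psi> ?l" if "\<psi> \<in> Xi e Y \<pi>" for \<psi>
      using sorted_list_of_set_strict_mono_image[OF fin Xi_strict_mono[OF that]] w by (simp add: symb_def)
    have F: "F (?l ! \<nu>) (?l ! \<sigma> \<nu>)
        = cnj (?s * zeta e ^ ((symb Y \<pi> \<psi>1 w ! \<nu>) * (symb Y \<pi> \<psi>2 w ! \<sigma> \<nu>)))"
      if "\<nu> < card (fib Y \<pi> w)" "\<sigma> permutes {..<card (fib Y \<pi> w)}" for \<nu> \<sigma>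
      using that permutes_in_image[OF that(2), of \<nu>] fin cnj_zeta_power[of e]
      by (simp add: F_def symb \<psi>1 \<psi>2 del: complex_cnj_power)
    show ?thesis
      unfolding T_def sum_permutes_reindex[OF bij finite_lessThan] cnj_sum complex_cnj_mult[of "of_int _"]
        cnj_prod complex_cnj_of_int
      by (intro sum.cong refl arg_cong2[where f = "(*)"] prod.cong F[symmetric]) auto
  qed
  have "{y \<in> Y. \<pi> y \<in> \<pi> ` Y} = Y" by auto
  then have "(\<Prod>w\<in>\<pi> ` Y. \<Sum>\<sigma> | \<sigma> permutes fib Y \<pi> w. of_int (sign \<sigma>) * (\<Prod>y\<in>fib Y \<pi> w. F y (\<sigma> y)))
      = (\<Sum>\<sigma>\<in>fib_perms Y \<pi>. of_int (sign \<sigma>) * (\<Prod>y\<in>Y. F y (\<sigma> y)))"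
    using prod_sum_fibre_permutes[OF Y, where W = "\<pi> ` Y" and \<pi> = \<pi> and F = F] Y by simp
  also have "\<dots> = ?s ^ card Y * alt e Y \<pi> (\<lambda>x. int (\<psi>2 x)) (\<lambda>x. int (\<psi>1 x))"
    unfolding alt_def F_def prod.distrib prod_constant sum_distrib_left
    by (intro sum.cong refl) (simp add: mult_ac)
  \<comment> \<open>In \<open>Smat\<close> the permutation acts on the second index, in
    \<open>alt\<close> on the first argument.\<close>
  also have "alt e Y \<pi> (\<lambda>x. int (\<psi>2 x)) (\<lambda>x. int (\<psi>1 x)) = alt e Y \<pi> (\<lambda>x. int (\<psi>1 x)) (\<lambda>x. int (\<psi>2 x))"
    by (rule alt_commute[OF Y])
  finally have prod: "(\<Prod>w\<in>\<pi> ` Y. cnj (T w)) = ?s ^ card Y * alt e Y \<pi> (\<lambda>x. int (\<psi>1 x)) (\<lambda>x. int (\<psi>2 x))"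
    by (simp add: fibre)
  have "Smat e m Y \<pi> \<psi>1 \<psi>2
      = cnj (cnj (cfac e m (card Y)) * eps Y \<psi>1 * eps Y \<psi>2 * (\<Prod>w\<in>\<pi> ` Y. T w))"
    unfolding Smat_def T_def ..
  also have "\<dots> = cfac e m (card Y) * eps Y \<psi>1 * eps Y \<psi>2 * (\<Prod>w\<in>\<pi> ` Y. cnj (T w))"
    by (simp add: eps_def)
  finally show ?thesis
    unfolding prod by (simp only: mult_ac)
qed

section \<open>Signs of involutions\<close>

text \<open>An involution is a product of disjoint transpositions, one for every two moved
  points.\<close>

lemma sign_involution:
  assumes "finite Y" "\<tau> permutes Y" "\<And>x. \<tau> (\<tau> x) = x"
  shows "even (card {x. \<tau> x \<noteq> x})" "sign \<tau> = (- 1) ^ (card {x. \<tau> x \<noteq> x} div 2)"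
proof -
  have "even (card {x. \<tau> x \<noteq> x}) \<and> sign \<tau> = (- 1) ^ (card {x. \<tau> x \<noteq> x} div 2)"
    using assms(2,3)
  proof (induction "card {x. \<tau> x \<noteq> x}" arbitrary: \<tau> rule: less_induct)
    case less
    have fin: "finite {x. \<tau> x \<noteq> x}"
      using permutes_not_in[OF less.prems(1)] by (intro finite_subset[OF _ assms(1)]) auto
    show ?case
    proof (cases "\<exists>x. \<tau> x \<noteq> x")
      case False
      then have "\<tau> = id" by auto
      then show ?thesis by simp
    next
      case True
      then obtain x where x: "\<tau> x \<noteq> x" by blast
      let ?t = "Transposition.transpose x (\<tau> x)"
      \<comment> \<open>Removing one transposition leaves an involution with two moved points
        fewer.\<close>
      define \<tau>' where "\<tau>' = ?t \<circ> \<tau>"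
      have \<tau>': "\<tau>' y = (if y = x \<or> y = \<tau> x then y else \<tau> y)" for y
        using less.prems(2) by (auto simp: \<tau>'_def Transposition.transpose_def) metis+
      have xY: "x \<in> Y" "\<tau> x \<in> Y"
        using x permutes_not_in[OF less.prems(1)] permutes_in_image[OF less.prems(1)] by auto
      then have t: "?t permutes Y" by (intro permutes_swap_id)
      have perm: "\<tau>' permutes Y"
        unfolding \<tau>'_def by (rule permutes_compose[OF less.prems(1) t])
      have inv: "\<tau>' (\<tau>' y) = y" for y
        using less.prems(2) by (auto simp: \<tau>') metis+
      have supp: "{y. \<tau> y \<noteq> y} = insert x (insert (\<tau> x) {y. \<tau>' y \<noteq> y})"
        using x less.prems(2) by (auto simp: \<tau>') 
      have card: "card {y. \<tau> y \<noteq> y} = Suc (Suc (card {y. \<tau>' y \<noteq> y}))"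
        using fin x unfolding supp by (simp add: \<tau>')
      have IH: "even (card {y. \<tau>' y \<noteq> y}) \<and> sign \<tau>' = (- 1) ^ (card {y. \<tau>' y \<noteq> y} div 2)"
        by (rule less.hyps[OF _ perm inv]) (simp add: card)
      have "\<tau> = ?t \<circ> \<tau>'"
        by (simp add: \<tau>'_def fun_eq_iff)
      then have "sign \<tau> = sign ?t * sign \<tau>'"
        using sign_compose[OF permutes_imp_permutation[OF assms(1) t] permutes_imp_permutation[OF assms(1) perm]]
        by simp
      also have "\<dots> = - sign \<tau>'"
        using x by (simp add: sign_swap_id)
      finally show ?thesis
        using IH card by simp
    qed
  qed
  then show "even (card {x. \<tau> x \<noteq> x})" "sign \<tau> = (- 1) ^ (card {x. \<tau> x \<noteq> x} div 2)"
    by blast+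
qed

section \<open>The lattice spanned by the alternants\<close>

locale fourier_data =
  fixes e m :: nat and Y :: "'a::linorder set" and \<pi> :: "'a \<Rightarrow> nat"
  assumes e: "e \<ge> 1" and Y: "finite Y" and cY: "card Y = e * m + 1"
    and fib_le: "card (fib Y \<pi> w) \<le> e"
begin

abbreviation I where "I \<equiv> E' e m Y \<pi>"
abbreviation S where "S \<equiv> Smat e m Y \<pi>"
abbreviation J :: "('a \<Rightarrow> nat) \<Rightarrow> 'a \<Rightarrow> int" where "J \<psi> \<equiv> \<lambda>x. int (\<psi> x)"
abbreviation D :: "('a \<Rightarrow> nat) \<Rightarrow> ('a \<Rightarrow> int) \<Rightarrow> complex" where "D \<psi> \<equiv> alt e Y \<pi> (J \<psi>)"
abbreviation t :: int where "t \<equiv> int (m * (e choose 2))"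

lemma I_Xi: "\<psi> \<in> I \<Longrightarrow> \<psi> \<in> Xi e Y \<pi>"
  and I_sum: "\<psi> \<in> I \<Longrightarrow> [(\<Sum>y\<in>Y. J \<psi> y) = t] (mod int e)"
  by (simp_all only: E'_iff[OF Y])

lemma finite_I: "finite I"
  by (rule finite_E'[OF Y])

lemma D_commute: "D \<psi> (J j) = D j (J \<psi>)"
  by (rule alt_commute[OF Y])

lemma D_orthogonality:
  assumes "j \<in> I" "k \<in> I"
  shows "of_nat e * (\<Sum>\<psi>\<in>I. D \<psi> (J j) * cnj (D \<psi> (J k))) = (if j = k then of_nat (e ^ card Y) else 0)"
  using alt_orthogonality_E'[OF e Y cY assms] unfolding D_commute[of _ j] D_commute[of _ k] .

lemma D_nonzero:
  assumes "j \<in> I"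
  shows "\<exists>\<psi>\<in>I. D \<psi> (J j) \<noteq> 0"
proof (rule ccontr)
  assume "\<not> ?thesis"
  then have "(\<Sum>\<psi>\<in>I. D \<psi> (J j) * cnj (D \<psi> (J j))) = 0" by simp
  then show False using D_orthogonality[OF assms assms] e by simp
qed

text \<open>Columns indexed by \<open>I\<close> are non-zero, and distinct ones are
  orthogonal.\<close>

lemma D_proportional:
  assumes "j \<in> I" "k \<in> I" and eq: "\<And>\<psi>. \<psi> \<in> I \<Longrightarrow> D \<psi> (J k) = c * D \<psi> (J j)"
  shows "k = j" "c = 1"
proof -
  have *: "of_nat e * (\<Sum>\<psi>\<in>I. D \<psi> (J k) * cnj (D \<psi> (J j)))
      = c * (of_nat e * (\<Sum>\<psi>\<in>I. D \<psi> (J j) * cnj (D \<psi> (J j))))"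
    by (simp add: eq sum_distrib_left mult_ac)
  show kj: "k = j"
  proof (rule ccontr)
    assume "k \<noteq> j"
    then have "c = 0" using * D_orthogonality assms(1,2) e by auto
    then have "\<forall>\<psi>\<in>I. D \<psi> (J k) = 0" using eq by simp
    then show False using D_nonzero[OF assms(2)] by blast
  qed
  show "c = 1" using * D_orthogonality assms(1,2) e kj by auto
qed

lemma reduce_exact:
  assumes "fib_inj e Y \<pi> g" "[(\<Sum>y\<in>Y. g y) = t] (mod int e)"
  obtains j \<tau> where "j \<in> I" "\<tau> \<in> fib_perms Y \<pi>" "\<And>y. y \<in> Y \<Longrightarrow> [g y = J j (\<tau> y)] (mod int e)"
proof -
  obtain j \<tau> where *: "j \<in> Xi e Y \<pi>" "\<tau> \<in> fib_perms Y \<pi>" "\<And>y. y \<in> Y \<Longrightarrow> [g y = J j (\<tau> y)] (mod int e)"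
    using Xi_sort[OF e Y assms(1)] by blast
  have "[(\<Sum>y\<in>Y. g y) = (\<Sum>y\<in>Y. J j (\<tau> y))] (mod int e)"
    by (rule cong_sum) (rule *(3))
  also have "(\<Sum>y\<in>Y. J j (\<tau> y)) = (\<Sum>y\<in>Y. J j y)"
    by (rule sum.reindex_bij_betw[OF fib_perms_bij[OF *(2)]])
  finally have "j \<in> I"
    using assms(2) *(1) unfolding E'_iff[OF Y] by (blast intro: cong_trans cong_sym)
  with * that show thesis by blast
qed

lemma alt_match:
  assumes "\<tau> \<in> fib_perms Y \<pi>" "\<And>y. y \<in> Y \<Longrightarrow> [g y = h (\<tau> y)] (mod int e)"
  shows "D \<psi> g = of_int (sign \<tau>) * D \<psi> h"
  using alt_cong[OF e, of Y g "h \<circ> \<tau>" \<pi> "J \<psi>"] assms(2) alt_comp[OF Y assms(1)] by simp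

lemma sign_eq_1_or_minus_1: "sign \<tau> \<in> {1, -1 :: int}"
  by (cases \<tau> rule: sign_cases) auto

text \<open>Since \<open>card Y\<close> is 1 modulo \<open>e\<close>, adding \<open>k\<close> to
  every entry changes the sum of entries by \<open>k\<close> modulo \<open>e\<close>; this brings
  \<open>g\<close> into the class defining \<open>E'\<close>. On \<open>I\<close> the alternant
  changes by the factor \<open>chi e (t * k)\<close>, which is a sign.\<close>

lemma reduce:
  assumes "\<exists>\<psi>\<in>I. D \<psi> g \<noteq> 0"
  obtains j s where "j \<in> I" "s \<in> {1, -1 :: int}" "\<And>\<psi>. \<psi> \<in> I \<Longrightarrow> D \<psi> g = of_int s * D \<psi> (J j)"
proof -
  define k where "k = t - (\<Sum>y\<in>Y. g y)"
  define g' where "g' = (\<lambda>y. g y + k)"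
  have "(\<Sum>y\<in>Y. g' y) = (\<Sum>y\<in>Y. g y) + (int e * int m + 1) * k"
    by (simp add: g'_def sum.distrib cY)
  also have "\<dots> = t + int e * (int m * k)"
    by (simp add: k_def algebra_simps)
  finally have "(\<Sum>y\<in>Y. g' y) = t + int e * (int m * k)" .
  then have sum_g': "[(\<Sum>y\<in>Y. g' y) = t] (mod int e)"
    by (simp add: cong_def)
  \<comment> \<open>Twice \<open>t\<close> is a multiple of \<open>e\<close>, so the factor squares
    to 1.\<close>
  have "even (e * (e - 1))" by (cases e) auto
  then have "2 * (e choose 2) = e * (e - 1)"
    by (simp add: choose_two)
  then have "2 * t = int e * int (m * (e - 1))"
    by (metis mult.left_commute of_nat_mult of_nat_numeral)
  then have "int 2 * (t * k) = int e * (int (m * (e - 1)) * k)"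
    by (simp only: mult.assoc[symmetric] of_nat_numeral)
  then have "chi e (int 2 * (t * k)) = 1"
    by (simp only: chi_eq_1_iff[OF e] dvd_triv_left)
  then have "chi e (t * k) ^ 2 = 1"
    by (simp only: chi_mult_nat)
  then obtain u where u: "u \<in> {1, -1 :: int}" "chi e (t * k) = of_int u"
    unfolding power2_eq_1_iff by (elim disjE) (auto intro: that[of 1] that[of "-1"])
  have g': "D \<psi> g' = of_int u * D \<psi> g" if "\<psi> \<in> I" for \<psi>
  proof -
    have "D \<psi> g' = chi e ((\<Sum>y\<in>Y. J \<psi> y) * k) * D \<psi> g"
      unfolding g'_def using alt_shift[OF Y, of e \<pi> "J \<psi>" g "\<lambda>_. k"] by (simp add: sum_distrib_right)
    also have "chi e ((\<Sum>y\<in>Y. J \<psi> y) * k) = chi e (t * k)"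
      by (intro chi_cong[OF e] cong_mult I_sum that cong_refl)
    finally show ?thesis by (simp only: u)
  qed
  \<comment> \<open>A repeated residue would make the alternant vanish on all of
    \<open>I\<close>.\<close>
  have "fib_inj e Y \<pi> g'"
    unfolding fib_inj_def
  proof (intro ballI impI, rule ccontr)
    fix y y' assume *: "y \<in> Y" "y' \<in> Y" "\<pi> y = \<pi> y' \<and> [g' y = g' y'] (mod int e)" "y \<noteq> y'"
    then have "D \<psi> g' = 0" for \<psi>
      using alt_eq_0[OF e Y, of y y' \<pi> g'] by blast
    then show False using g' u assms by auto
  qed
  from reduce_exact[OF this sum_g'] obtain j \<tau>
    where j: "j \<in> I" "\<tau> \<in> fib_perms Y \<pi>" "\<And>y. y \<in> Y \<Longrightarrow> [g' y = J j (\<tau> y)] (mod int e)" by blast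
  have match: "D \<psi> g' = of_int (sign \<tau>) * D \<psi> (J j)" for \<psi>
    by (intro alt_match j)
  have "D \<psi> g = of_int (u * sign \<tau>) * D \<psi> (J j)" if "\<psi> \<in> I" for \<psi>
    using g'[OF that] match[of \<psi>] u(1) by auto
  moreover have "u * sign \<tau> \<in> {1, -1}"
    using u sign_eq_1_or_minus_1[of \<tau>] by auto
  ultimately show thesis using that j by blast
qed

section \<open>The lattice of alternants and its multipliers\<close>

definition L :: "(('a \<Rightarrow> nat) \<Rightarrow> complex) set" where
  "L = {l. \<exists>c :: ('a \<Rightarrow> nat) \<Rightarrow> int. \<forall>\<psi>\<in>I. l \<psi> = (\<Sum>j\<in>I. of_int (c j) * D \<psi> (J j))}"

text \<open>The multipliers of \<open>L\<close>: closed under products by construction, whereas no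
  such closure is claimed for \<open>L\<close> itself.\<close>

definition M :: "(('a \<Rightarrow> nat) \<Rightarrow> complex) set" where
  "M = {q. \<forall>l\<in>L. (\<lambda>\<psi>. q \<psi> * l \<psi>) \<in> L}"

lemma L_cong: "(\<And>\<psi>. \<psi> \<in> I \<Longrightarrow> l \<psi> = l' \<psi>) \<Longrightarrow> l \<in> L \<Longrightarrow> l' \<in> L"
  unfolding L_def by fastforce

lemma L_zero: "(\<lambda>_. 0) \<in> L"
  unfolding L_def by (auto intro: exI[of _ "\<lambda>_. 0"])

lemma L_add:
  assumes "l \<in> L" "l' \<in> L"
  shows "(\<lambda>\<psi>. l \<psi> + l' \<psi>) \<in> L"
proof -
  obtain c c' :: "('a \<Rightarrow> nat) \<Rightarrow> int" where "\<forall>\<psi>\<in>I. l \<psi> = (\<Sum>j\<in>I. of_int (c j) * D \<psi> (J j))"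
    "\<forall>\<psi>\<in>I. l' \<psi> = (\<Sum>j\<in>I. of_int (c' j) * D \<psi> (J j))"
    using assms unfolding L_def by blast
  then show ?thesis
    unfolding L_def by (auto intro!: exI[of _ "\<lambda>j. c j + c' j"] simp: sum.distrib ring_distribs)
qed

lemma L_scale:
  assumes "l \<in> L"
  shows "(\<lambda>\<psi>. of_int z * l \<psi>) \<in> L"
proof -
  obtain c :: "('a \<Rightarrow> nat) \<Rightarrow> int" where "\<forall>\<psi>\<in>I. l \<psi> = (\<Sum>j\<in>I. of_int (c j) * D \<psi> (J j))"
    using assms unfolding L_def by blast
  then show ?thesis
    unfolding L_def by (auto intro!: exI[of _ "\<lambda>j. z * c j"] simp: sum_distrib_left mult_ac)
qed

lemma L_sum: "(\<And>i. i \<in> A \<Longrightarrow> l i \<in> L) \<Longrightarrow> (\<lambda>\<psi>. \<Sum>i\<in>A. l i \<psi>) \<in> L"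
  by (induction A rule: infinite_finite_induct) (auto intro: L_zero L_add)

text \<open>An alternant with arbitrary integer entries either vanishes on \<open>I\<close> or is,
  up to sign, a column indexed by \<open>I\<close>.\<close>

lemma L_D: "(\<lambda>\<psi>. D \<psi> g) \<in> L"
proof (cases "\<exists>\<psi>\<in>I. D \<psi> g \<noteq> 0")
  case True
  from reduce[OF this] obtain j s
    where *: "j \<in> I" "\<And>\<psi>. \<psi> \<in> I \<Longrightarrow> D \<psi> g = of_int s * D \<psi> (J j)" by blast
  have "(\<Sum>k\<in>I. of_int (if k = j then s else 0) * D \<psi> (J k)) = of_int s * D \<psi> (J j)" for \<psi>
  proof -
    have "(\<Sum>k\<in>I. of_int (if k = j then s else 0) * D \<psi> (J k)) = (\<Sum>k\<in>I. if k = j then of_int s * D \<psi> (J k) else 0)"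
      by (intro sum.cong) auto
    then show ?thesis using *(1) finite_I by (simp add: sum.delta)
  qed
  then show ?thesis
    unfolding L_def using * by (intro CollectI exI[of _ "\<lambda>k. if k = j then s else 0"]) simp
next
  case False
  then show ?thesis by (intro L_cong[OF _ L_zero]) auto
qed

lemma M_cong: "(\<And>\<psi>. \<psi> \<in> I \<Longrightarrow> q \<psi> = q' \<psi>) \<Longrightarrow> q \<in> M \<Longrightarrow> q' \<in> M"
  unfolding M_def by (auto intro: L_cong[of "\<lambda>\<psi>. q \<psi> * _ \<psi>"])

lemma M_L: "q \<in> M \<Longrightarrow> l \<in> L \<Longrightarrow> (\<lambda>\<psi>. q \<psi> * l \<psi>) \<in> L"
  unfolding M_def by (drule CollectD, drule (1) bspec)

lemma M_add: "q \<in> M \<Longrightarrow> q' \<in> M \<Longrightarrow> (\<lambda>\<psi>. q \<psi> + q' \<psi>) \<in> M"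
  unfolding M_def by (auto simp: ring_distribs intro: L_add)

lemma M_mult: "q \<in> M \<Longrightarrow> q' \<in> M \<Longrightarrow> (\<lambda>\<psi>. q \<psi> * q' \<psi>) \<in> M"
  unfolding M_def by (auto simp: mult.assoc)

lemma M_of_int: "(\<lambda>_. of_int z) \<in> M"
  unfolding M_def by (auto intro: L_scale)

lemma M_scale: "q \<in> M \<Longrightarrow> (\<lambda>\<psi>. of_int z * q \<psi>) \<in> M"
  by (rule M_mult[OF M_of_int])

lemma M_sum: "(\<And>i. i \<in> A \<Longrightarrow> q i \<in> M) \<Longrightarrow> (\<lambda>\<psi>. \<Sum>i\<in>A. q i \<psi>) \<in> M"
  using M_of_int[of 0] by (induction A rule: infinite_finite_induct) (auto intro: M_add)

text \<open>Pieri's rule writes the product with a generator of \<open>L\<close> as a sum of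
  alternants, all of which lie in \<open>L\<close>.\<close>

lemma M_esym: "(\<lambda>\<psi>. esym e (fib Y \<pi> w) r (J \<psi>)) \<in> M"
  unfolding M_def
proof (intro CollectI ballI)
  fix l assume "l \<in> L"
  then obtain c :: "('a \<Rightarrow> nat) \<Rightarrow> int" where c: "\<And>\<psi>. \<psi> \<in> I \<Longrightarrow> l \<psi> = (\<Sum>j\<in>I. of_int (c j) * D \<psi> (J j))"
    unfolding L_def by blast
  have "(\<lambda>\<psi>. \<Sum>j\<in>I. of_int (c j) * (esym e (fib Y \<pi> w) r (J \<psi>) * D \<psi> (J j))) \<in> L"
    unfolding esym_mult_alt[OF Y] by (intro L_sum L_scale L_D)
  then show "(\<lambda>\<psi>. esym e (fib Y \<pi> w) r (J \<psi>) * l \<psi>) \<in> L"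
    by (rule L_cong[rotated]) (simp add: c sum_distrib_left mult.left_commute)
qed

section \<open>Reduction to the window of the unit column\<close>

text \<open>The factorisation is asked for all maps \<psi>, while membership of \<open>q\<close> in
  \<open>M\<close> depends on the values on \<open>I\<close> alone.\<close>

definition multiple_of :: "('a \<Rightarrow> nat) \<Rightarrow> ('a \<Rightarrow> int) \<Rightarrow> bool" where
  "multiple_of \<xi>0 g \<longleftrightarrow> (\<exists>q\<in>M. \<forall>\<psi>. D \<psi> g = q \<psi> * D \<psi> (J \<xi>0))"

lemma multiple_ofI: "q \<in> M \<Longrightarrow> (\<And>\<psi>. D \<psi> g = q \<psi> * D \<psi> (J \<xi>0)) \<Longrightarrow> multiple_of \<xi>0 g"
  unfolding multiple_of_def by (rule bexI[of _ q]) blast+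

text \<open>The recurrence, solved for its leading term, expresses the alternant with entry
  \<open>b + i\<close> at \<open>y\<close> by those with the \<open>n\<close> preceding entries; its
  coefficients are multipliers, so \<open>n\<close> consecutive entries suffice as a start.\<close>

lemma multiple_of_step:
  assumes y: "y \<in> Y" and base: "\<And>k. b \<le> k \<Longrightarrow> k < b + int (card (fib Y \<pi> (\<pi> y))) \<Longrightarrow> multiple_of \<xi>0 (g(y := k))"
  shows "multiple_of \<xi>0 (g(y := b + int i))"
proof (induction i rule: less_induct)
  case (less i)
  let ?A = "fib Y \<pi> (\<pi> y)"
  define n where "n = card ?A"
  show ?case
  proof (cases "i < n")
    case True
    then show ?thesis by (intro base) (auto simp: n_def)
  next
    case False
    have "multiple_of \<xi>0 (g(y := b + int i - int r))" if "r \<in> {1..n}" for r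
    proof -
      have "b + int i - int r = b + int (i - r)" "i - r < i"
        using that False by auto
      then show ?thesis using less[of "i - r"] by (simp only:)
    qed
    then obtain q where q: "\<And>r. r \<in> {1..n} \<Longrightarrow> q r \<in> M"
      "\<And>r \<psi>. r \<in> {1..n} \<Longrightarrow> D \<psi> (g(y := b + int i - int r)) = q r \<psi> * D \<psi> (J \<xi>0)"
      unfolding multiple_of_def by metis
    have "D \<psi> (g(y := b + int i)) = (\<Sum>r\<in>{1..n}. of_int (- ((-1) ^ r)) * (esym e ?A r (J \<psi>) * q r \<psi>)) * D \<psi> (J \<xi>0)"
      for \<psi>
    proof -
      \<comment> \<open>The leading coefficient is 1, so no division occurs.\<close>
      have "esym e ?A 0 (J \<psi>) = 1"
      proof -
        have "{T. T \<subseteq> ?A \<and> card T = 0} = {{}}"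
          using Y by (auto simp: fib_def dest: finite_subset)
        then show ?thesis by (simp add: esym_def)
      qed
      moreover have "{..n} = insert 0 {1..n}" by auto
      ultimately have "D \<psi> (g(y := b + int i)) +
          (\<Sum>r\<in>{1..n}. (-1) ^ r * esym e ?A r (J \<psi>) * D \<psi> (g(y := b + int i - int r))) = 0"
        using alt_recurrence[OF Y y, where \<pi> = \<pi> and e = e and f = "J \<psi>" and g = g and k = "b + int i"] by (simp add: n_def)
      then have "D \<psi> (g(y := b + int i)) = - (\<Sum>r\<in>{1..n}. (-1) ^ r * esym e ?A r (J \<psi>) * D \<psi> (g(y := b + int i - int r)))"
        by (simp add: eq_neg_iff_add_eq_0)
      also have "\<dots> = (\<Sum>r\<in>{1..n}. of_int (- ((-1) ^ r)) * (esym e ?A r (J \<psi>) * q r \<psi>)) * D \<psi> (J \<xi>0)"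
        unfolding sum_distrib_right sum_negf[symmetric] by (intro sum.cong refl) (simp add: q)
      finally show ?thesis .
    qed
    moreover have "(\<lambda>\<psi>. \<Sum>r\<in>{1..n}. of_int (- ((-1) ^ r)) * (esym e ?A r (J \<psi>) * q r \<psi>)) \<in> M"
      by (intro M_sum M_scale M_mult M_esym q)
    ultimately show ?thesis
      by (intro multiple_ofI)
  qed
qed

text \<open>The feature of \<xi>0 that the argument works with: in every fibre its entries hit all
  residues \<open>a, ..., a + n - 1\<close>.\<close>

definition window :: "(nat \<Rightarrow> int) \<Rightarrow> ('a \<Rightarrow> nat) \<Rightarrow> bool" where
  "window a \<xi>0 \<longleftrightarrow> (\<forall>y\<in>Y. \<forall>k<card (fib Y \<pi> (\<pi> y)).
     \<exists>y'\<in>Y. \<pi> y' = \<pi> y \<and> [J \<xi>0 y' = a (\<pi> y) + int k] (mod int e))"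

lemma windowD:
  assumes "window a \<xi>0" "y \<in> Y" "a (\<pi> y) \<le> k" "k < a (\<pi> y) + int (card (fib Y \<pi> (\<pi> y)))"
  shows "\<exists>y'\<in>Y. \<pi> y' = \<pi> y \<and> [k = J \<xi>0 y'] (mod int e)"
proof -
  have "nat (k - a (\<pi> y)) < card (fib Y \<pi> (\<pi> y))"
    using assms(3,4) by linarith
  then obtain y' where "y' \<in> Y" "\<pi> y' = \<pi> y" "[J \<xi>0 y' = a (\<pi> y) + int (nat (k - a (\<pi> y)))] (mod int e)"
    using assms(1,2) unfolding window_def by blast
  then show ?thesis
    using assms(3) by (auto intro: cong_sym)
qed

text \<open>With all entries in the windows, either a residue is repeated in a fibre and the
  multiplier is 0, or \<open>g\<close> rearranges \<xi>0 and the multiplier is a sign.\<close>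

lemma multiple_of_window:
  assumes \<xi>0: "window a \<xi>0"
    and g: "\<And>y. y \<in> Y \<Longrightarrow> a (\<pi> y) \<le> g y \<and> g y < a (\<pi> y) + int (card (fib Y \<pi> (\<pi> y)))"
  shows "multiple_of \<xi>0 g"
proof (cases "fib_inj e Y \<pi> g")
  case True
  have "\<exists>y'\<in>Y. \<pi> y' = \<pi> y \<and> [g y = J \<xi>0 y'] (mod int e)" if "y \<in> Y" for y
    using windowD[OF \<xi>0 that] g[OF that] by blast
  from match_residues[OF Y True this] obtain \<tau>
    where \<tau>: "\<tau> \<in> fib_perms Y \<pi>" "\<And>y. y \<in> Y \<Longrightarrow> [g y = J \<xi>0 (\<tau> y)] (mod int e)"
    by blast
  show ?thesis
    by (intro multiple_ofI[OF M_of_int[of "sign \<tau>"]] alt_match \<tau>)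
next
  case False
  then obtain y y' where "y \<in> Y" "y' \<in> Y" "\<pi> y = \<pi> y'" "y \<noteq> y'" "[g y = g y'] (mod int e)"
    by (auto simp: fib_inj_def)
  then show ?thesis
    using alt_eq_0[OF e Y] by (intro multiple_ofI[OF M_of_int[of 0]]) simp
qed

text \<open>Induction on the set \<open>T\<close> of points whose entries are bounded only from
  below: \<open>multiple_of_step\<close> lets these entries rise above their windows one point at a
  time.\<close>

lemma multiple_of_all:
  assumes \<xi>0: "window a \<xi>0"
  shows "multiple_of \<xi>0 g"
proof -
  have *: "multiple_of \<xi>0 g" if "finite T" "T \<subseteq> Y" "\<And>y. y \<in> T \<Longrightarrow> a (\<pi> y) \<le> g y"
    "\<And>y. y \<in> Y - T \<Longrightarrow> a (\<pi> y) \<le> g y \<and> g y < a (\<pi> y) + int (card (fib Y \<pi> (\<pi> y)))" for T g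
    using that
  proof (induction T arbitrary: g)
    case empty
    then show ?case by (intro multiple_of_window[OF \<xi>0]) auto
  next
    case (insert y T)
    have "multiple_of \<xi>0 (g(y := a (\<pi> y) + int (nat (g y - a (\<pi> y)))))"
    proof (rule multiple_of_step)
      show "multiple_of \<xi>0 (g(y := k))" if "a (\<pi> y) \<le> k" "k < a (\<pi> y) + int (card (fib Y \<pi> (\<pi> y)))" for k
        using insert.prems insert.hyps that by (intro insert.IH) auto
    qed (use insert.prems in auto)
    moreover have "a (\<pi> y) + int (nat (g y - a (\<pi> y))) = g y"
      using insert.prems by simp
    ultimately show ?case by simp
  qed
  \<comment> \<open>Modulo \<open>e\<close> every entry has a representative not below the start of
    its window.\<close>
  define g' where "g' y = a (\<pi> y) + (g y - a (\<pi> y)) mod int e" for y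
  have "multiple_of \<xi>0 g'"
    using e by (intro *[of Y]) (auto simp: Y g'_def)
  moreover have "[g y = g' y] (mod int e)" for y
    unfolding g'_def by (simp add: cong_def mod_add_right_eq)
  then have "D \<psi> g = D \<psi> g'" for \<psi>
    by (intro alt_cong[OF e])
  ultimately show ?thesis
    by (simp add: multiple_of_def)
qed

text \<open>A zero of column \<xi>0 at \<psi> would be a zero of all alternants at \<psi>, and by
  symmetry the column of \<psi> would vanish on \<open>I\<close>.\<close>

lemma window_nonzero:
  assumes "window a \<xi>0" "\<psi> \<in> I"
  shows "D \<psi> (J \<xi>0) \<noteq> 0"
proof
  assume "D \<psi> (J \<xi>0) = 0"
  then have "D \<psi> g = 0" for g
    using multiple_of_all[OF assms(1), of g] by (auto simp: multiple_of_def)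
  moreover obtain j where "D j (J \<psi>) \<noteq> 0"
    using D_nonzero[OF assms(2)] by blast
  ultimately show False
    by (simp add: D_commute[of \<psi> j, symmetric])
qed

lemma M_quotient:
  assumes "window a \<xi>0"
  shows "(\<lambda>\<psi>. D \<psi> g / D \<psi> (J \<xi>0)) \<in> M"
proof -
  obtain q where q: "q \<in> M" "\<And>\<psi>. D \<psi> g = q \<psi> * D \<psi> (J \<xi>0)"
    using multiple_of_all[OF assms, of g] unfolding multiple_of_def by blast
  show ?thesis
  proof (rule M_cong[OF _ q(1)])
    show "q \<psi> = D \<psi> g / D \<psi> (J \<xi>0)" if "\<psi> \<in> I" for \<psi>
      unfolding q(2)[of \<psi>] using window_nonzero[OF assms that] by (rule nonzero_mult_div_cancel_right[symmetric])
  qed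
qed

section \<open>From alternants back to the Fourier matrix\<close>

definition K :: complex where
  "K = cfac e m (card Y) * (1 / of_real (sqrt (real e))) ^ card Y"

lemma K_norm: "K * cnj K = of_nat e / of_nat (e ^ card Y)"
proof -
  \<comment> \<open>The exponent \<open>d - em\<close> of the square root of \<open>e\<close> equals
    1.\<close>
  have "norm (cfac e m (card Y)) = sqrt (real e)"
    unfolding cfac_def using cY by (simp add: norm_mult norm_power norm_power_int)
  moreover have "norm ((1 / complex_of_real (sqrt (real e))) ^ card Y) = (1 / sqrt (real e)) ^ card Y"
    by (simp add: norm_power norm_divide)
  moreover have "((1 / sqrt (real e)) ^ card Y) ^ 2 = (1 / real e) ^ card Y"
    by (simp only: power_mult[symmetric] mult.commute[of "card Y"]) (simp add: power_mult power_divide)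
  ultimately have "norm K ^ 2 = real e * (1 / real e) ^ card Y"
    by (simp add: K_def norm_mult power_mult_distrib)
  also have "\<dots> = real e / real e ^ card Y"
    by (simp add: power_divide)
  finally show ?thesis
    unfolding complex_norm_square[symmetric] by simp
qed

lemma K_nonzero: "K \<noteq> 0"
  using K_norm e by auto

text \<open>The integer counterpart of \<open>eps\<close>, so that these signs can enter integer
  coefficients.\<close>

definition pair_sign :: "('a \<Rightarrow> nat) \<Rightarrow> int" where
  "pair_sign \<psi> = (- 1) ^ card {(y, y'). y \<in> Y \<and> y' \<in> Y \<and> y < y' \<and> \<psi> y < \<psi> y'}"

lemma pair_sign_cases: "pair_sign \<psi> \<in> {1, -1}"
  unfolding pair_sign_def by (simp add: minus_one_power_iff)

lemma pair_sign_mult_self [simp]: "pair_sign \<psi> * pair_sign \<psi> = 1"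
  using pair_sign_cases[of \<psi>] by auto

lemma S_eq:
  assumes "\<psi> \<in> I" "j \<in> I"
  shows "S \<psi> j = K * of_int (pair_sign \<psi>) * of_int (pair_sign j) * D \<psi> (J j)"
  using Smat_eq_alt[OF Y I_Xi[OF assms(1)] I_Xi[OF assms(2)], of m]
  by (simp add: K_def eps_def pair_sign_def)

lemma S_symmetric: "\<psi> \<in> I \<Longrightarrow> j \<in> I \<Longrightarrow> S \<psi> j = S j \<psi>"
  by (simp add: S_eq D_commute[of j])

lemma S_col_orth:
  assumes "j \<in> I" "k \<in> I"
  shows "(\<Sum>\<psi>\<in>I. S \<psi> j * cnj (S \<psi> k)) = (if j = k then 1 else 0)"
proof -
  have "S \<psi> j * cnj (S \<psi> k) = K * cnj K * of_int (pair_sign j * pair_sign k) * (D \<psi> (J j) * cnj (D \<psi> (J k)))"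
    if "\<psi> \<in> I" for \<psi>
    using pair_sign_cases[of \<psi>] by (auto simp: S_eq that assms)
  then have "(\<Sum>\<psi>\<in>I. S \<psi> j * cnj (S \<psi> k))
      = K * cnj K * of_int (pair_sign j * pair_sign k) * (\<Sum>\<psi>\<in>I. D \<psi> (J j) * cnj (D \<psi> (J k)))"
    by (simp add: sum_distrib_left)
  also have "\<dots> = of_int (pair_sign j * pair_sign k) / of_nat (e ^ card Y) *
      (of_nat e * (\<Sum>\<psi>\<in>I. D \<psi> (J j) * cnj (D \<psi> (J k))))"
    by (simp add: K_norm)
  also have "\<dots> = (if j = k then 1 else 0)"
    unfolding D_orthogonality[OF assms] using e by (auto simp del: of_int_mult)
  finally show ?thesis .
qed

lemma S_row_orth:
  assumes "j \<in> I" "k \<in> I"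
  shows "(\<Sum>\<psi>\<in>I. S j \<psi> * cnj (S k \<psi>)) = (if j = k then 1 else 0)"
  unfolding S_col_orth[OF assms, symmetric]
  by (intro sum.cong refl) (simp add: S_symmetric assms)

lemma norm_col_S:
  assumes "\<xi>0 \<in> I" "\<psi> \<in> I" "j \<in> I"
  shows "norm_col I S \<xi>0 j \<psi> = of_int (pair_sign j * pair_sign \<xi>0) * (D \<psi> (J j) / D \<psi> (J \<xi>0))"
  using assms K_nonzero pair_sign_cases[of \<psi>] pair_sign_cases[of \<xi>0] by (auto simp: norm_col_def S_eq)

text \<open>Multiplication by the alternant of \<xi>0 clears denominators. The remaining discrepancy
  consists of signs, which are units in the integers.\<close>

lemma col_lattice_iff_L:
  assumes \<xi>0: "\<xi>0 \<in> I" "window a \<xi>0"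
  shows "f \<in> col_lattice I S \<xi>0 \<longleftrightarrow> f \<in> extensional I \<and> (\<lambda>\<psi>. f \<psi> * D \<psi> (J \<xi>0)) \<in> L"
proof -
  have *: "(\<Sum>j\<in>I. of_int (c j) * norm_col I S \<xi>0 j \<psi>) * D \<psi> (J \<xi>0)
      = (\<Sum>j\<in>I. of_int (c j * (pair_sign j * pair_sign \<xi>0)) * D \<psi> (J j))" if "\<psi> \<in> I" for \<psi> and c :: "_ \<Rightarrow> int"
    unfolding sum_distrib_right
    using window_nonzero[OF \<xi>0(2) that] by (intro sum.cong refl) (simp add: norm_col_S \<xi>0(1) that)
  show ?thesis
  proof safe
    assume f: "f \<in> col_lattice I S \<xi>0"
    show "f \<in> extensional I" by (rule col_lattice_extensional[OF f])
    obtain c :: "_ \<Rightarrow> int" where "\<And>i. i \<in> I \<Longrightarrow> f i = (\<Sum>j\<in>I. of_int (c j) * norm_col I S \<xi>0 j i)"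
      using f by (elim col_latticeE) blast
    then show "(\<lambda>\<psi>. f \<psi> * D \<psi> (J \<xi>0)) \<in> L"
      unfolding L_def using * by (intro CollectI exI[of _ "\<lambda>j. c j * (pair_sign j * pair_sign \<xi>0)"]) simp
  next
    assume f: "f \<in> extensional I" "(\<lambda>\<psi>. f \<psi> * D \<psi> (J \<xi>0)) \<in> L"
    then obtain c :: "_ \<Rightarrow> int" where c: "\<And>\<psi>. \<psi> \<in> I \<Longrightarrow> f \<psi> * D \<psi> (J \<xi>0) = (\<Sum>j\<in>I. of_int (c j) * D \<psi> (J j))"
      unfolding L_def by blast
    have "f \<psi> = (\<Sum>j\<in>I. of_int (c j * (pair_sign j * pair_sign \<xi>0)) * norm_col I S \<xi>0 j \<psi>)" if "\<psi> \<in> I" for \<psi>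
    proof -
      have cc: "c j * (pair_sign j * pair_sign \<xi>0) * (pair_sign j * pair_sign \<xi>0) = c j" for j
        using pair_sign_cases[of j] pair_sign_cases[of \<xi>0] by auto
      have "(\<Sum>j\<in>I. of_int (c j * (pair_sign j * pair_sign \<xi>0)) * norm_col I S \<xi>0 j \<psi>) * D \<psi> (J \<xi>0) = f \<psi> * D \<psi> (J \<xi>0)"
        unfolding *[OF that, of "\<lambda>j. c j * (pair_sign j * pair_sign \<xi>0)"] c[OF that] cc ..
      then show ?thesis
        using window_nonzero[OF \<xi>0(2) that] by simp
    qed
    then show "f \<in> col_lattice I S \<xi>0"
      using f(1) by (intro col_latticeI)
  qed
qed

lemma col_lattice_subset_M:
  assumes \<xi>0: "\<xi>0 \<in> I" "window a \<xi>0" and f: "f \<in> col_lattice I S \<xi>0"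
  shows "f \<in> M"
proof -
  obtain c :: "_ \<Rightarrow> int" where c: "\<And>i. i \<in> I \<Longrightarrow> f i = (\<Sum>j\<in>I. of_int (c j) * norm_col I S \<xi>0 j i)"
    using f by (elim col_latticeE) blast
  have "(\<lambda>\<psi>. \<Sum>j\<in>I. of_int (c j * (pair_sign j * pair_sign \<xi>0)) * (D \<psi> (J j) / D \<psi> (J \<xi>0))) \<in> M"
    by (intro M_sum M_scale M_quotient[OF \<xi>0(2)])
  then show ?thesis
    by (rule M_cong[rotated]) (simp add: c norm_col_S \<xi>0(1) mult.assoc)
qed

lemma defines_Z_algebra_S:
  assumes \<xi>0: "\<xi>0 \<in> I" "window a \<xi>0"
  shows "defines_Z_algebra I S \<xi>0"
  unfolding defines_Z_algebra_def
proof (intro conjI ballI)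
  show "S \<psi> \<xi>0 \<noteq> 0" if "\<psi> \<in> I" for \<psi>
    using window_nonzero[OF \<xi>0(2) that] K_nonzero pair_sign_cases[of \<psi>] pair_sign_cases[of \<xi>0]
    by (auto simp: S_eq that \<xi>0(1))
  fix f g assume f: "f \<in> col_lattice I S \<xi>0" and g: "g \<in> col_lattice I S \<xi>0"
  \<comment> \<open>The factor \<open>f\<close> acts as a multiplier on the element of
    \<open>L\<close> that belongs to \<open>g\<close>.\<close>
  have "(\<lambda>\<psi>. f \<psi> * (g \<psi> * D \<psi> (J \<xi>0))) \<in> L"
    using g unfolding col_lattice_iff_L[OF \<xi>0] by (intro M_L[OF col_lattice_subset_M[OF \<xi>0 f]]) (rule conjunct2)
  then show "(\<lambda>i\<in>I. f i * g i) \<in> col_lattice I S \<xi>0"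
    unfolding col_lattice_iff_L[OF \<xi>0] by (auto intro: L_cong[rotated])
qed (use S_row_orth finite_I \<xi>0(1) in auto)

section \<open>Complex conjugation\<close>

text \<open>Subtraction from this constant reverses the window
  \<open>a, ..., a + n - 1\<close>.\<close>

definition reflection :: "(nat \<Rightarrow> int) \<Rightarrow> nat \<Rightarrow> int" where
  "reflection a w = 2 * a w + int (card (fib Y \<pi> w)) - 1"

lemma D_reflect: "D \<psi> (\<lambda>y. reflection a (\<pi> y) - g y) = chi e (\<Sum>x\<in>Y. J \<psi> x * reflection a (\<pi> x)) * cnj (D \<psi> g)"
  using alt_shift[OF Y, where c = "reflection a" and g = "\<lambda>x. - g x"] by (simp add: cnj_alt)

lemma fib_inj_reflect: "fib_inj e Y \<pi> g \<Longrightarrow> fib_inj e Y \<pi> (\<lambda>y. reflection a (\<pi> y) - g y)"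
  unfolding fib_inj_def by (auto simp: cong_iff_dvd_diff dvd_diff_commute)

text \<open>Reversing the windows permutes their residues, hence the entries of \<xi>0.\<close>

lemma window_reflect:
  assumes "\<xi>0 \<in> I" "window a \<xi>0"
  obtains \<tau> where "\<tau> \<in> fib_perms Y \<pi>" "\<And>y. y \<in> Y \<Longrightarrow> [reflection a (\<pi> y) - J \<xi>0 y = J \<xi>0 (\<tau> y)] (mod int e)"
proof (rule match_residues[OF Y fib_inj_reflect[OF Xi_fib_inj[OF I_Xi[OF assms(1)]]], of a "J \<xi>0"])
  fix y assume y: "y \<in> Y"
  let ?A = "fib Y \<pi> (\<pi> y)" and ?w = "\<lambda>k. a (\<pi> y) + int k"
  have finA: "finite ?A" using Y by (auto simp: fib_def)
  have "\<forall>k\<in>{..<card ?A}. \<exists>y'\<in>?A. [J \<xi>0 y' = ?w k] (mod int e)"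
    using assms(2) y unfolding window_def by (fastforce simp: fib_def)
  then obtain h where h: "\<And>k. k < card ?A \<Longrightarrow> h k \<in> ?A \<and> [J \<xi>0 (h k) = ?w k] (mod int e)"
    by (metis lessThan_iff)
  \<comment> \<open>Since a fibre has at most \<open>e\<close> points, the residues of its window
    are distinct; by counting, every point of the fibre is some \<open>h k\<close>.\<close>
  have "inj_on h {..<card ?A}"
  proof (rule inj_onI)
    fix k k' assume k: "k \<in> {..<card ?A}" "k' \<in> {..<card ?A}" "h k = h k'"
    then have "[?w k = ?w k'] (mod int e)"
      using h[of k] h[of k'] by (auto intro: cong_trans cong_sym)
    then have "[k = k'] (mod e)"
      by (simp add: cong_add_lcancel cong_int_iff)
    then show "k = k'"
      using k(1,2) fib_le[of "\<pi> y"] by (auto intro!: cong_less_modulus_unique_nat)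
  qed
  then have "h ` {..<card ?A} = ?A"
    using h finA by (intro card_subset_eq) (auto simp: card_image)
  moreover have "y \<in> ?A" using y by (simp add: fib_def)
  ultimately obtain k where k: "k < card ?A" "y = h k"
    by (metis imageE lessThan_iff)
  have "[reflection a (\<pi> y) - J \<xi>0 y = reflection a (\<pi> y) - ?w k] (mod int e)"
    using h[OF k(1)] k(2) by (intro cong_diff) auto
  also have "reflection a (\<pi> y) - ?w k = ?w (card ?A - 1 - k)"
    using k(1) by (simp add: reflection_def of_nat_diff)
  finally have 1: "[reflection a (\<pi> y) - J \<xi>0 y = ?w (card ?A - 1 - k)] (mod int e)" .
  have "card ?A - 1 - k < card ?A"
    using k(1) by simp
  then obtain y' where y': "y' \<in> Y" "\<pi> y' = \<pi> y" "[J \<xi>0 y' = ?w (card ?A - 1 - k)] (mod int e)"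
    using assms(2) y unfolding window_def by blast
  then show "\<exists>y'\<in>Y. \<pi> y' = \<pi> y \<and> [reflection a (\<pi> y) - J \<xi>0 y = J \<xi>0 y'] (mod int e)"
    using cong_trans[OF 1 cong_sym[OF y'(3)]] by blast
qed (use that in blast)

text \<open>Reflecting twice restores the residue, and \<open>j\<close> has distinct residues in
  each fibre.\<close>

lemma reflect_involution:
  assumes "j \<in> Xi e Y \<pi>" "\<tau> \<in> fib_perms Y \<pi>" "\<And>y. y \<in> Y \<Longrightarrow> [reflection a (\<pi> y) - J j y = J j (\<tau> y)] (mod int e)"
  shows "\<tau> (\<tau> y) = y"
proof (cases "y \<in> Y")
  case True
  then have Y': "\<tau> y \<in> Y" "\<tau> (\<tau> y) \<in> Y" and p: "\<pi> (\<tau> y) = \<pi> y" "\<pi> (\<tau> (\<tau> y)) = \<pi> y"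
    using assms(2) by (simp_all add: fib_perms_in_Y fib_perms_fibre)
  have "[J j (\<tau> (\<tau> y)) = reflection a (\<pi> y) - J j (\<tau> y)] (mod int e)"
    using assms(3)[OF Y'(1)] p by (simp add: cong_sym)
  also have "[reflection a (\<pi> y) - J j (\<tau> y) = reflection a (\<pi> y) - (reflection a (\<pi> y) - J j y)] (mod int e)"
    by (intro cong_diff cong_refl cong_sym[OF assms(3)[OF True]])
  finally show ?thesis
    using Xi_fib_inj[OF assms(1)] Y' p True unfolding fib_inj_def by auto
next
  case False
  then show ?thesis
    using permutes_not_in[OF fib_perms_permutes[OF assms(2)]] by simp
qed

text \<open>For even \<open>n\<close> a fixed point would need \<open>2 j \<equiv> 2 a + n - 1 (mod e)\<close>; this is impossible
  for even \<open>e\<close>, and for odd \<open>e\<close> it has a unique solution, which parity excludes.\<close>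

lemma reflect_fixed_points:
  assumes j: "j \<in> Xi e Y \<pi>" and \<tau>: "\<tau> \<in> fib_perms Y \<pi>"
    and eq: "\<And>y. y \<in> Y \<Longrightarrow> [reflection a (\<pi> y) - J j y = J j (\<tau> y)] (mod int e)"
  shows "card {y \<in> fib Y \<pi> w. \<tau> y = y} = card (fib Y \<pi> w) mod 2"
proof -
  let ?A = "fib Y \<pi> w"
  define n where "n = card ?A"
  define F where "F = {y \<in> ?A. \<tau> y = y}"
  have finA: "finite ?A" using Y by (auto simp: fib_def)
  have "restrict_id \<tau> ?A permutes ?A"
    by (rule permutes_restrict_id[OF fib_perms_bij_fib[OF \<tau>]])
  moreover have "restrict_id \<tau> ?A (restrict_id \<tau> ?A y) = y" for y
    using reflect_involution[OF j \<tau> eq] bij_betwE[OF fib_perms_bij_fib[OF \<tau>, of w]]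
    by (cases "y \<in> ?A") auto
  ultimately have "even (card {y. restrict_id \<tau> ?A y \<noteq> y})"
    using sign_involution(1)[OF finA] by blast
  moreover have "{y. restrict_id \<tau> ?A y \<noteq> y} = ?A - F"
    by (auto simp: F_def restrict_id_def)
  moreover have "card (?A - F) = n - card F" "card F \<le> n"
    using finA by (auto simp: F_def n_def card_Diff_subset intro: card_mono)
  ultimately have parity: "even n \<longleftrightarrow> even (card F)"
    by auto
  define s where "s = reflection a w mod int e"
  have s: "0 \<le> s" "s < int e" using e by (auto simp: s_def)
  \<comment> \<open>At a fixed point twice the entry is congruent to \<open>s\<close> and lies in
    \<open>[0, 2e)\<close>, which leaves two possibilities.\<close>
  have F: "2 * J j y = s \<or> 2 * J j y = s + int e" if "y \<in> F" for y
  proof -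
    have y: "y \<in> Y" "\<pi> y = w" "\<tau> y = y" using that by (auto simp: F_def fib_def)
    have "[reflection a w = 2 * J j y] (mod int e)"
      using eq[OF y(1)] y by (simp add: cong_iff_dvd_diff algebra_simps)
    then have "s = (2 * J j y) mod int e" by (simp add: cong_def s_def)
    moreover have "0 \<le> 2 * J j y" "2 * J j y < 2 * int e"
      using Xi_less[OF j y(1)] by auto
    moreover have "(2 * J j y - int e) mod int e = 2 * J j y mod int e"
      by simp
    ultimately show ?thesis
      using mod_pos_pos_trivial[of "2 * J j y" "int e"] mod_pos_pos_trivial[of "2 * J j y - int e" "int e"]
      by (cases "2 * J j y < int e") linarith+
  qed
  have le1: "card {y \<in> F. 2 * J j y = z} \<le> 1" for z
  proof -
    have "y = y'" if "y \<in> {y \<in> F. 2 * J j y = z}" "y' \<in> {y \<in> F. 2 * J j y = z}" for y y'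
      using that inj_onD[OF Xi_inj_on[OF j, of w], of y y'] by (auto simp: F_def)
    then show ?thesis
      by (metis (no_types, lifting) card_le_Suc0_iff_eq One_nat_def card.infinite le0)
  qed
  have "F \<subseteq> {y \<in> F. 2 * J j y = s} \<union> {y \<in> F. 2 * J j y = s + int e}"
    using F by auto
  then have card_F: "card F \<le> card {y \<in> F. 2 * J j y = s} + card {y \<in> F. 2 * J j y = s + int e}"
    using finA by (intro order_trans[OF card_mono card_Un_le]) (auto simp: F_def)
  have "card F = n mod 2"
  proof (cases "even n")
    case True
    then have odd_s: "odd (reflection a w)"
      by (simp add: reflection_def n_def)
    \<comment> \<open>If both values occurred, \<open>s\<close> and \<open>e\<close> would be even,
      and so would the reflection constant, which is odd for even \<open>n\<close>.\<close>
    have "{y \<in> F. 2 * J j y = s} = {} \<or> {y \<in> F. 2 * J j y = s + int e} = {}"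
    proof (rule ccontr)
      assume "\<not> ?thesis"
      then obtain y y' where "2 * J j y = s" "2 * J j y' = s + int e" by auto
      then have "even s" "even (int e)" by presburger+
      then have "even (reflection a w)"
        unfolding s_def by (simp add: dvd_mod_iff)
      then show False using odd_s by simp
    qed
    then have "card {y \<in> F. 2 * J j y = s} = 0 \<or> card {y \<in> F. 2 * J j y = s + int e} = 0"
      by (elim disjE) (simp_all only: card.empty simp_thms)
    then have "card F \<le> 1" using card_F le1[of s] le1[of "s + int e"] by linarith
    then show ?thesis using True parity by (cases "card F") auto
  next
    case False
    have "card F \<le> 2" using card_F le1[of s] le1[of "s + int e"] by linarith
    moreover have "odd (card F)" using False parity by simp
    ultimately have "card F = 1" by (cases "card F") auto
    then show ?thesis using False by (simp add: odd_iff_mod_2_eq_one)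
  qed
  then show ?thesis by (simp add: F_def n_def)
qed

text \<open>The sign of an involution depends on its number of moved points, which here is
  determined by the fibre sizes.\<close>

lemma reflect_sign_eq:
  assumes j: "j \<in> Xi e Y \<pi>" "\<tau> \<in> fib_perms Y \<pi>" "\<And>y. y \<in> Y \<Longrightarrow> [reflection a (\<pi> y) - J j y = J j (\<tau> y)] (mod int e)"
    and k: "k \<in> Xi e Y \<pi>" "\<rho> \<in> fib_perms Y \<pi>" "\<And>y. y \<in> Y \<Longrightarrow> [reflection a (\<pi> y) - J k y = J k (\<rho> y)] (mod int e)"
  shows "sign \<tau> = sign \<rho>"
proof -
  have supp: "card {y. \<tau> y \<noteq> y} = card Y - (\<Sum>w\<in>\<pi> ` Y. card (fib Y \<pi> w) mod 2)"
    if *: "j \<in> Xi e Y \<pi>" "\<tau> \<in> fib_perms Y \<pi>" "\<And>y. y \<in> Y \<Longrightarrow> [reflection a (\<pi> y) - J j y = J j (\<tau> y)] (mod int e)"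
    for j \<tau>
  proof -
    have "{y. \<tau> y \<noteq> y} = Y - {y \<in> Y. \<tau> y = y}"
      using permutes_not_in[OF fib_perms_permutes[OF *(2)]] by auto
    then have "card {y. \<tau> y \<noteq> y} = card Y - card {y \<in> Y. \<tau> y = y}"
      using Y by (simp add: card_Diff_subset)
    also have "card {y \<in> Y. \<tau> y = y} = (\<Sum>w\<in>\<pi> ` Y. card {y \<in> fib Y \<pi> w. \<tau> y = y})"
    proof -
      have "{y \<in> Y. \<tau> y = y} = (\<Union>w\<in>\<pi> ` Y. {y \<in> fib Y \<pi> w. \<tau> y = y})"
        by (auto simp: fib_def)
      then show ?thesis
        using Y by (simp only:) (rule card_UN_disjoint, auto simp: fib_def)
    qed
    finally show ?thesis
      by (simp add: reflect_fixed_points[OF *])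
  qed
  have "sign \<tau> = (- 1) ^ (card {y. \<tau> y \<noteq> y} div 2)"
    by (intro sign_involution(2)[OF Y fib_perms_permutes[OF j(2)]] reflect_involution[OF j])
  moreover have "sign \<rho> = (- 1) ^ (card {y. \<rho> y \<noteq> y} div 2)"
    by (intro sign_involution(2)[OF Y fib_perms_permutes[OF k(2)]] reflect_involution[OF k])
  ultimately show ?thesis
    by (simp add: supp[OF j] supp[OF k])
qed

text \<open>Conjugation and reflection of an alternant differ by a character value independent of
  \<open>g\<close>, which cancels in the quotient; the sign comes from rearranging the reflected
  \<xi>0.\<close>

lemma cnj_quotient:
  assumes \<xi>0: "\<xi>0 \<in> I" "window a \<xi>0"
    and \<tau>: "\<tau> \<in> fib_perms Y \<pi>" "\<And>y. y \<in> Y \<Longrightarrow> [reflection a (\<pi> y) - J \<xi>0 y = J \<xi>0 (\<tau> y)] (mod int e)"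
    and \<psi>: "\<psi> \<in> I"
  shows "cnj (D \<psi> g / D \<psi> (J \<xi>0)) = of_int (sign \<tau>) * (D \<psi> (\<lambda>y. reflection a (\<pi> y) - g y) / D \<psi> (J \<xi>0))"
proof -
  let ?c = "chi e (\<Sum>x\<in>Y. J \<psi> x * reflection a (\<pi> x))"
  have "cnj (D \<psi> g / D \<psi> (J \<xi>0)) = (?c * cnj (D \<psi> g)) / (?c * cnj (D \<psi> (J \<xi>0)))"
    by simp
  also have "\<dots> = D \<psi> (\<lambda>y. reflection a (\<pi> y) - g y) / (of_int (sign \<tau>) * D \<psi> (J \<xi>0))"
    using alt_match[where h = "J \<xi>0" and g = "\<lambda>y. reflection a (\<pi> y) - J \<xi>0 y", OF \<tau>, of \<psi>]
    by (simp add: D_reflect[symmetric])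
  also have "\<dots> = of_int (sign \<tau>) * (D \<psi> (\<lambda>y. reflection a (\<pi> y) - g y) / D \<psi> (J \<xi>0))"
    using sign_eq_1_or_minus_1[of \<tau>] by auto
  finally show ?thesis .
qed

lemma cnj_norm_col:
  assumes \<xi>0: "\<xi>0 \<in> I" "window a \<xi>0" and j: "j \<in> I"
  shows "\<exists>k\<in>I. \<exists>s\<in>{1, -1 :: int}. \<forall>\<psi>\<in>I. cnj (norm_col I S \<xi>0 j \<psi>) = of_int s * norm_col I S \<xi>0 k \<psi>"
proof -
  obtain \<tau> where \<tau>: "\<tau> \<in> fib_perms Y \<pi>" "\<And>y. y \<in> Y \<Longrightarrow> [reflection a (\<pi> y) - J \<xi>0 y = J \<xi>0 (\<tau> y)] (mod int e)"
    using window_reflect[OF \<xi>0] by blast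
  \<comment> \<open>Reflection conjugates the alternant and multiplies it by a non-zero number, so
    \<open>reduce\<close> applies.\<close>
  have "\<exists>\<psi>\<in>I. D \<psi> (\<lambda>y. reflection a (\<pi> y) - J j y) \<noteq> 0"
    using D_nonzero[OF j] by (simp add: D_reflect)
  then obtain k s where k: "k \<in> I" "s \<in> {1, -1 :: int}"
    and eq: "\<And>\<psi>. \<psi> \<in> I \<Longrightarrow> D \<psi> (\<lambda>y. reflection a (\<pi> y) - J j y) = of_int s * D \<psi> (J k)"
    by (rule reduce) blast
  \<comment> \<open>Collects the signs of both columns, of \<tau> and of straightening; that of
    \<xi>0 is common to both sides.\<close>
  define u where "u = pair_sign j * pair_sign k * sign \<tau> * s"
  have "cnj (norm_col I S \<xi>0 j \<psi>) = of_int u * norm_col I S \<xi>0 k \<psi>" if "\<psi> \<in> I" for \<psi>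
  proof -
    have "cnj (norm_col I S \<xi>0 j \<psi>)
        = of_int (pair_sign j * pair_sign \<xi>0) * (of_int (sign \<tau>) * (of_int s * D \<psi> (J k) / D \<psi> (J \<xi>0)))"
      by (simp only: norm_col_S[OF \<xi>0(1) that j] complex_cnj_mult complex_cnj_of_int
        cnj_quotient[OF \<xi>0 \<tau> that] eq[OF that])
    also have "\<dots> = of_int u * norm_col I S \<xi>0 k \<psi>"
      unfolding norm_col_S[OF \<xi>0(1) that k(1)] using pair_sign_cases[of k] by (auto simp: u_def)
    finally show ?thesis .
  qed
  moreover have "u \<in> {1, -1}"
    using pair_sign_cases[of j] pair_sign_cases[of k] sign_eq_1_or_minus_1[of \<tau>] k(2) by (auto simp: u_def)
  ultimately show ?thesis using k(1) by blast
qed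

text \<open>If conjugation negated the column of \<open>j\<close>, its reflection would straighten
  to \<open>j\<close> itself with a sign opposite to that of \<tau>. But reflected \<open>j\<close>
  and reflected \<xi>0 are rearranged by involutions of equal sign.\<close>

lemma cnj_norm_col_neq_minus:
  assumes \<xi>0: "\<xi>0 \<in> I" "window a \<xi>0" and j: "j \<in> I"
  shows "\<not> (\<forall>\<psi>\<in>I. cnj (norm_col I S \<xi>0 j \<psi>) = - norm_col I S \<xi>0 j \<psi>)"
proof
  assume neg: "\<forall>\<psi>\<in>I. cnj (norm_col I S \<xi>0 j \<psi>) = - norm_col I S \<xi>0 j \<psi>"
  obtain \<tau> where \<tau>: "\<tau> \<in> fib_perms Y \<pi>" "\<And>y. y \<in> Y \<Longrightarrow> [reflection a (\<pi> y) - J \<xi>0 y = J \<xi>0 (\<tau> y)] (mod int e)"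
    using window_reflect[OF \<xi>0] by blast
  let ?g = "\<lambda>y. reflection a (\<pi> y) - J j y"
  \<comment> \<open>Reflection preserves the entries of \<xi>0 modulo \<open>e\<close>, so the
    reflection constants sum to \<open>2t\<close> and the reflected \<open>j\<close> again has sum
    \<open>t\<close>, modulo \<open>e\<close>.\<close>
  have "[(\<Sum>y\<in>Y. reflection a (\<pi> y) - J \<xi>0 y) = (\<Sum>y\<in>Y. J \<xi>0 (\<tau> y))] (mod int e)"
    by (rule cong_sum) (rule \<tau>(2))
  also have "(\<Sum>y\<in>Y. J \<xi>0 (\<tau> y)) = (\<Sum>y\<in>Y. J \<xi>0 y)"
    by (rule sum.reindex_bij_betw[OF fib_perms_bij[OF \<tau>(1)]])
  finally have "[(\<Sum>y\<in>Y. reflection a (\<pi> y) - J \<xi>0 y) + ((\<Sum>y\<in>Y. J \<xi>0 y) - (\<Sum>y\<in>Y. J j y))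
      = (\<Sum>y\<in>Y. J \<xi>0 y) + ((\<Sum>y\<in>Y. J \<xi>0 y) - (\<Sum>y\<in>Y. J j y))] (mod int e)"
    by (intro cong_add cong_refl)
  moreover have "[(\<Sum>y\<in>Y. J \<xi>0 y) + ((\<Sum>y\<in>Y. J \<xi>0 y) - (\<Sum>y\<in>Y. J j y)) = t + (t - t)] (mod int e)"
    by (intro cong_add cong_diff I_sum \<xi>0(1) j)
  ultimately have "[(\<Sum>y\<in>Y. reflection a (\<pi> y) - J \<xi>0 y) + ((\<Sum>y\<in>Y. J \<xi>0 y) - (\<Sum>y\<in>Y. J j y)) = t + (t - t)] (mod int e)"
    by (rule cong_trans)
  then   have "[(\<Sum>y\<in>Y. ?g y) = t] (mod int e)"
    by (simp add: sum_subtractf)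
  \<comment> \<open>The sum is already right, so no shift intervenes and the sign of \<rho> is the
    whole straightening sign.\<close>
  with fib_inj_reflect[OF Xi_fib_inj[OF I_Xi[OF j]], of a] obtain k \<rho>
    where k: "k \<in> I" "\<rho> \<in> fib_perms Y \<pi>" "\<And>y. y \<in> Y \<Longrightarrow> [?g y = J k (\<rho> y)] (mod int e)"
    by (rule reduce_exact) blast
  have "D \<psi> (J k) = of_int (- sign \<rho> * sign \<tau>) * D \<psi> (J j)" if "\<psi> \<in> I" for \<psi>
  proof -
    have "D \<psi> ?g = of_int (sign \<rho>) * D \<psi> (J k)"
      by (intro alt_match k)
    moreover have *: "cnj z = - z" if "cnj (of_int u * z) = - (of_int u * z)" "u \<in> {1, -1}" for u z
    proof -
      have "of_int u * cnj z = of_int u * - z"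
        using that(1) by (simp only: complex_cnj_mult complex_cnj_of_int mult_minus_right)
      then show ?thesis
        using that(2) unfolding mult_cancel_left by auto
    qed
    have "cnj (D \<psi> (J j) / D \<psi> (J \<xi>0)) = - (D \<psi> (J j) / D \<psi> (J \<xi>0))"
    proof (rule *)
      show "cnj (of_int (pair_sign j * pair_sign \<xi>0) * (D \<psi> (J j) / D \<psi> (J \<xi>0)))
          = - (of_int (pair_sign j * pair_sign \<xi>0) * (D \<psi> (J j) / D \<psi> (J \<xi>0)))"
        using neg[rule_format, OF that] unfolding norm_col_S[OF \<xi>0(1) that j] .
      show "pair_sign j * pair_sign \<xi>0 \<in> {1, -1}"
        using pair_sign_cases[of j] pair_sign_cases[of \<xi>0] by auto
    qed
    then have "of_int (sign \<tau>) * (D \<psi> ?g / D \<psi> (J \<xi>0)) = - (D \<psi> (J j) / D \<psi> (J \<xi>0))"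
      using cnj_quotient[OF \<xi>0 \<tau> that, of "J j"] by simp
    then have "of_int (sign \<tau>) * D \<psi> ?g = - D \<psi> (J j)"
      using window_nonzero[OF \<xi>0(2) that] by (simp add: field_simps)
    ultimately show ?thesis
      using sign_eq_1_or_minus_1[of \<tau>] sign_eq_1_or_minus_1[of \<rho>] by auto
  qed
  from D_proportional[OF j k(1) this] have kj: "k = j" and s: "complex_of_int (- sign \<rho> * sign \<tau>) = of_int 1"
    by auto
  have "sign \<rho> = sign \<tau>"
    by (rule reflect_sign_eq[where j = j and k = \<xi>0 and a = a])
       (use k kj \<tau> I_Xi[OF j] I_Xi[OF \<xi>0(1)] in auto)
  then show False
    using s unfolding of_int_eq_iff by simp
qed

section \<open>Existence of the unit column and assembly\<close>

text \<open>All windows may start at the same integer: since \<open>card Y\<close> is 1 modulo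
  \<open>e\<close>, a common start \<open>k\<close> adjusts the sum of entries to any prescribed
  residue.\<close>

lemma exists_window_symbol:
  "\<exists>a. \<exists>\<xi>0\<in>I. symb Y \<pi> \<xi>0 = interval_symb e Y \<pi> a"
proof -
  have "\<exists>h. bij_betw h (fib Y \<pi> w) {0..<card (fib Y \<pi> w)}" for w
    using Y by (intro ex_bij_betw_finite_nat) (auto simp: fib_def)
  then obtain h where h: "\<And>w. bij_betw (h w) (fib Y \<pi> w) {0..<card (fib Y \<pi> w)}"
    by metis
  define k where "k = t - (\<Sum>y\<in>Y. int (h (\<pi> y) y))"
  define g where "g y = k + int (h (\<pi> y) y)" for y
  have "(\<Sum>y\<in>Y. g y) = (int e * int m + 1) * k + (\<Sum>y\<in>Y. int (h (\<pi> y) y))"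
    by (simp add: g_def sum.distrib cY)
  also have "\<dots> = t + int e * (int m * k)"
    by (simp add: k_def algebra_simps)
  finally have "[(\<Sum>y\<in>Y. g y) = t] (mod int e)"
    by (simp add: cong_def)
  have h_less: "h (\<pi> y) y < e" if "y \<in> Y" for y
    using bij_betwE[OF h[of "\<pi> y"]] fib_le[of "\<pi> y"] that by (fastforce simp: fib_def)
  have "fib_inj e Y \<pi> g"
    unfolding fib_inj_def
  proof (intro ballI impI)
    fix y y' assume y: "y \<in> Y" "y' \<in> Y" "\<pi> y = \<pi> y' \<and> [g y = g y'] (mod int e)"
    then have "h (\<pi> y) y = h (\<pi> y) y'"
      using h_less[of y] h_less[of y'] by (intro nat_cong_imp_eq[of _ _ e]) (auto simp: g_def cong_add_lcancel)
    then show "y = y'"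
      using y inj_onD[OF bij_betw_imp_inj_on[OF h[of "\<pi> y"]]] by (auto simp: fib_def)
  qed
  then obtain \<xi>0 \<tau> where *: "\<xi>0 \<in> I" "\<tau> \<in> fib_perms Y \<pi>" "\<And>y. y \<in> Y \<Longrightarrow> [g y = J \<xi>0 (\<tau> y)] (mod int e)"
    using \<open>[(\<Sum>y\<in>Y. g y) = t] (mod int e)\<close> by (rule reduce_exact) blast
  let ?r = "\<lambda>i. nat ((k + int i) mod int e)"
  have "sorted_list_of_set (\<xi>0 ` fib Y \<pi> w) = sort (map ?r [0..<card (fib Y \<pi> w)])" for w
  proof -
    have eq: "\<xi>0 (\<tau> y) = ?r (h w y)" if "y \<in> fib Y \<pi> w" for y
    proof -
      have y: "y \<in> Y" "\<pi> y = w" "\<tau> y \<in> Y" using that *(2) by (auto simp: fib_def fib_perms_in_Y)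
      have "g y mod int e = J \<xi>0 (\<tau> y)"
        using *(3)[OF y(1)] Xi_less[OF I_Xi[OF *(1)] y(3)] by (simp add: cong_def)
      then show ?thesis by (simp add: g_def y)
    qed
    have "\<xi>0 ` fib Y \<pi> w = \<xi>0 ` \<tau> ` fib Y \<pi> w"
      using fib_perms_bij_fib[OF *(2), of w] by (simp add: bij_betw_def)
    also have "\<dots> = ?r ` h w ` fib Y \<pi> w"
      unfolding image_image by (intro image_cong refl eq)
    also have "h w ` fib Y \<pi> w = {0..<card (fib Y \<pi> w)}"
      using h[of w] by (simp add: bij_betw_def)
    finally have set: "\<xi>0 ` fib Y \<pi> w = set (map ?r [0..<card (fib Y \<pi> w)])" by simp
    \<comment> \<open>The list has as many values as entries, so sorting the set of its values loses
      no repetition.\<close>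
    have "distinct (map ?r [0..<card (fib Y \<pi> w)])"
    proof -
      have "card (set (map ?r [0..<card (fib Y \<pi> w)])) = length (map ?r [0..<card (fib Y \<pi> w)])"
        unfolding set[symmetric] using card_image[OF Xi_inj_on[OF I_Xi[OF *(1)]]] by simp
      then show ?thesis by (rule card_distinct)
    qed
    then show ?thesis
      unfolding set by (simp only: sorted_list_of_set_sort_remdups remdups_id_iff_distinct[THEN iffD2])
  qed
  then have "symb Y \<pi> \<xi>0 = interval_symb e Y \<pi> (\<lambda>_. k)"
    by (auto simp: symb_def interval_symb_def)
  then show ?thesis using *(1) by blast
qed

lemma window_of_symb:
  assumes "symb Y \<pi> \<xi>0 = interval_symb e Y \<pi> a"
  shows "window a \<xi>0"
  unfolding window_def
proof (intro ballI allI impI)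
  fix y k assume y: "y \<in> Y" and k: "k < card (fib Y \<pi> (\<pi> y))"
  have fin: "finite (fib Y \<pi> (\<pi> y))" using Y by (auto simp: fib_def)
  have "sorted_list_of_set (\<xi>0 ` fib Y \<pi> (\<pi> y))
      = sort (map (\<lambda>k. nat ((a (\<pi> y) + int k) mod int e)) [0..<card (fib Y \<pi> (\<pi> y))])"
    using fun_cong[OF assms, of "\<pi> y"] y by (simp add: symb_def interval_symb_def)
  from arg_cong[OF this, of set]
  have "\<xi>0 ` fib Y \<pi> (\<pi> y) = (\<lambda>k. nat ((a (\<pi> y) + int k) mod int e)) ` {0..<card (fib Y \<pi> (\<pi> y))}"
    using fin by simp
  then have "nat ((a (\<pi> y) + int k) mod int e) \<in> \<xi>0 ` fib Y \<pi> (\<pi> y)"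
    using k by auto
  then obtain y' where "y' \<in> fib Y \<pi> (\<pi> y)" "\<xi>0 y' = nat ((a (\<pi> y) + int k) mod int e)"
    by auto
  then show "\<exists>y'\<in>Y. \<pi> y' = \<pi> y \<and> [J \<xi>0 y' = a (\<pi> y) + int k] (mod int e)"
    using e by (intro bexI[of _ y']) (auto simp: fib_def cong_def)
qed

end

text \<open>The first conjunct ensures that the second, which treats every admissible choice of
  \<open>a\<close> and \<xi>0, is not vacuous.\<close>

theorem theorem5p3:
  fixes e m :: nat
    and Y :: "'a::linorder set"
    and \<pi> :: "'a \<Rightarrow> nat"
  assumes "e \<ge> 1"
    and "finite Y"
    and "card Y = e * m + 1"
    and "\<forall>w. card (fib Y \<pi> w) \<le> e"
  shows "(\<exists>a. \<exists>\<xi>0 \<in> E' e m Y \<pi>. symb Y \<pi> \<xi>0 = interval_symb e Y \<pi> a) \<and>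
    (\<forall>a. \<forall>\<xi>0 \<in> E' e m Y \<pi>. symb Y \<pi> \<xi>0 = interval_symb e Y \<pi> a \<longrightarrow>
      (let I = E' e m Y \<pi>;
           R = mat_alg I (Smat e m Y \<pi>) \<xi>0;
           b = norm_col I (Smat e m Y \<pi>) \<xi>0
       in defines_Z_algebra I (Smat e m Y \<pi>) \<xi>0 \<and>
          cring R \<and> inj_on b I \<and> Z_basis R (b ` I) \<and>
          (\<exists>\<eta> :: ('a \<Rightarrow> nat) \<Rightarrow> int. (\<forall>\<xi>\<in>I. \<eta> \<xi> \<in> {1, -1}) \<and>
             Z_based_ring R ((\<lambda>\<xi>. [\<eta> \<xi>] \<cdot>\<^bsub>R\<^esub> b \<xi>) ` I))))"
proof -
  interpret fourier_data e m Y \<pi>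
    using assms by unfold_locales auto
  show ?thesis
    unfolding Let_def
  proof (intro conjI allI ballI impI)
    fix a \<xi>0 assume \<xi>0: "\<xi>0 \<in> I" and symb: "symb Y \<pi> \<xi>0 = interval_symb e Y \<pi> a"
    note w = \<xi>0 window_of_symb[OF symb]
    show alg: "defines_Z_algebra I S \<xi>0"
      by (rule defines_Z_algebra_S[OF w])
    then show "cring (mat_alg I S \<xi>0)"
      by (rule cring_mat_alg)
    \<comment> \<open>Unitarity, stability under conjugation up to sign, and the exclusion of the
      sign -1 on fixed columns enter the general criterion.\<close>
    note based = Z_based_ring_mat_alg[OF alg S_col_orth cnj_norm_col[OF w] cnj_norm_col_neq_minus[OF w]]
    show "inj_on (norm_col I S \<xi>0) I"
      by (rule based(1))
    show "Z_basis (mat_alg I S \<xi>0) (norm_col I S \<xi>0 ` I)"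
      by (rule based(2))
    show "\<exists>\<eta> :: ('a \<Rightarrow> nat) \<Rightarrow> int. (\<forall>\<xi>\<in>I. \<eta> \<xi> \<in> {1, -1}) \<and>
        Z_based_ring (mat_alg I S \<xi>0) ((\<lambda>\<xi>. [\<eta> \<xi>] \<cdot>\<^bsub>mat_alg I S \<xi>0\<^esub> norm_col I S \<xi>0 \<xi>) ` I)"
      by (rule based(3))
  qed (rule exists_window_symbol)
qed

end
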